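(* Let $p>3$ be a prime with $p\equiv 3 \pmod 4$, and let $b\ge 2$ be an integer with $p\nmid b$ that is a quadratic residue modulo $p$. Let $d$ be the order of $b$ in $(\mathbb{Z}/p\mathbb{Z})^{\times}$, let $g$ be a primitive root modulo $p$, and for $j=0,\ldots,(p-1)/(2d)-1$ let $b_j=(g^{2j})_p$. Let $$\frac{b_j}{p}=\sum_{k=1}^{\infty}a_k^{(j)}b^{-k},\qquad a_k^{(j)}\in\{0,1,\ldots,b-1\},$$ be the digit expansion of $b_j/p$ with respect to the basis $b$, which is periodic with period $(a_1^{(j)},a_2^{(j)},\ldots,a_d^{(j)})$, and let $$S_j=a_1^{(j)}+a_2^{(j)}+\cdots+a_d^{(j)},\qquad j=0,\ldots,(p-1)/(2d)-1,$$ be the sum of the digits of this period. Then $$S_0+S_1+\cdots+S_{(p-1)/(2d)-1}=\frac{(b-1)(p-1)}{4}-\frac{(b-1)h_2^-}{2}.$$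
   Context: For an integer $k$, $(k)_p$ denotes the number $j\in\{0,1,\ldots,p-1\}$ with $j\equiv k\pmod p$. $h_2^-$ denotes the relative class number of the imaginary quadratic field $\mathbb{Q}(\sqrt{-p})$, which equals its class number. The digits of the expansion of $b_j/p$ are given by $a_k^{(j)}=\theta_b(b_jb^{k-1})$, where $\theta_b(k)=\bigl(b(k)_p-(bk)_p\bigr)/p$ for $k\in\mathbb{Z}$. *)

theory Defs
  imports
    Complex_Main
    "HOL-Computational_Algebra.Polynomial"
    "HOL-Algebra.Ideal"
    "HOL-Number_Theory.Number_Theory"
begin

definition quadratic_field :: "int \<Rightarrow> complex set" where
  "quadratic_field D = {x + y * csqrt (of_int D) | x y. x \<in> \<rat> \<and> y \<in> \<rat>}"

text \<open>The ring of algebraic integers of a number field that is given as a subset of the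
  complex numbers.\<close>

definition ring_of_integers :: "complex set \<Rightarrow> complex ring" where
  "ring_of_integers K =
     \<lparr>carrier = {z \<in> K. algebraic_int z}, mult = (*), one = 1, zero = 0, add = (+)\<rparr>"

definition nonzero_ideals :: "('a, 'b) ring_scheme \<Rightarrow> 'a set set" where
  "nonzero_ideals R = {I. ideal I R \<and> I \<noteq> {\<zero>\<^bsub>R\<^esub>}}"

text \<open>Two nonzero ideals \<open>I\<close> and \<open>J\<close> of a domain lie in the same ideal class iff
  \<open>a I = b J\<close> for some nonzero ring elements \<open>a\<close> and \<open>b\<close>, that is, iff they
  differ by a principal fractional ideal. For a Dedekind domain the classes of this relation
  are the elements of the ideal class group.\<close>

definition ideal_class_rel :: "('a, 'b) ring_scheme \<Rightarrow> ('a set \<times> 'a set) set" where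
  "ideal_class_rel R =
     {(I, J) \<in> nonzero_ideals R \<times> nonzero_ideals R.
        \<exists>a\<in>carrier R - {\<zero>\<^bsub>R\<^esub>}. \<exists>b\<in>carrier R - {\<zero>\<^bsub>R\<^esub>}.
          (\<lambda>x. a \<otimes>\<^bsub>R\<^esub> x) ` I = (\<lambda>x. b \<otimes>\<^bsub>R\<^esub> x) ` J}"

definition class_number :: "complex set \<Rightarrow> nat" where
  "class_number K =
     card (nonzero_ideals (ring_of_integers K) // ideal_class_rel (ring_of_integers K))"

text \<open>The quotient \<open>h / h\<^sup>+\<close>, where \<open>h\<^sup>+\<close> is the class number of the maximal
  real subfield. If \<open>K\<close> is imaginary quadratic, this subfield is \<open>\<rat>\<close>, so that
  \<open>h\<^sup>+ = 1\<close>.\<close>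

definition relative_class_number :: "complex set \<Rightarrow> real" where
  "relative_class_number K = real (class_number K) / real (class_number (K \<inter> \<real>))"

end

theory Submission
  imports
    Defs
    "HOL-Analysis.Analysis"
    "HOL-Real_Asymp.Real_Asymp"
    "HOL-Computational_Algebra.Nth_Powers"
begin

text \<open>The digits satisfy \<open>p a\<^sub>k\<^sub>+\<^sub>1 = b r\<^sub>k - r\<^sub>k\<^sub>+\<^sub>1\<close>, where \<open>r\<^sub>k\<close> is the residue of
  \<open>b\<^sub>j b\<^sup>k\<close> modulo \<open>p\<close>. As \<open>j\<close> and \<open>k\<close> vary, these residues run exactly once through the
  quadratic residues, so the digit sums telescope to \<open>(b - 1)/p\<close> times the sum of the quadratic
  residues, and everything reduces to the class number formula \<open>p h = - \<Sum> d \<chi>(d)\<close>.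

  The class number formula is obtained by computing the constant term of
  \<open>Z(t) = \<Sum> exp(- t N(I))\<close>, the sum being over all nonzero ideals \<open>I\<close>, as \<open>t\<close> tends to \<open>0\<close>
  from above, in two ways. The ideals in the class of \<open>J\<close> are the \<open>\<gamma> J\<close> with nonzero \<open>\<gamma>\<close> in
  the lattice of all \<open>\<gamma>\<close> such that \<open>\<gamma> J\<close> is integral, and \<open>\<gamma>\<close> is unique up to sign. A Gaussian sum
  over a full lattice is \<open>c/t + o(1)\<close>, and leaving out \<open>\<gamma> = 0\<close> contributes \<open>- 1\<close>; hence every class
  has constant term \<open>- 1/2\<close>. On the other hand, there are \<open>\<Sum> \<chi>(d)\<close>, summed over \<open>d\<close> dividing \<open>n\<close>,
  ideals of norm \<open>n\<close>, so \<open>Z\<close> is a Lambert series, whose constant term is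
  \<open>(\<Sum> d \<chi>(d)) / (2 p)\<close> by Euler-Maclaurin summation. This corresponds to the evaluation of the
  zeta function at \<open>0\<close>, and neither the value of \<open>L(1, \<chi>)\<close> nor the sign of the Gauss sum is
  needed.\<close>

section \<open>Euler-Maclaurin summation\<close>

text \<open>The delicate point is the error o(1) for a Gaussian sum over a plane lattice. It is
  summed row by row: about t^(-1/2) rows carry weight and each has its own real shift, so a single
  row needs an error o(t^(1/2)), uniformly in the shift. Hence the Euler-Maclaurin formula with an
  explicit fourth-order error; it serves the Lambert series as well. The coefficients of 1/t stay
  unevaluated integrals: two expansions c/t + u + o(1) of one function share the same u.

  Norms are read off from covolumes, so that N(\<gamma> J) = |\<gamma>|^2 N(J) also for \<gamma>
  outside the ring. Every ideal has a unique normal form c (a Z + (b + omega) Z) with a dividing b^2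
  + b + m, where m = (p + 1)/4, and its norm is c^2 a. Counting ideals of norm n thus becomes a
  Dirichlet convolution of the indicator of squares with the number of roots of x^2 + x + m. This is
  multiplicative, and so is the divisor sum of the character, so that they need comparison only at
  prime powers, where quadratic reciprocity enters. The bound p > 3 leaves the units 1 and -1 only,
  which is the source of the factor 1/2.\<close>

lemma trapezoid_step:
  fixes D :: "nat \<Rightarrow> real \<Rightarrow> real"
  assumes D: "\<And>k x. k < 4 \<Longrightarrow> (D k has_real_derivative D (Suc k) x) (at x)"
    and h: "h > 0" and M: "\<And>t. x \<le> t \<Longrightarrow> t \<le> x + h \<Longrightarrow> \<bar>D 4 t\<bar> \<le> M"
  shows "\<bar>D 0 (x + h) - D 0 x - h / 2 * (D 1 x + D 1 (x + h)) + h\<^sup>2 / 12 * (D 2 (x + h) - D 2 x)\<bar>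
           \<le> h ^ 4 / 6 * M"
proof -
  have "\<exists>t. x < t \<and> t < x + h \<and>
      D j (x + h) = (\<Sum>m<4-j. D (j + m) x / fact m * (x + h - x) ^ m)
        + D (j + (4 - j)) t / fact (4 - j) * (x + h - x) ^ (4 - j)" if "j < 4" for j
    by (rule Taylor_up[where a = x and diff = "\<lambda>m. D (j + m)"]) (use that h D in auto)
  then have T: "\<exists>t. x < t \<and> t < x + h \<and>
      D j (x + h) = (\<Sum>m<4-j. D (j + m) x / fact m * h ^ m) + D 4 t / fact (4 - j) * h ^ (4 - j)"
    if "j < 4" for j
    using that by fastforce
  have ex: "{..<4::nat} = {0,1,2,3}" "{..<3::nat} = {0,1,2}" "{..<2::nat} = {0,1}"
    by auto
  obtain a where a: "x < a" "a < x + h"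
    "D 0 (x + h) = D 0 x + D 1 x * h + D 2 x / 2 * h\<^sup>2 + D 3 x / 6 * h ^ 3 + D 4 a / 24 * h ^ 4"
    using T[of 0] by (auto simp: ex fact_numeral numeral_2_eq_2[symmetric])
  obtain b where b: "x < b" "b < x + h"
    "D 1 (x + h) = D 1 x + D 2 x * h + D 3 x / 2 * h\<^sup>2 + D 4 b / 6 * h ^ 3"
    using T[of 1] by (auto simp: ex fact_numeral numeral_2_eq_2[symmetric] numeral_3_eq_3[symmetric])
  obtain c where c: "x < c" "c < x + h"
    "D 2 (x + h) = D 2 x + D 3 x * h + D 4 c / 2 * h\<^sup>2"
    using T[of 2] by (auto simp: ex fact_numeral numeral_2_eq_2[symmetric] numeral_3_eq_3[symmetric])
  \<comment> \<open>With weights 1/2 and 1/12 all Taylor terms up to \<open>D 3\<close> cancel (1/6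
    - 1/4 + 1/12 = 0). The three remainders add up to the constant 1/24 + 1/12 + 1/24 = 1/6.\<close>
  have "D 0 (x + h) - D 0 x - h / 2 * (D 1 x + D 1 (x + h)) + h\<^sup>2 / 12 * (D 2 (x + h) - D 2 x)
      = h ^ 4 * (D 4 a / 24 - D 4 b / 12 + D 4 c / 24)"
    unfolding a(3) b(3) c(3) by (simp add: field_simps power2_eq_square power3_eq_cube power4_eq_xxxx)
  also have "\<bar>\<dots>\<bar> \<le> h ^ 4 * (M / 24 + M / 12 + M / 24)"
    unfolding abs_mult using M[of a] M[of b] M[of c] a b c h
    by (intro mult_mono) (auto simp: abs_if split: if_splits)
  finally show ?thesis by simp
qed

text \<open>The trapezoid estimates on the mesh x + n h telescope, and everything at infinity
  vanishes. \<open>D 0\<close> is an antiderivative of the summand \<open>D 1\<close>, so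
  \<open>L - D 0 x\<close> is the integral over the half line. Summing the step errors h^4 exp(- n
  h) costs one power of h.\<close>

lemma euler_maclaurin_exp_decay:
  fixes D :: "nat \<Rightarrow> real \<Rightarrow> real"
  assumes D: "\<And>k x. k < 4 \<Longrightarrow> (D k has_real_derivative D (Suc k) x) (at x)"
    and h: "h > 0"
    and D4: "\<And>t. x \<le> t \<Longrightarrow> \<bar>D 4 t\<bar> \<le> K * exp (- t)"
    and lim0: "(D 0 \<longlongrightarrow> L) at_top" and lim2: "(D 2 \<longlongrightarrow> 0) at_top"
    and sums: "(\<lambda>n. D 1 (x + real n * h)) sums S"
  shows "\<bar>h * S - (L - D 0 x) - h / 2 * D 1 x + h\<^sup>2 / 12 * D 2 x\<bar> \<le> K * exp (- x) * h ^ 3 * (1 + h) / 6"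
proof -
  have K: "K \<ge> 0"
    using D4[of x] by (smt (verit, best) exp_gt_zero mult_neg_pos)
  define y where "y = (\<lambda>n. x + real n * h)"
  define E where "E = (\<lambda>n. D 0 (y (Suc n)) - D 0 (y n) - h / 2 * (D 1 (y n) + D 1 (y (Suc n)))
      + h\<^sup>2 / 12 * (D 2 (y (Suc n)) - D 2 (y n)))"
  have ySuc: "y (Suc n) = y n + h" for n by (simp add: y_def algebra_simps)
  have yx: "y n \<ge> x" for n using h by (simp add: y_def)
  have E: "\<bar>E n\<bar> \<le> h ^ 4 / 6 * (K * exp (- y n))" for n
    unfolding E_def ySuc
  proof (rule trapezoid_step[where D = D and x = "y n", OF _ h])
    show "(D k has_real_derivative D (Suc k) x) (at x)" if "k < 4" for k x using that by (rule D)
  next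
    fix t assume "y n \<le> t" "t \<le> y n + h"
    then show "\<bar>D 4 t\<bar> \<le> K * exp (- y n)"
      using D4[of t] yx[of n] K by (smt (verit) exp_le_cancel_iff mult_left_mono)
  qed
  \<comment> \<open>Interior nodes receive h/2 from both neighbouring steps, hence the full weight
    h; the two end nodes need a correction by h/2.\<close>
  have partial: "(\<Sum>n<N. E n) = D 0 (y N) - D 0 x - h * (\<Sum>n<N. D 1 (y n)) + h / 2 * D 1 x
      - h / 2 * D 1 (y N) + h\<^sup>2 / 12 * (D 2 (y N) - D 2 x)" for N
    by (induction N) (simp_all add: E_def y_def[of ] algebra_simps)
  have yexp: "exp (- y n) = exp (- x) * exp (- h) ^ n" for n
    unfolding y_def exp_of_nat_mult[symmetric] exp_add[symmetric] by (simp add: algebra_simps)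
  have geo: "(\<lambda>n. exp (- h) ^ n) sums (1 / (1 - exp (- h)))"
    by (rule geometric_sums) (use h in auto)
  have geo_le: "(\<Sum>n<N. exp (- h) ^ n) \<le> (1 + h) / h" for N
  proof -
    have "(\<Sum>n<N. exp (- h) ^ n) \<le> 1 / (1 - exp (- h))"
      using sum_le_suminf[OF sums_summable[OF geo], of "{..<N}"] sums_unique[OF geo] by simp
    also have "1 + h \<le> exp h" by (rule exp_ge_add_one_self)
    then have "exp (- h) * (1 + h) \<le> 1" by (simp add: exp_minus field_simps)
    then have "1 / (1 - exp (- h)) \<le> (1 + h) / h" using h by (simp add: field_simps)
    finally show ?thesis .
  qed
  have bound: "\<bar>\<Sum>n<N. E n\<bar> \<le> K * exp (- x) * h ^ 3 * (1 + h) / 6" for N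
  proof -
    have "\<bar>\<Sum>n<N. E n\<bar> \<le> (\<Sum>n<N. h ^ 4 / 6 * (K * exp (- y n)))"
      by (rule order_trans[OF sum_abs sum_mono[OF E]])
    also have "\<dots> = h ^ 4 / 6 * K * exp (- x) * (\<Sum>n<N. exp (- h) ^ n)"
      by (simp add: yexp sum_distrib_left mult_ac)
    also have "\<dots> \<le> h ^ 4 / 6 * K * exp (- x) * ((1 + h) / h)"
      using h K by (intro mult_left_mono geo_le) auto
    also have "\<dots> = K * exp (- x) * h ^ 3 * (1 + h) / 6"
      using h by (simp add: field_simps power_numeral_reduce)
    finally show ?thesis .
  qed
  have ytop: "filterlim y at_top sequentially"
    unfolding y_def using h by real_asymp
  have D1lim: "(\<lambda>n. D 1 (y n)) \<longlonglongrightarrow> 0"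
    using sums_summable[OF sums] unfolding y_def by (rule summable_LIMSEQ_zero)
  have "(\<lambda>N. \<Sum>n<N. E n) \<longlonglongrightarrow> L - D 0 x - h * S + h / 2 * D 1 x - h / 2 * 0 + h\<^sup>2 / 12 * (0 - D 2 x)"
    unfolding partial
    by (intro tendsto_intros filterlim_compose[OF lim0 ytop] filterlim_compose[OF lim2 ytop] D1lim)
       (use sums in \<open>simp add: sums_def y_def\<close>)
  then have "\<bar>L - D 0 x - h * S + h / 2 * D 1 x - h / 2 * 0 + h\<^sup>2 / 12 * (0 - D 2 x)\<bar>
      \<le> K * exp (- x) * h ^ 3 * (1 + h) / 6"
    by (rule Lim_bounded[OF tendsto_rabs]) (use bound in auto)
  then show ?thesis by (simp add: abs_if algebra_simps split: if_splits)
qed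

text \<open>The improper integral converges because \<open>F x - K * exp (- x)\<close> increases and
  \<open>F x + K * exp (- x)\<close> decreases for x >= a. The supremum of the first function lies
  between the two, and their distance tends to 0.\<close>

lemma antiderivative_exp_decay:
  fixes f :: "real \<Rightarrow> real"
  assumes cont: "\<And>x. isCont f x" and bd: "\<And>x. x \<ge> a \<Longrightarrow> \<bar>f x\<bar> \<le> K * exp (- x)"
  shows "\<exists>F L. (\<forall>x. (F has_real_derivative f x) (at x)) \<and> (F \<longlongrightarrow> L) at_top"
proof -
  obtain F where F: "\<And>x. (F has_real_derivative f x) (at x)"
    using einterval_antiderivative[of "-\<infinity>" "\<infinity>" f] cont
    by (auto simp: has_real_derivative_iff_has_vector_derivative)
  have up: "F x - K * exp (- x) \<le> F y - K * exp (- y)" if "a \<le> x" "x \<le> y" for x y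
  proof (rule DERIV_nonneg_imp_nondecreasing[OF that(2)])
    fix z assume "x \<le> z" "z \<le> y"
    then have "f z + K * exp (- z) \<ge> 0" using bd[of z] that by linarith
    moreover have "((\<lambda>x. F x - K * exp (- x)) has_real_derivative f z + K * exp (- z)) (at z)"
      by (auto intro!: derivative_eq_intros F)
    ultimately show "\<exists>y. ((\<lambda>x. F x - K * exp (- x)) has_real_derivative y) (at z) \<and> 0 \<le> y" by blast
  qed
  have down: "F x + K * exp (- x) \<ge> F y + K * exp (- y)" if "a \<le> x" "x \<le> y" for x y
  proof (rule DERIV_nonpos_imp_nonincreasing[OF that(2)])
    fix z assume "x \<le> z" "z \<le> y"
    then have "f z - K * exp (- z) \<le> 0" using bd[of z] that by linarith
    moreover have "((\<lambda>x. F x + K * exp (- x)) has_real_derivative f z - K * exp (- z)) (at z)"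
      by (auto intro!: derivative_eq_intros F)
    ultimately show "\<exists>y. ((\<lambda>x. F x + K * exp (- x)) has_real_derivative y) (at z) \<and> y \<le> 0" by blast
  qed
  have K: "K \<ge> 0"
    using bd[of a] by (smt (verit, best) exp_gt_zero mult_neg_pos)
  define L where "L = (SUP x\<in>{a..}. F x - K * exp (- x))"
  have bdd: "bdd_above ((\<lambda>x. F x - K * exp (- x)) ` {a..})"
  proof (rule bdd_aboveI2)
    fix x assume "x \<in> {a..}"
    then show "F x - K * exp (- x) \<le> F a + K * exp (- a)"
      using down[of a x] mult_nonneg_nonneg[OF K, of "exp (- x)"] by (smt (verit) atLeast_iff exp_ge_zero)
  qed
  have "F x - K * exp (- x) \<le> L" if "x \<ge> a" for x
    unfolding L_def by (rule cSUP_upper[OF _ bdd]) (use that in auto)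
  moreover have "L \<le> F x + K * exp (- x)" if "x \<ge> a" for x
    unfolding L_def
  proof (rule cSUP_least)
    fix y assume y: "y \<in> {a..}"
    have "F y - K * exp (- y) \<le> F (max x y) - K * exp (- max x y)" by (rule up) (use y in auto)
    also have "\<dots> \<le> F (max x y) + K * exp (- max x y)" using K by simp
    also have "\<dots> \<le> F x + K * exp (- x)" by (rule down) (use that in auto)
    finally show "F y - K * exp (- y) \<le> F x + K * exp (- x)" .
  qed auto
  ultimately have ev: "\<forall>\<^sub>F x in at_top. norm (F x - L) \<le> K * exp (- x)"
    by (intro eventually_mono[OF eventually_ge_at_top[of a]]) (smt (verit) real_norm_def)
  have "((\<lambda>x. K * exp (- x)) \<longlongrightarrow> 0) at_top" by real_asymp
  then have "((\<lambda>x. F x - L) \<longlongrightarrow> 0) at_top"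
    by (rule Lim_null_comparison[OF ev])
  then have "(F \<longlongrightarrow> L) at_top" by (simp add: LIM_zero_cancel)
  with F show ?thesis by blast
qed

section \<open>Gaussian sums over lattices\<close>

lemma has_sum_int:
  fixes f :: "int \<Rightarrow> 'a :: {topological_comm_monoid_add, t3_space}"
  assumes "((\<lambda>n. f (int n)) has_sum a) UNIV" "((\<lambda>n. f (- int n - 1)) has_sum b) UNIV"
  shows "(f has_sum (a + b)) UNIV"
proof -
  have "(f has_sum a) (range int)"
    using assms(1) by (subst has_sum_reindex) (auto simp: o_def)
  moreover have "(f has_sum b) (range (\<lambda>n. - int n - 1))"
    using assms(2) by (subst has_sum_reindex) (auto simp: o_def inj_on_def)
  moreover have "range int \<inter> range (\<lambda>n. - int n - 1) = {}" by auto
  moreover have "range int \<union> range (\<lambda>n. - int n - 1) = UNIV"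
  proof -
    have "x \<in> range int \<union> range (\<lambda>n. - int n - 1)" for x :: int
      using rangeI[of int "nat x"] rangeI[of "\<lambda>n. - int n - 1" "nat (- x - 1)"]
      by (cases "x \<ge> 0") auto
    then show ?thesis by blast
  qed
  ultimately show ?thesis using has_sum_Un_disjoint[of f _ a _ b] by metis
qed

text \<open>The cubic factor belongs to the third derivative of exp(- x^2), which is
  \<open>D 4\<close> when \<open>D 0\<close> is an antiderivative of the Gaussian. The bound 4|x| <=
  x^2 + 4 leaves exp(3|x|) to absorb the cubic and still yields exp(- |x|).\<close>

lemma gaussian_le_exp:
  fixes x :: real
  shows "exp (- x\<^sup>2) \<le> exp 4 * exp (- \<bar>x\<bar>)" "\<bar>(12 * x - 8 * x ^ 3) * exp (- x\<^sup>2)\<bar> \<le> 20 * exp 4 * exp (- \<bar>x\<bar>)"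
proof -
  have le: "\<bar>x\<bar> * 4 \<le> x\<^sup>2 + 4"
    using zero_le_power2[of "\<bar>x\<bar> - 2"] by (simp add: power2_eq_square algebra_simps)
  show "exp (- x\<^sup>2) \<le> exp 4 * exp (- \<bar>x\<bar>)"
    unfolding exp_add[symmetric] using le by simp
  have ax: "\<bar>x\<bar> \<le> exp \<bar>x\<bar>" using exp_ge_add_one_self[of "\<bar>x\<bar>"] by linarith
  have 1: "\<bar>x\<bar> \<le> exp (3 * \<bar>x\<bar>)" by (rule order_trans[OF ax]) simp
  have "\<bar>x\<bar> ^ 3 \<le> exp \<bar>x\<bar> ^ 3" using ax by (intro power_mono) auto
  then have 3: "\<bar>x\<bar> ^ 3 \<le> exp (3 * \<bar>x\<bar>)" by (simp add: exp_of_nat_mult[symmetric])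
  have "\<bar>12 * x - 8 * x ^ 3\<bar> \<le> 12 * \<bar>x\<bar> + 8 * \<bar>x\<bar> ^ 3"
    by (simp add: abs_mult power_abs order_trans[OF abs_triangle_ineq4])
  also have "\<dots> \<le> 20 * exp (3 * \<bar>x\<bar>)" using 1 3 by linarith
  finally have "\<bar>12 * x - 8 * x ^ 3\<bar> * exp (- x\<^sup>2) \<le> 20 * exp (3 * \<bar>x\<bar>) * exp (- x\<^sup>2)"
    by (rule mult_right_mono) auto
  also have "\<dots> \<le> 20 * (exp 4 * exp (- \<bar>x\<bar>))"
    unfolding mult.assoc exp_add[symmetric] using le by simp
  finally show "\<bar>(12 * x - 8 * x ^ 3) * exp (- x\<^sup>2)\<bar> \<le> 20 * exp 4 * exp (- \<bar>x\<bar>)"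
    by (simp add: abs_mult)
qed

lemma summable_gaussian:
  assumes h: "(h::real) > 0"
  shows "summable (\<lambda>n. exp (- (x + real n * h)\<^sup>2))"
proof (rule summable_comparison_test)
  have "(\<lambda>n. exp 4 * exp (- x) * exp (- h) ^ n) sums (exp 4 * exp (- x) * (1 / (1 - exp (- h))))"
    by (intro sums_mult geometric_sums) (use h in auto)
  then show "summable (\<lambda>n. exp 4 * exp (- x) * exp (- h) ^ n)" by (rule sums_summable)
  show "\<exists>N. \<forall>n\<ge>N. norm (exp (- (x + real n * h)\<^sup>2)) \<le> exp 4 * exp (- x) * exp (- h) ^ n"
  proof (intro exI allI impI)
    fix n
    have "exp (- (x + real n * h)\<^sup>2) \<le> exp 4 * exp (- \<bar>x + real n * h\<bar>)" by (rule gaussian_le_exp)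
    also have "\<dots> \<le> exp 4 * exp (- (x + real n * h))" by simp
    also have "\<dots> = exp 4 * exp (- x) * exp (- h) ^ n"
      unfolding exp_of_nat_mult[symmetric] mult.assoc exp_add[symmetric] by (simp add: algebra_simps)
    finally show "norm (exp (- (x + real n * h)\<^sup>2)) \<le> exp 4 * exp (- x) * exp (- h) ^ n" by simp
  qed
qed

text \<open>The boundary terms of the summation formula on the two half lines cancel since the Gaussian
  is even; the error term needed below is \<open>o(h)\<close>, uniformly in the shift.\<close>

lemma gaussian_sum_unit_shift:
  "\<exists>I C :: real. C \<ge> 0 \<and> (\<forall>h s::real. 0 < h \<longrightarrow> h \<le> 1 \<longrightarrow> 0 \<le> s \<longrightarrow> s \<le> 1 \<longrightarrow>
       (\<exists>S. ((\<lambda>n::int. exp (- (h * (of_int n + s))\<^sup>2)) has_sum S) UNIV \<and> \<bar>S - I / h\<bar> \<le> C * h\<^sup>2))"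
proof -
  have c1: "isCont (\<lambda>x::real. exp (- x\<^sup>2)) x" for x by (intro continuous_intros)
  have c2: "\<bar>exp (- x\<^sup>2)\<bar> \<le> exp 4 * exp (- x)" if "x \<ge> (0::real)" for x
    using gaussian_le_exp(1)[of x] that by simp
  obtain F L where F: "\<And>x. (F has_real_derivative exp (- x\<^sup>2)) (at x)"
    and L: "(F \<longlongrightarrow> L) at_top"
    using antiderivative_exp_decay[where f = "\<lambda>x. exp (- x\<^sup>2)" and a = 0 and K = "exp 4", OF c1 c2] by blast
  define D where "D = (\<lambda>k::nat. if k = 0 then F else if k = 1 then (\<lambda>x. exp (- x\<^sup>2))
     else if k = 2 then (\<lambda>x. - 2 * x * exp (- x\<^sup>2)) else if k = 3 then (\<lambda>x. (4 * x\<^sup>2 - 2) * exp (- x\<^sup>2))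
     else (\<lambda>x. (12 * x - 8 * x ^ 3) * exp (- x\<^sup>2)))"
  have D: "(D k has_real_derivative D (Suc k) x) (at x)" if "k < 4" for k x
  proof -
    consider "k = 0" | "k = 1" | "k = 2" | "k = 3" using \<open>k < 4\<close> by linarith
    then show ?thesis
    proof cases
      case 1
      then show ?thesis using F by (simp add: D_def)
    qed (auto simp: D_def power2_eq_square power3_eq_cube algebra_simps intro!: derivative_eq_intros)
  qed
  define K where "K = 20 * exp (4::real)"
  have D4: "\<bar>D 4 t\<bar> \<le> K * exp (- t)" for t
  proof -
    have "\<bar>D 4 t\<bar> \<le> K * exp (- \<bar>t\<bar>)"
      unfolding D_def K_def using gaussian_le_exp(2)[of t] by simp
    also have "\<dots> \<le> K * exp (- t)" by (simp add: K_def)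
    finally show ?thesis .
  qed
  have D2: "(D 2 \<longlongrightarrow> 0) at_top" unfolding D_def by simp real_asymp
  \<comment> \<open>An antiderivative of an even function is odd up to a constant, so the integrals
    from x and from -x to infinity add up to the integral over the whole line, which is
    \<open>I\<close> below.\<close>
  have sym: "F x + F (- x) = F 0 + F (- 0)" for x
  proof (rule DERIV_isconst_all[where f = "\<lambda>x. F x + F (- x)"], rule allI)
    show "((\<lambda>x. F x + F (- x)) has_real_derivative 0) (at x)" for x
      by (auto intro!: derivative_eq_intros F DERIV_chain2[of F])
  qed
  define I where "I = 2 * L - 2 * F 0"
  define C where "C = 2 * K * exp 1"
  show ?thesis
  proof (rule exI[of _ I], rule exI[of _ C], intro conjI allI impI)
    show "C \<ge> 0" by (simp add: C_def K_def)
    fix h s :: real assume hs: "0 < h" "h \<le> 1" "0 \<le> s" "s \<le> 1"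
    have sm: "summable (\<lambda>n. D 1 (x + real n * h))" for x
      unfolding D_def using summable_gaussian[OF hs(1)] by simp
    define S where "S = (\<lambda>x. suminf (\<lambda>n. D 1 (x + real n * h)))"
    have S: "(\<lambda>n. D 1 (x + real n * h)) sums S x" for x
      unfolding S_def using sm by (rule summable_sums)
    have EM: "\<bar>h * S x - (L - D 0 x) - h / 2 * D 1 x + h\<^sup>2 / 12 * D 2 x\<bar> \<le> K * exp (- x) * h ^ 3 * (1 + h) / 6" for x
      by (rule euler_maclaurin_exp_decay[OF _ hs(1) D4 _ D2 S]) (use D L in \<open>auto simp: D_def\<close>)
    define x where "x = h * s"
    have x: "0 \<le> x" "x \<le> 1" using hs by (auto simp: x_def mult_le_one)
    have pos: "((\<lambda>n. exp (- (h * (of_int (int n) + s))\<^sup>2)) has_sum S x) UNIV"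
      using sums_nonneg_imp_has_sum[OF S[of x]] by (simp add: D_def x_def algebra_simps)
    \<comment> \<open>The points to the left of x are mirrored to -x + n h. The term n = 0 is
      dropped since it mirrors x itself, already counted in \<open>S x\<close>.\<close>
    have "(\<lambda>n. D 1 (- x + real (Suc n) * h)) sums (S (- x) - D 1 (- x))"
      using S[of "- x"] by (subst sums_Suc_iff) simp
    then have "((\<lambda>n. D 1 (- x + real (Suc n) * h)) has_sum (S (- x) - D 1 x)) UNIV"
      by (intro sums_nonneg_imp_has_sum) (auto simp: D_def)
    moreover have "D 1 (- x + real (Suc n) * h) = exp (- (h * (of_int (- int n - 1) + s))\<^sup>2)" for n
      by (simp add: D_def x_def power2_eq_square algebra_simps)
    ultimately have neg: "((\<lambda>n. exp (- (h * (of_int (- int n - 1) + s))\<^sup>2)) has_sum (S (- x) - D 1 x)) UNIV"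
      by simp
    have hsum: "((\<lambda>n::int. exp (- (h * (of_int n + s))\<^sup>2)) has_sum (S x + (S (- x) - D 1 x))) UNIV"
      by (rule has_sum_int[OF pos neg])
    have e: "exp (- x) \<le> exp 1" "exp x \<le> exp 1" using x by auto
    have "\<bar>h * (S x + (S (- x) - D 1 x)) - I\<bar> \<le> K * exp (- x) * h ^ 3 * (1 + h) / 6 + K * exp x * h ^ 3 * (1 + h) / 6"
    proof -
      \<comment> \<open>\<open>D 2\<close> is odd, so its boundary terms cancel; \<open>D 1\<close>
        is even, so the two halves h/2 account exactly for the dropped term.\<close>
      have "h * (S x + (S (- x) - D 1 x)) - I =
        (h * S x - (L - D 0 x) - h / 2 * D 1 x + h\<^sup>2 / 12 * D 2 x) +
        (h * S (- x) - (L - D 0 (- x)) - h / 2 * D 1 (- x) + h\<^sup>2 / 12 * D 2 (- x))"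
        using sym[of x] by (simp add: D_def I_def algebra_simps)
      then show ?thesis
        by (simp only:) (rule order_trans[OF abs_triangle_ineq
              add_mono[OF EM[of x] EM[of "- x", unfolded minus_minus]]])
    qed
    also have "\<dots> = K * h ^ 3 * ((1 + h) * (exp (- x) + exp x) / 6)" by (simp add: algebra_simps add_divide_distrib)
    also have "\<dots> \<le> K * h ^ 3 * (2 * (exp 1 + exp 1) / 6)"
      using hs e by (intro mult_left_mono divide_right_mono mult_mono add_mono) (auto simp: K_def)
    also have "\<dots> \<le> C * h ^ 3" using hs by (auto simp: C_def K_def)
    finally have "\<bar>h * (S x + (S (- x) - D 1 x)) - I\<bar> / h \<le> C * h ^ 3 / h"
      using hs by (intro divide_right_mono) auto
    also have "C * h ^ 3 / h = C * h\<^sup>2" using hs by (simp add: power2_eq_square power3_eq_cube)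
    also have "\<bar>h * (S x + (S (- x) - D 1 x)) - I\<bar> / h = \<bar>(S x + (S (- x) - D 1 x)) - I / h\<bar>"
    proof -
      have "(S x + (S (- x) - D 1 x)) - I / h = (h * (S x + (S (- x) - D 1 x)) - I) / h"
        using hs by (simp add: diff_divide_distrib)
      then show ?thesis using hs by simp
    qed
    finally show "\<exists>S. ((\<lambda>n::int. exp (- (h * (of_int n + s))\<^sup>2)) has_sum S) UNIV \<and> \<bar>S - I / h\<bar> \<le> C * h\<^sup>2"
      using hsum by blast
  qed
qed

text \<open>Translating n by the integer part of s reduces every real shift to the unit interval.
  The constant C does not depend on s: the rows of a lattice have unbounded shifts.\<close>

lemma gaussian_sum_int:
  "\<exists>I C :: real. C \<ge> 0 \<and> (\<forall>t s::real. 0 < t \<longrightarrow> t \<le> 1 \<longrightarrow>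
       (\<exists>S. ((\<lambda>n::int. exp (- (t * (of_int n + s)\<^sup>2))) has_sum S) UNIV \<and> \<bar>S - I / sqrt t\<bar> \<le> C * t))"
proof -
  obtain I C where C: "C \<ge> 0" and *: "\<forall>h s::real. 0 < h \<longrightarrow> h \<le> 1 \<longrightarrow> 0 \<le> s \<longrightarrow> s \<le> 1 \<longrightarrow>
       (\<exists>S. ((\<lambda>n::int. exp (- (h * (of_int n + s))\<^sup>2)) has_sum S) UNIV \<and> \<bar>S - I / h\<bar> \<le> C * h\<^sup>2)"
    using gaussian_sum_unit_shift by blast
  show ?thesis
  proof (rule exI[of _ I], rule exI[of _ C], intro conjI allI impI C)
    fix t s :: real assume t: "0 < t" "t \<le> 1"
    obtain S where S: "((\<lambda>n::int. exp (- (sqrt t * (of_int n + frac s))\<^sup>2)) has_sum S) UNIV"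
      "\<bar>S - I / sqrt t\<bar> \<le> C * (sqrt t)\<^sup>2"
      using *[rule_format, of "sqrt t" "frac s"] t frac_lt_1[of s] by fastforce
    have "((\<lambda>n::int. exp (- (t * (of_int n + s)\<^sup>2))) has_sum S) UNIV \<longleftrightarrow>
          ((\<lambda>n::int. exp (- (sqrt t * (of_int n + frac s))\<^sup>2)) has_sum S) UNIV"
      by (rule has_sum_reindex_bij_witness[where i = "\<lambda>n. n - \<lfloor>s\<rfloor>" and j = "\<lambda>n. n + \<lfloor>s\<rfloor>"])
         (use t in \<open>auto simp: frac_def power_mult_distrib\<close>)
    with S t show "\<exists>S. ((\<lambda>n::int. exp (- (t * (of_int n + s)\<^sup>2))) has_sum S) UNIV \<and> \<bar>S - I / sqrt t\<bar> \<le> C * t"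
      by auto
  qed
qed

text \<open>For fixed y the sum over x is a one-dimensional sum with shift \<sigma> y, equal to I /
  sqrt(t A) + O(t) uniformly in y. The weights of the rows sum to I / sqrt(t B) + O(t). The product
  of the main terms is c / t, and the remaining products are O(t^(1/2)).\<close>

lemma gaussian_lattice_sum:
  fixes A B \<sigma> :: real
  assumes A: "A > 0" and B: "B > 0"
  shows "\<exists>(c :: real) T.
    (\<forall>\<^sub>F t in at_right 0. ((\<lambda>(y::int, x::int).
        exp (- (t * (A * (of_int x + \<sigma> * of_int y)\<^sup>2 + B * (of_int y)\<^sup>2)))) has_sum T t) UNIV) \<and>
    ((\<lambda>t. T t - c / t) \<longlongrightarrow> 0) (at_right 0)"
proof -
  obtain I C where C: "C \<ge> 0" and G: "\<forall>t s::real. 0 < t \<longrightarrow> t \<le> 1 \<longrightarrow>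
       (\<exists>S. ((\<lambda>n::int. exp (- (t * (of_int n + s)\<^sup>2))) has_sum S) UNIV \<and> \<bar>S - I / sqrt t\<bar> \<le> C * t)"
    using gaussian_sum_int by blast
  define f where "f = (\<lambda>t (y::int, x::int). exp (- (t * (A * (of_int x + \<sigma> * of_int y)\<^sup>2 + B * (of_int y)\<^sup>2))))"
  define c where "c = I\<^sup>2 / (sqrt A * sqrt B)"
  \<comment> \<open>First the error of one row times a bound for the total weight, then the main
    term of a row times the error of the total weight.\<close>
  define E where "E = (\<lambda>t. C * t * A * (\<bar>I\<bar> / sqrt (t * B) + C * t * B) + \<bar>I\<bar> / sqrt (t * A) * (C * t * B))"
  have main: "\<exists>S. (f t has_sum S) UNIV \<and> \<bar>S - c / t\<bar> \<le> E t" if t: "0 < t" "t \<le> 1 / A" "t \<le> 1 / B" for t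
  proof -
    have tA: "0 < t * A" "t * A \<le> 1" and tB: "0 < t * B" "t * B \<le> 1"
      using t A B by (auto simp: field_simps)
    obtain g where g: "\<And>s. ((\<lambda>n::int. exp (- (t * A * (of_int n + s)\<^sup>2))) has_sum g s) UNIV"
      and gb: "\<And>s. \<bar>g s - I / sqrt (t * A)\<bar> \<le> C * (t * A)"
      using G[rule_format, OF tA] by metis
    obtain H where H: "((\<lambda>n::int. exp (- (t * B * (of_int n + 0)\<^sup>2))) has_sum H) UNIV"
      and Hb: "\<bar>H - I / sqrt (t * B)\<bar> \<le> C * (t * B)"
      using G[rule_format, OF tB] by metis
    define w where "w = (\<lambda>y::int. exp (- (t * B * (of_int y)\<^sup>2)))"
    have Hw: "(w has_sum H) UNIV" using H by (simp add: w_def)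
    have inner: "((\<lambda>x. f t (y, x)) has_sum w y * g (\<sigma> * of_int y)) UNIV" for y
      using has_sum_cmult_right[OF g[of "\<sigma> * of_int y"], of "w y"]
      by (simp add: f_def w_def exp_add[symmetric] algebra_simps)
    have gn: "g s \<ge> 0" for s
      using has_sum_nonneg[OF g[of s]] by auto
    have "(\<lambda>y. w y * g (\<sigma> * of_int y)) summable_on UNIV"
    proof (rule summable_on_comparison_test)
      show "(\<lambda>y. w y * (I / sqrt (t * A) + C * (t * A))) summable_on UNIV"
        using Hw has_sum_imp_summable by (intro summable_on_cmult_left) blast
      show "w y * g (\<sigma> * of_int y) \<le> w y * (I / sqrt (t * A) + C * (t * A))" for y
        using gb[of "\<sigma> * of_int y"] by (intro mult_left_mono) (auto simp: w_def)
      show "0 \<le> w y * g (\<sigma> * of_int y)" for y using gn by (simp add: w_def)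
    qed
    then obtain S where S: "((\<lambda>y. w y * g (\<sigma> * of_int y)) has_sum S) UNIV"
      by (auto simp: summable_on_def)
    have "f t summable_on (UNIV \<times> UNIV)"
      by (rule summable_on_SigmaI[OF inner]) (use S has_sum_imp_summable in \<open>auto simp: f_def\<close>)
    then have "(f t has_sum S) (UNIV \<times> UNIV)"
      by (intro has_sum_SigmaI[OF inner S]) auto
    moreover have "\<bar>S - c / t\<bar> \<le> E t"
    proof -
      have up: "S \<le> H * (I / sqrt (t * A) + C * (t * A))"
        proof (rule has_sum_mono[OF S has_sum_cmult_left[OF Hw]])
        show "w y * g (\<sigma> * of_int y) \<le> w y * (I / sqrt (t * A) + C * (t * A))" for y
          using gb[of "\<sigma> * of_int y"] by (intro mult_left_mono) (auto simp: w_def)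
      qed
      have low: "S \<ge> H * (I / sqrt (t * A) - C * (t * A))"
        proof (rule has_sum_mono[OF has_sum_cmult_left[OF Hw] S])
        show "w y * (I / sqrt (t * A) - C * (t * A)) \<le> w y * g (\<sigma> * of_int y)" for y
          using gb[of "\<sigma> * of_int y"] by (intro mult_left_mono) (auto simp: w_def)
      qed
      have H0: "H \<ge> 0" using has_sum_nonneg[OF Hw] by (auto simp: w_def)
      have 1: "\<bar>S - H * (I / sqrt (t * A))\<bar> \<le> C * t * A * H"
        using up low by (auto simp: algebra_simps abs_le_iff)
      have "H \<le> I / sqrt (t * B) + C * (t * B)" using Hb by linarith
      also have "\<dots> \<le> \<bar>I\<bar> / sqrt (t * B) + C * t * B"
        using tB by (intro add_mono divide_right_mono) auto
      finally have 2: "C * t * A * H \<le> C * t * A * (\<bar>I\<bar> / sqrt (t * B) + C * t * B)"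
        using C t A by (intro mult_left_mono) auto
      have 3: "\<bar>(H - I / sqrt (t * B)) * (I / sqrt (t * A))\<bar> \<le> \<bar>I\<bar> / sqrt (t * A) * (C * t * B)"
        unfolding abs_mult using Hb tA by (subst mult.commute, intro mult_mono) (auto simp: mult.assoc)
      have 4: "c / t = I / sqrt (t * B) * (I / sqrt (t * A))"
        using t A B by (simp add: c_def real_sqrt_mult power2_eq_square field_simps)
      have "S - c / t = (S - H * (I / sqrt (t * A))) + (H - I / sqrt (t * B)) * (I / sqrt (t * A))"
        unfolding 4 by (simp add: algebra_simps)
      with 1 2 3 show ?thesis unfolding E_def by linarith
    qed
    ultimately show ?thesis by auto
  qed
  define T where "T = (\<lambda>t. infsum (f t) UNIV)"
  have ev: "\<forall>\<^sub>F t in at_right 0. (f t has_sum T t) UNIV \<and> \<bar>T t - c / t\<bar> \<le> E t"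
  proof -
    have "\<forall>\<^sub>F t in at_right 0. t \<in> {0<..<min (1 / A) (1 / B)}"
      by (rule eventually_at_right_real) (use A B in auto)
    then show ?thesis
    proof eventually_elim
      case (elim t)
      then have "\<exists>S. (f t has_sum S) UNIV \<and> \<bar>S - c / t\<bar> \<le> E t" by (intro main) auto
      then show ?case unfolding T_def using infsumI by blast
    qed
  qed
  have "(E \<longlongrightarrow> 0) (at_right 0)"
    unfolding E_def real_sqrt_mult using A B by real_asymp
  then have "((\<lambda>t. T t - c / t) \<longlongrightarrow> 0) (at_right 0)"
    by (rule Lim_null_comparison[rotated]) (use ev in \<open>auto elim: eventually_mono\<close>)
  then show ?thesis
    by (intro exI[of _ T] exI[of _ c] conjI eventually_mono[OF ev]) (auto simp: f_def)
qed

section \<open>Lambert series of periodic functions\<close>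

text \<open>A class of functions closed under differentiation to which Euler-Maclaurin applies: the
  zero of \<open>N\<close> at 0 forces decay like exp(- u), and positivity of \<open>D\<close> on
  the whole half line makes the function smooth at every real u, negative ones included.\<close>

definition exp_rational :: "(real \<Rightarrow> real) \<Rightarrow> bool" where
  "exp_rational f \<longleftrightarrow> (\<exists>N D. poly N 0 = 0 \<and> (\<forall>x\<ge>0. poly D x > 0) \<and>
     f = (\<lambda>u. poly N (exp (- u)) / poly D (exp (- u))))"

lemma exp_rational_deriv:
  assumes "exp_rational f"
  shows "\<exists>f'. exp_rational f' \<and> (\<forall>u. (f has_real_derivative f' u) (at u))"
proof -
  obtain N D where N: "poly N 0 = 0" and D: "\<And>x. x \<ge> 0 \<Longrightarrow> poly D x > 0"
    and f: "f = (\<lambda>u. poly N (exp (- u)) / poly D (exp (- u)))"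
    using assms unfolding exp_rational_def by blast
  \<comment> \<open>In terms of x = exp(- u) differentiation in u is - x d/dx. The factor x also
    gives the new numerator its zero at 0.\<close>
  define N' where "N' = - ([:0, 1:] * (pderiv N * D - N * pderiv D))"
  have D0: "poly D (exp (- u)) \<noteq> 0" for u using D[of "exp (- u)"] by simp
  have "(f has_real_derivative poly N' (exp (- u)) / poly (D\<^sup>2) (exp (- u))) (at u)" for u
    unfolding f using D0[of u]
    by (auto intro!: derivative_eq_intros poly_DERIV DERIV_chain2[OF poly_DERIV]
        simp: N'_def field_simps power2_eq_square)
  moreover have "exp_rational (\<lambda>u. poly N' (exp (- u)) / poly (D\<^sup>2) (exp (- u)))"
    unfolding exp_rational_def
    using D D0 by (rule_tac exI[of _ N'], rule_tac exI[of _ "D\<^sup>2"]) (auto simp: N'_def poly_power dest: D)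
  ultimately show ?thesis by blast
qed

text \<open>Dividing the numerator by x leaves a quotient that is continuous on the compact interval
  [0, 1], where exp(- u) lies for u >= 0.\<close>

lemma exp_rational_bound:
  assumes "exp_rational f"
  shows "\<exists>K. \<forall>u\<ge>0. \<bar>f u\<bar> \<le> K * exp (- u)"
proof -
  obtain N D where N: "poly N 0 = 0" and D: "\<And>x. x \<ge> 0 \<Longrightarrow> poly D x > 0"
    and f: "f = (\<lambda>u. poly N (exp (- u)) / poly D (exp (- u)))"
    using assms unfolding exp_rational_def by blast
  obtain Q where Q: "N = [:0, 1:] * Q"
    using N poly_eq_0_iff_dvd[of N 0] by (auto elim: dvdE)
  have "continuous_on {0..1} (\<lambda>x. poly Q x / poly D x)"
    using D by (intro continuous_intros) force
  then have "bounded ((\<lambda>x. poly Q x / poly D x) ` {0..1})"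
    by (intro compact_imp_bounded compact_continuous_image) auto
  then obtain K where "\<forall>y\<in>(\<lambda>x. poly Q x / poly D x) ` {0..1}. norm y \<le> K"
    unfolding bounded_iff by blast
  then have K: "\<bar>poly Q x / poly D x\<bar> \<le> K" if "x \<in> {0..1}" for x
    using that by (metis imageI real_norm_def)
  have "\<bar>f u\<bar> \<le> K * exp (- u)" if "u \<ge> 0" for u
  proof -
    have "f u = exp (- u) * (poly Q (exp (- u)) / poly D (exp (- u)))" by (simp add: f Q)
    then have "\<bar>f u\<bar> = exp (- u) * \<bar>poly Q (exp (- u)) / poly D (exp (- u))\<bar>" by (simp add: abs_mult)
    also have "\<dots> \<le> exp (- u) * K" using that by (intro mult_left_mono K) auto
    finally show ?thesis by (simp add: mult.commute)
  qed
  then show ?thesis by blast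
qed

text \<open>Euler-Maclaurin at 0 gives B / t + f(0)/2 + O(t) for the sum over n >= 0, where B is the
  integral of f. The sum here starts at n = 1, and removing f(0) turns the constant into -
  f(0)/2.\<close>

lemma exp_rational_sum:
  assumes "exp_rational f"
  shows "\<exists>B. ((\<lambda>t. (\<Sum>n. f (real (Suc n) * t)) - B / t) \<longlongrightarrow> - f 0 / 2) (at_right 0)"
proof -
  obtain f1 where f1: "exp_rational f1" "\<And>u. (f has_real_derivative f1 u) (at u)"
    using exp_rational_deriv[OF assms] by blast
  obtain f2 where f2: "exp_rational f2" "\<And>u. (f1 has_real_derivative f2 u) (at u)"
    using exp_rational_deriv[OF f1(1)] by blast
  obtain f3 where f3: "exp_rational f3" "\<And>u. (f2 has_real_derivative f3 u) (at u)"
    using exp_rational_deriv[OF f2(1)] by blast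
  obtain K where K: "\<And>u. u \<ge> 0 \<Longrightarrow> \<bar>f u\<bar> \<le> K * exp (- u)"
    using exp_rational_bound[OF assms] by blast
  obtain K1 where K1: "\<And>u. u \<ge> 0 \<Longrightarrow> \<bar>f1 u\<bar> \<le> K1 * exp (- u)"
    using exp_rational_bound[OF f1(1)] by blast
  obtain K3 where K3: "\<And>u. u \<ge> 0 \<Longrightarrow> \<bar>f3 u\<bar> \<le> K3 * exp (- u)"
    using exp_rational_bound[OF f3(1)] by blast
  have "isCont f u" for u using f1(2) by (rule DERIV_isCont)
  then obtain F L where F: "\<And>x. (F has_real_derivative f x) (at x)" and L: "(F \<longlongrightarrow> L) at_top"
    using antiderivative_exp_decay[of f 0 K] K by blast
  have lim1: "(f1 \<longlongrightarrow> 0) at_top"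
  proof (rule Lim_null_comparison)
    show "\<forall>\<^sub>F u in at_top. norm (f1 u) \<le> K1 * exp (- u)"
      using K1 by (intro eventually_mono[OF eventually_ge_at_top[of 0]]) auto
    show "((\<lambda>u. K1 * exp (- u)) \<longlongrightarrow> 0) at_top" by real_asymp
  qed
  define D where "D = (\<lambda>k::nat. if k = 0 then F else if k = 1 then f
     else if k = 2 then f1 else if k = 3 then f2 else f3)"
  have D: "(D k has_real_derivative D (Suc k) x) (at x)" if "k < 4" for k x
  proof -
    consider "k = 0" | "k = 1" | "k = 2" | "k = 3" using \<open>k < 4\<close> by linarith
    then show ?thesis by cases (use F f1 f2 f3 in \<open>simp_all add: D_def\<close>)
  qed
  define B where "B = L - F 0"
  define e where "e = (\<lambda>t. K3 * t ^ 2 * (1 + t) / 6 + \<bar>t / 12 * f1 0\<bar>)"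
  have main: "norm ((\<Sum>n. f (real (Suc n) * t)) - B / t + f 0 / 2) \<le> e t" if t: "t > 0" for t
  proof -
    have "summable (\<lambda>n. f (real n * t))"
    proof (rule summable_comparison_test)
      have "(\<lambda>n. K * exp (- t) ^ n) sums (K * (1 / (1 - exp (- t))))"
        by (intro sums_mult geometric_sums) (use t in auto)
      then show "summable (\<lambda>n. K * exp (- t) ^ n)" by (rule sums_summable)
      show "\<exists>N. \<forall>n\<ge>N. norm (f (real n * t)) \<le> K * exp (- t) ^ n"
        using K t by (auto simp flip: exp_of_nat_mult)
    qed
    then obtain S where S: "(\<lambda>n. f (real n * t)) sums S" by (auto simp: summable_def)
    then have S1: "(\<Sum>n. f (real (Suc n) * t)) = S - f 0"
      using sums_Suc_iff[of "\<lambda>n. f (real n * t)" "S - f 0"] by (simp add: sums_iff)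
    have "\<bar>t * S - (L - D 0 0) - t / 2 * D 1 0 + t\<^sup>2 / 12 * D 2 0\<bar> \<le> K3 * exp (- 0) * t ^ 3 * (1 + t) / 6"
      by (rule euler_maclaurin_exp_decay[OF _ t]) (use D L K3 lim1 S in \<open>auto simp: D_def\<close>)
    then have "\<bar>t * S - B - t / 2 * f 0 + t\<^sup>2 / 12 * f1 0\<bar> / t \<le> K3 * t ^ 3 * (1 + t) / 6 / t"
      using t by (intro divide_right_mono) (auto simp: D_def B_def)
    also have "K3 * t ^ 3 * (1 + t) / 6 / t = K3 * t ^ 2 * (1 + t) / 6"
      using t by (simp add: power2_eq_square power3_eq_cube)
    also have "\<bar>t * S - B - t / 2 * f 0 + t\<^sup>2 / 12 * f1 0\<bar> / t = \<bar>S - B / t - f 0 / 2 + t / 12 * f1 0\<bar>"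
      using t by (simp add: field_simps power2_eq_square flip: abs_div_pos)
    finally show ?thesis unfolding S1 e_def real_norm_def by linarith
  qed
  have "(e \<longlongrightarrow> 0) (at_right 0)"
    unfolding e_def by (rule tendsto_eq_intros refl tendsto_ident_at | simp)+
  then have "((\<lambda>t. (\<Sum>n. f (real (Suc n) * t)) - B / t + f 0 / 2) \<longlongrightarrow> 0) (at_right 0)"
    by (rule Lim_null_comparison[rotated])
       (use main in \<open>auto simp: eventually_at_filter\<close>)
  then have "((\<lambda>t. (\<Sum>n. f (real (Suc n) * t)) - B / t + f 0 / 2 - f 0 / 2) \<longlongrightarrow> 0 - f 0 / 2) (at_right 0)"
    by (intro tendsto_intros)
  then show ?thesis by auto
qed

text \<open>By periodicity the generating function is N(x) / (1 - x^p). The vanishing sum over a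
  period makes x - 1 divide N, and cancelling it removes the pole at x = 1, that is at u = 0. The
  value there is - N'(1) / p.\<close>

lemma periodic_series_exp_rational:
  fixes c :: "nat \<Rightarrow> real"
  assumes p: "p > 0" and c: "\<And>n. c (n + p) = c n" "\<And>n. \<bar>c n\<bar> \<le> 1" "c 0 = 0" "(\<Sum>d<p. c d) = 0"
  shows "\<exists>f. exp_rational f \<and> f 0 = - (\<Sum>d<p. real d * c d) / real p \<and>
           (\<forall>u>0. ((\<lambda>d. c d * exp (- (real d * u))) has_sum f u) {1..})"
proof -
  define N where "N = (\<Sum>d<p. Polynomial.monom (c d) d)"
  have Nx: "poly N x = (\<Sum>d<p. c d * x ^ d)" for x
    by (simp add: N_def poly_sum poly_monom)
  have "poly N 1 = 0" by (simp add: Nx c)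
  then obtain Q where Q: "N = [:-1, 1:] * Q"
    using poly_eq_0_iff_dvd[of N 1] by (auto elim: dvdE)
  define D :: "real poly" where "D = (\<Sum>i<p. Polynomial.monom 1 i)"
  have Dx: "poly D x = (\<Sum>i<p. x ^ i)" for x
    by (simp add: D_def poly_sum poly_monom)
  have Dpos: "poly D x > 0" if "x \<ge> 0" for x
  proof -
    have "(\<Sum>i\<in>{0}. x ^ i) \<le> poly D x"
      unfolding Dx using that p by (intro sum_mono2) auto
    then show ?thesis by simp
  qed
  have "poly N 0 = 0"
    unfolding Nx using c(3) by (intro sum.neutral) (auto simp: power_0_left)
  then have Q0: "poly Q 0 = 0" by (simp add: Q)
  \<comment> \<open>Differentiating N = (x - 1) Q and setting x = 1 leaves only Q(1).\<close>
  have "poly (pderiv N) 1 = poly Q 1"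
    unfolding Q pderiv_mult by (simp add: pderiv_pCons)
  moreover have "poly (pderiv N) 1 = (\<Sum>d<p. real d * c d)"
  proof -
    have "pderiv (\<Sum>d<n. Polynomial.monom (c d) d) = (\<Sum>d<n. pderiv (Polynomial.monom (c d) d))" for n
      by (induction n) (simp_all add: pderiv_add)
    then show ?thesis unfolding N_def by (simp add: pderiv_monom poly_sum poly_monom)
  qed
  ultimately have Q1: "poly Q 1 = (\<Sum>d<p. real d * c d)" by simp
  define f where "f = (\<lambda>u. poly (- Q) (exp (- u)) / poly D (exp (- u)))"
  have "exp_rational f"
    unfolding exp_rational_def f_def using Dpos Q0 by (rule_tac exI[of _ "- Q"], rule_tac exI[of _ D]) auto
  moreover have "f 0 = - (\<Sum>d<p. real d * c d) / real p"
    by (simp add: f_def Q1 Dx)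
  moreover have "((\<lambda>d. c d * exp (- (real d * u))) has_sum f u) {1..}" if u: "u > 0" for u
  proof -
    define x where "x = exp (- u)"
    have x: "0 < x" "x < 1" using u by (auto simp: x_def)
    have xd: "exp (- (real d * u)) = x ^ d" for d
      by (simp add: x_def flip: exp_of_nat_mult)
    have abs: "summable (\<lambda>d. norm (c d * x ^ d))"
    proof (rule summable_comparison_test)
      show "summable (\<lambda>d. x ^ d)" using x by (intro summable_geometric) auto
      show "\<exists>N. \<forall>n\<ge>N. norm (norm (c n * x ^ n)) \<le> x ^ n"
        using c(2) x by (auto simp: abs_mult intro!: mult_left_le_one_le)
    qed
    define S where "S = (\<Sum>d. c d * x ^ d)"
    have S: "((\<lambda>d. c d * x ^ d) has_sum S) UNIV"
      unfolding S_def using norm_summable_imp_has_sum[OF abs summable_sums[OF summable_norm_cancel[OF abs]]] .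
    have "S = (\<Sum>d. c (d + p) * x ^ (d + p)) + (\<Sum>d<p. c d * x ^ d)"
      unfolding S_def by (rule suminf_split_initial_segment[OF summable_norm_cancel[OF abs]])
    also have "(\<Sum>d. c (d + p) * x ^ (d + p)) = (\<Sum>d. x ^ p * (c d * x ^ d))"
      by (simp add: c power_add mult_ac)
    also have "\<dots> = x ^ p * S"
      unfolding S_def by (rule suminf_mult[OF summable_norm_cancel[OF abs]])
    finally have "S * (1 - x ^ p) = poly N x" by (simp add: Nx algebra_simps)
    also have "1 - x ^ p = (1 - x) * poly D x"
      unfolding Dx by (rule one_diff_power_eq)
    also have "poly N x = (x - 1) * poly Q x" by (simp add: Q algebra_simps)
    finally have "(1 - x) * (S * poly D x) = (1 - x) * - poly Q x" by (simp add: algebra_simps)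
    then have "S * poly D x = - poly Q x" using x by (subst (asm) mult_cancel_left) auto
    then have "S = f u"
      using Dpos[of x] x by (simp add: f_def x_def[symmetric] field_simps)
    moreover have "((\<lambda>d. c d * x ^ d) has_sum S) {1..} \<longleftrightarrow> ((\<lambda>d. c d * x ^ d) has_sum S) UNIV"
      by (rule has_sum_cong_neutral) (use c(3) in \<open>auto simp: not_le\<close>)
    ultimately show ?thesis using S by (simp add: xd)
  qed
  ultimately show ?thesis by blast
qed

text \<open>Writing n = m d and summing over d first turns the Lambert series into the sum of f(m t)
  over m >= 1, with f from \<open>periodic_series_exp_rational\<close>; its constant term is -
  f(0)/2.\<close>

lemma lambert_series_asymptotic:
  fixes c :: "nat \<Rightarrow> real"
  assumes p: "p > 0" and c: "\<And>n. c (n + p) = c n" "\<And>n. \<bar>c n\<bar> \<le> 1" "c 0 = 0" "(\<Sum>d<p. c d) = 0"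
  shows "\<exists>B T. (\<forall>t>0. ((\<lambda>n. (\<Sum>d | d dvd n. c d) * exp (- (real n * t))) has_sum T t) {1..}) \<and>
           ((\<lambda>t. T t - B / t) \<longlongrightarrow> (\<Sum>d<p. real d * c d) / (2 * real p)) (at_right 0)"
proof -
  obtain f where f: "exp_rational f" "f 0 = - (\<Sum>d<p. real d * c d) / real p"
    and fs: "\<And>u. u > 0 \<Longrightarrow> ((\<lambda>d. c d * exp (- (real d * u))) has_sum f u) {1..}"
    using periodic_series_exp_rational[of p c] assms by blast
  obtain B where B: "((\<lambda>t. (\<Sum>n. f (real (Suc n) * t)) - B / t) \<longlongrightarrow> - f 0 / 2) (at_right 0)"
    using exp_rational_sum[OF f(1)] by blast
  define T where "T = (\<lambda>t. (\<Sum>n. f (real (Suc n) * t)))"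
  have "((\<lambda>n. (\<Sum>d | d dvd n. c d) * exp (- (real n * t))) has_sum T t) {1..}" if t: "t > 0" for t
  proof -
    define x where "x = exp (- t)"
    have x: "0 < x" "x < 1" using t by (auto simp: x_def)
    define g where "g = (\<lambda>(m, d). c d * exp (- (real d * (real m * t))))"
    have geo: "((\<lambda>n. x ^ n) has_sum (1 / (1 - x))) UNIV"
      using x by (intro sums_nonneg_imp_has_sum geometric_sums) auto
    have geo1: "(\<lambda>n. x ^ n) summable_on {1..}"
      using summable_on_subset[OF has_sum_imp_summable[OF geo]] by blast
    have "(\<lambda>(m, d). x ^ m * x ^ d / x) summable_on {1..} \<times> {1..}"
    proof (rule summable_on_SigmaI)
      show "((\<lambda>d. case (m, d) of (m, d) \<Rightarrow> x ^ m * x ^ d / x) has_sum x ^ m * (infsum (\<lambda>n. x ^ n) {1..} / x)) {1..}" for m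
        using has_sum_cmult_right[OF has_sum_cmult_left[OF has_sum_infsum[OF geo1], of "1 / x"], of "x ^ m"] by simp
      show "(\<lambda>m. x ^ m * (infsum (\<lambda>n. x ^ n) {1..} / x)) summable_on {1..}"
        using geo1 by (rule summable_on_cmult_left)
    qed (use x in auto)
    then have "(\<lambda>z. norm (g z)) summable_on {1..} \<times> {1..}"
    proof (rule summable_on_comparison_test)
      fix z :: "nat \<times> nat" assume "z \<in> {1..} \<times> {1..}"
      then obtain m d where z: "z = (m, d)" "m \<ge> 1" "d \<ge> 1" by auto
      \<comment> \<open>This is (m - 1)(d - 1) >= 0. It yields the summable majorant x^(m + d - 1),
        a product of geometric series, which permits the exchange of summations.\<close>
      have "m + d \<le> d * m + 1"
      proof -
        obtain m' d' where "m = Suc m'" "d = Suc d'" using z by (metis One_nat_def Suc_le_D)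
        then show ?thesis by simp
      qed
      then have xle: "x ^ (d * m) * x \<le> x ^ (m + d)"
        using x power_decreasing[of "m + d" "d * m + 1" x] by (simp add: mult.commute)
      have xexp: "exp (- (real d * (real m * t))) = x ^ (d * m)"
        by (simp add: x_def mult.assoc flip: exp_of_nat_mult)
      have cle: "\<bar>c d\<bar> * x ^ (d * m) \<le> x ^ (d * m)"
        using c(2)[of d] x by (intro mult_left_le_one_le) auto
      have "norm (g z) = \<bar>c d\<bar> * x ^ (d * m)"
        unfolding g_def z(1) using xexp x by (simp add: abs_mult)
      then have "norm (g z) * x \<le> x ^ (m + d)"
        using order_trans[OF mult_right_mono[OF cle, of x] xle] x by simp
      then show "norm (g z) \<le> (case z of (m, d) \<Rightarrow> x ^ m * x ^ d / x)"
        using x by (simp add: z power_add pos_le_divide_eq)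
    next
      show "0 \<le> norm (g z)" for z by simp
    qed
    then have "g summable_on {1..} \<times> {1..}" by (rule abs_summable_summable)
    then obtain S where S: "(g has_sum S) ({1..} \<times> {1..})" by (auto simp: summable_on_def)
    have "((\<lambda>m. f (real m * t)) has_sum S) {1..}"
    proof (rule has_sum_SigmaD[OF S])
      fix m :: nat assume "m \<in> {1..}"
      then show "((\<lambda>d. g (m, d)) has_sum f (real m * t)) {1..}"
        using fs[of "real m * t"] t by (simp add: g_def)
    qed
    moreover have "((\<lambda>n. f (real (Suc n) * t)) has_sum S) UNIV \<longleftrightarrow> ((\<lambda>m. f (real m * t)) has_sum S) {1..}"
      by (rule has_sum_reindex_bij_witness[where i = "\<lambda>n. n - 1" and j = Suc]) auto
    ultimately have "((\<lambda>n. f (real (Suc n) * t)) has_sum S) UNIV" by simp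
    then have ST: "S = T t" unfolding T_def by (intro sums_unique has_sum_imp_sums)
    have bij: "((\<lambda>(n, d). c d * exp (- (real n * t))) has_sum S) (Sigma {1..} (\<lambda>n. {d. d dvd n}))
        \<longleftrightarrow> (g has_sum S) ({1..} \<times> {1..})"
    proof (rule has_sum_reindex_bij_witness[where j = "\<lambda>(n, d). (n div d, d)" and i = "\<lambda>(m, d). (m * d, d)"])
      fix z :: "nat \<times> nat" assume "z \<in> Sigma {1..} (\<lambda>n. {d. d dvd n})"
      then obtain m d where z: "z = (m * d, d)" "m \<ge> 1" "d \<ge> 1"
        by (auto simp: mult.commute Suc_le_eq elim!: dvdE)
      show "(case case z of (n, d) \<Rightarrow> (n div d, d) of (m, d) \<Rightarrow> (m * d, d)) = z"
        "(case z of (n, d) \<Rightarrow> (n div d, d)) \<in> {1..} \<times> {1..}"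
        "g (case z of (n, d) \<Rightarrow> (n div d, d)) = (case z of (n, d) \<Rightarrow> c d * exp (- (real n * t)))"
        using z by (auto simp: g_def mult_ac)
    qed (auto simp: Suc_le_eq)
    have "((\<lambda>(n, d). c d * exp (- (real n * t))) has_sum S) (Sigma {1..} (\<lambda>n. {d. d dvd n}))"
      using bij S by simp
    then have "((\<lambda>n. (\<Sum>d | d dvd n. c d) * exp (- (real n * t))) has_sum S) {1..}"
    proof (rule has_sum_SigmaD)
      fix n :: nat assume "n \<in> {1..}"
      then show "((\<lambda>d. case (n, d) of (n, d) \<Rightarrow> c d * exp (- (real n * t))) has_sum
          (\<Sum>d | d dvd n. c d) * exp (- (real n * t))) {d. d dvd n}"
        by (auto simp: sum_distrib_right intro!: has_sum_finiteI)
    qed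
    then show ?thesis unfolding ST .
  qed
  moreover have "((\<lambda>t. T t - B / t) \<longlongrightarrow> (\<Sum>d<p. real d * c d) / (2 * real p)) (at_right 0)"
    using B by (simp add: T_def f(2) mult.commute)
  ultimately show ?thesis by blast
qed

section \<open>The number of ideals of given norm\<close>

definition multiplicative :: "(nat \<Rightarrow> int) \<Rightarrow> bool" where
  "multiplicative f \<longleftrightarrow> f 1 = 1 \<and> (\<forall>a b. a > 0 \<longrightarrow> b > 0 \<longrightarrow> coprime a b \<longrightarrow> f (a * b) = f a * f b)"

lemma dvd_coprime_mult_eq:
  fixes a b d :: nat
  assumes "coprime a b" "d dvd a * b"
  shows "gcd d a * gcd d b = d"
proof -
  obtain x y where xy: "d = x * y" "x dvd a" "y dvd b"
    using division_decomp[OF assms(2)] by blast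
  have "coprime y a" "coprime x b"
    using assms(1) xy coprime_divisors by (metis coprime_commute dvd_refl)+
  then have "gcd d a = x" "gcd d b = y"
    using xy by (simp_all add: gcd_mult_right_right_cancel gcd_mult_right_left_cancel
      gcd_mult_left_right_cancel gcd_mult_left_left_cancel gcd_proj1_iff coprime_commute)
  then show ?thesis using xy by simp
qed

text \<open>For coprime a and b the divisors of a b are the products of a divisor of a and one of b;
  both factors are recovered as gcds.\<close>

lemma multiplicative_dirichlet:
  assumes f: "multiplicative f" and g: "multiplicative g"
  shows "multiplicative (\<lambda>n. \<Sum>d | d dvd n. f d * g (n div d))"
  unfolding multiplicative_def
proof (intro conjI allI impI)
  show "(\<Sum>d | d dvd 1. f d * g (1 div d)) = 1"
    using f g by (simp add: multiplicative_def)
next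
  fix a b :: nat assume ab: "a > 0" "b > 0" "coprime a b"
  have "(\<Sum>d | d dvd a. f d * g (a div d)) * (\<Sum>d | d dvd b. f d * g (b div d))
      = (\<Sum>(x, y)\<in>{x. x dvd a} \<times> {y. y dvd b}. f x * g (a div x) * (f y * g (b div y)))"
    by (simp add: sum_product sum.cartesian_product)
  also have "\<dots> = (\<Sum>d | d dvd a * b. f d * g (a * b div d))"
  proof (rule sum.reindex_bij_witness[where j = "\<lambda>(x, y). x * y" and i = "\<lambda>d. (gcd d a, gcd d b)"])
    fix z assume "z \<in> {x. x dvd a} \<times> {y. y dvd b}"
    then obtain x y where z: "z = (x, y)" "x dvd a" "y dvd b" by auto
    have cop: "coprime x y" "coprime y a" "coprime x b"
      using ab(3) z coprime_divisors by (metis coprime_commute dvd_refl)+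
    have "gcd (x * y) a = x" "gcd (x * y) b = y"
      using cop z by (simp_all add: gcd_mult_left_right_cancel gcd_mult_left_left_cancel gcd_proj1_iff coprime_commute)
    then show "(gcd (case z of (x, y) \<Rightarrow> x * y) a, gcd (case z of (x, y) \<Rightarrow> x * y) b) = z"
      by (simp add: z)
    show "(case z of (x, y) \<Rightarrow> x * y) \<in> {d. d dvd a * b}"
      using z by (simp add: mult_dvd_mono)
    have pos: "x > 0" "y > 0" "a div x > 0" "b div y > 0"
      using z ab by (auto simp: div_greater_zero_iff dvd_imp_le intro: Nat.gr0I)
    have "coprime (a div x) (b div y)"
      using ab(3) z coprime_divisors by (metis dvd_div_mult_self dvd_triv_left)
    then have "g (a * b div (x * y)) = g (a div x) * g (b div y)"
      using g pos z by (simp add: multiplicative_def div_mult_div_if_dvd[symmetric])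
    moreover have "f (x * y) = f x * f y"
      using f pos cop by (simp add: multiplicative_def)
    ultimately show "f (case z of (x, y) \<Rightarrow> x * y) * g (a * b div (case z of (x, y) \<Rightarrow> x * y)) =
        (case z of (x, y) \<Rightarrow> f x * g (a div x) * (f y * g (b div y)))"
      by (simp add: z)
  next
    fix d assume "d \<in> {d. d dvd a * b}"
    then show "(case (gcd d a, gcd d b) of (x, y) \<Rightarrow> x * y) = d"
      using dvd_coprime_mult_eq[OF ab(3)] by simp
  qed auto
  finally show "(\<Sum>d | d dvd a * b. f d * g (a * b div d)) =
     (\<Sum>d | d dvd a. f d * g (a div d)) * (\<Sum>d | d dvd b. f d * g (b div d))" by simp
qed

lemma multiplicative_eqI:
  assumes f: "multiplicative f" and g: "multiplicative g"
    and eq: "\<And>q k. prime q \<Longrightarrow> f (q ^ k) = g (q ^ k)" and n: "n > 0"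
  shows "f n = g n"
  using n
proof (induction n rule: less_induct)
  case (less n)
  show ?case
  proof (cases "n = 1")
    case True
    then show ?thesis using f g by (simp add: multiplicative_def)
  next
    case False
    then obtain q where q: "prime q" "q dvd n" using prime_factor_nat by blast
    define r where "r = n div q ^ multiplicity q n"
    have "\<not> is_unit q" using q(1) not_prime_unit by blast
    then have r: "n = q ^ multiplicity q n * r" "\<not> q dvd r"
      using multiplicity_dvd[of q n] multiplicity_decompose[of n q] less.prems
      by (simp_all add: r_def)
    have k: "multiplicity q n > 0"
      using q less.prems prime_multiplicity_gt_zero_iff[of q n] by (simp add: prime_elem_nat_iff)
    have "r > 0" using r less.prems by (auto intro: Nat.gr0I)
    have "q ^ multiplicity q n > 1" by (rule one_less_power[OF prime_gt_1_nat[OF q(1)] k])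
    then have "r < n" using r(1) \<open>r > 0\<close> by (metis mult.left_neutral mult_less_cancel2)
    have "coprime (q ^ multiplicity q n) r"
      using r(2) q(1) by (simp add: prime_imp_coprime coprime_power_left_iff)
    then have "f n = f (q ^ multiplicity q n) * f r" "g n = g (q ^ multiplicity q n) * g r"
      using f g \<open>r > 0\<close> q(1) by (subst r(1); simp add: multiplicative_def prime_gt_0_nat)+
    then show ?thesis using eq[OF q(1)] less.IH[OF \<open>r < n\<close> \<open>r > 0\<close>] by simp
  qed
qed

text \<open>\<open>b^2 + b + m\<close> is the norm of b + omega, where omega^2 = omega - m. So these
  residues index the ideals with basis a, b + omega.\<close>

definition quad_roots :: "nat \<Rightarrow> nat \<Rightarrow> int set" where
  "quad_roots m a = {b. 0 \<le> b \<and> b < int a \<and> int a dvd b\<^sup>2 + b + int m}"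

lemma finite_quad_roots [simp]: "finite (quad_roots m a)"
  by (rule finite_subset[of _ "{0..<int a}"]) (auto simp: quad_roots_def)

lemma quad_cong_dvd:
  fixes a b c m :: int
  assumes "[b = c] (mod a)"
  shows "a dvd b\<^sup>2 + b + m \<longleftrightarrow> a dvd c\<^sup>2 + c + m"
proof -
  have "[b\<^sup>2 + b + m = c\<^sup>2 + c + m] (mod a)"
    by (intro cong_add cong_pow cong_refl assms)
  then show ?thesis by (rule cong_dvd_iff)
qed

text \<open>Chinese remainder theorem: a root modulo a b is a pair of roots modulo a and modulo
  b.\<close>

lemma multiplicative_card_quad_roots: "multiplicative (\<lambda>a. int (card (quad_roots m a)))"
  unfolding multiplicative_def
proof (intro conjI allI impI)
  have "quad_roots m 1 = {0}" by (auto simp: quad_roots_def)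
  then show "int (card (quad_roots m 1)) = 1" by simp
next
  fix a b :: nat assume ab: "a > 0" "b > 0" "coprime a b"
  then have cop: "coprime (int a) (int b)" by simp
  have "bij_betw (\<lambda>x. (x mod int a, x mod int b)) (quad_roots m (a * b)) (quad_roots m a \<times> quad_roots m b)"
    unfolding bij_betw_def
  proof (intro conjI inj_onI equalityI subsetI)
    fix x y assume xy: "x \<in> quad_roots m (a * b)" "y \<in> quad_roots m (a * b)"
      and "(x mod int a, x mod int b) = (y mod int a, y mod int b)"
    then have "[x = y] (mod int a)" "[x = y] (mod int b)" by (auto simp: Cong.cong_def)
    then have "[x = y] (mod (int a * int b))" using cop by (rule coprime_cong_mult)
    then show "x = y" using xy by (intro cong_less_imp_eq_int[of x "int (a * b)"]) (auto simp: quad_roots_def)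
  next
    fix z assume "z \<in> (\<lambda>x. (x mod int a, x mod int b)) ` quad_roots m (a * b)"
    then obtain x where x: "x \<in> quad_roots m (a * b)" "z = (x mod int a, x mod int b)" by blast
    have "int a dvd x\<^sup>2 + x + int m" "int b dvd x\<^sup>2 + x + int m"
      using x(1) by (auto simp: quad_roots_def intro: dvd_mult_left dvd_mult_right)
    then show "z \<in> quad_roots m a \<times> quad_roots m b"
      using ab quad_cong_dvd[of "x mod int a" x "int a" "int m"] quad_cong_dvd[of "x mod int b" x "int b" "int m"]
      by (simp add: x(2) quad_roots_def)
  next
    fix z assume z: "z \<in> quad_roots m a \<times> quad_roots m b"
    obtain x where x: "[x = fst z] (mod int a)" "[x = snd z] (mod int b)"
      using binary_chinese_remainder_int[OF cop] by blast
    define y where "y = x mod (int a * int b)"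
    have y: "[y = fst z] (mod int a)" "[y = snd z] (mod int b)"
      using x by (auto simp: y_def Cong.cong_def mod_mult2_eq mod_mod_cancel)
    have "int a dvd y\<^sup>2 + y + int m" "int b dvd y\<^sup>2 + y + int m"
      using z quad_cong_dvd[OF y(1)] quad_cong_dvd[OF y(2)] by (auto simp: quad_roots_def)
    then have "int a * int b dvd y\<^sup>2 + y + int m" using cop by (rule divides_mult)
    then have "y \<in> quad_roots m (a * b)" using ab by (simp add: quad_roots_def y_def)
    moreover have "z = (y mod int a, y mod int b)"
      using y z by (auto simp: Cong.cong_def quad_roots_def)
    ultimately show "z \<in> (\<lambda>x. (x mod int a, x mod int b)) ` quad_roots m (a * b)" by blast
  qed
  then show "int (card (quad_roots m (a * b))) = int (card (quad_roots m a)) * int (card (quad_roots m b))"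
    by (simp add: bij_betw_same_card card_cartesian_product)
qed

lemma multiplicative_square: "multiplicative (\<lambda>n. of_bool (is_nth_power 2 n))"
  unfolding multiplicative_def by (auto simp: is_nth_power_mult_coprime_nat_iff)

lemma multiplicative_one: "multiplicative (\<lambda>_. 1)"
  by (simp add: multiplicative_def)

section \<open>The Legendre symbol\<close>

lemma Legendre_cases: "Legendre a p = 0 \<or> Legendre a p = 1 \<or> Legendre a p = -1"
  by (simp add: Legendre_def)

text \<open>Two numbers in {-1, 0, 1} differ by at most 2, hence a congruence modulo p > 2 between
  them is an equality. This turns Euler's criterion into identities.\<close>

lemma Legendre_eqI:
  assumes "p > (2::int)" "[Legendre a q = x] (mod p)" "x \<in> {-1, 0, 1}"
  shows "Legendre a q = x"
proof -
  have "p dvd Legendre a q - x" using assms(2) by (simp add: cong_iff_dvd_diff)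
  moreover have "\<bar>Legendre a q - x\<bar> \<le> 2"
    using Legendre_cases[of a q] assms(3) by auto
  ultimately show ?thesis using assms(1) dvd_imp_le_int[of "Legendre a q - x" p] by fastforce
qed

lemma Legendre_mult:
  assumes "prime (p::nat)" "p > 2"
  shows "Legendre (a * b) (int p) = Legendre a (int p) * Legendre b (int p)"
proof (rule Legendre_eqI)
  have "[Legendre (a * b) (int p) = (a * b) ^ ((p - 1) div 2)] (mod int p)"
    by (rule euler_criterion[OF assms])
  also have "(a * b) ^ ((p - 1) div 2) = a ^ ((p - 1) div 2) * b ^ ((p - 1) div 2)"
    by (rule power_mult_distrib)
  also have "[\<dots> = Legendre a (int p) * Legendre b (int p)] (mod int p)"
    by (intro cong_mult cong_sym[OF euler_criterion[OF assms]])
  finally show "[Legendre (a * b) (int p) = Legendre a (int p) * Legendre b (int p)] (mod int p)" .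
  show "Legendre a (int p) * Legendre b (int p) \<in> {-1, 0, 1}"
    using Legendre_cases[of a "int p"] Legendre_cases[of b "int p"] by auto
qed (use assms in auto)

lemma Legendre_minus_one:
  assumes "prime (p::nat)" "p > 2"
  shows "Legendre (-1) (int p) = (-1) ^ ((p - 1) div 2)"
proof (rule Legendre_eqI)
  show "[Legendre (- 1) (int p) = (- 1) ^ ((p - 1) div 2)] (mod int p)"
    by (rule euler_criterion[OF assms])
qed (use assms in \<open>auto simp: minus_one_power_iff\<close>)

text \<open>Gauss's lemma: the numbers 2 x with 1 <= x <= 2 m - 1 = (p - 1)/2 are already reduced
  modulo p, and exactly those with x >= m exceed (p - 1)/2, which are m in number.\<close>

lemma Legendre_two:
  assumes "prime p" "p + 1 = 4 * m" "p > 3"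
  shows "Legendre 2 (int p) = (-1) ^ m"
proof -
  interpret GAUSS p 2
    using assms by unfold_locales (auto simp: Cong.cong_def)
  have half: "(int p - 1) div 2 = 2 * int m - 1" using assms by linarith
  have pm: "int p = 4 * int m - 1" using assms by linarith
  have "C = (\<lambda>x. x * 2) ` A"
    unfolding C_def B_def image_image A_def half pm by (intro image_cong refl) auto
  then have "E = (\<lambda>x. x * 2) ` {int m..2 * int m - 1}"
    unfolding E_def A_def half using assms by auto
  then have "card E = m"
    by (simp add: card_image inj_on_def)
  then show ?thesis using gauss_lemma by simp
qed

text \<open>\<open>m\<close> is chosen so that x^2 + x + m has discriminant 1 - 4 m = - p. The bound
  on p excludes the field of the cube roots of unity with its six units.\<close>

locale prime_3_mod_4 =
  fixes p m :: nat
  assumes prime_p: "prime p" and p_m: "p + 1 = 4 * m" and p_gt_3: "p > 3"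
begin

definition chi :: "nat \<Rightarrow> int" where "chi n = Legendre (int n) (int p)"

lemma chi_mult: "chi (a * b) = chi a * chi b"
  unfolding chi_def using Legendre_mult[OF prime_p] p_gt_3 by simp

lemma chi_cong:
  assumes "[x = y] (mod p)"
  shows "chi x = chi y"
proof -
  have "[int x = int y] (mod int p)" using assms by (simp add: cong_int_iff)
  then have "[int x = 0] (mod int p) \<longleftrightarrow> [int y = 0] (mod int p)"
    "QuadRes (int p) (int x) \<longleftrightarrow> QuadRes (int p) (int y)"
    unfolding QuadRes_def by (meson cong_sym cong_trans)+
  then show ?thesis by (simp add: chi_def Legendre_def)
qed

lemma chi_1: "chi 1 = 1"
proof -
  have "QuadRes (int p) 1" unfolding QuadRes_def by (rule exI[of _ 1]) simp
  then show ?thesis using p_gt_3 by (simp add: chi_def Legendre_def Cong.cong_def)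
qed

lemma chi_cases: "chi n = 0 \<or> chi n = 1 \<or> chi n = -1"
  unfolding chi_def by (rule Legendre_cases)

lemma chi_power: "chi (n ^ k) = chi n ^ k"
  by (induction k) (simp_all add: chi_mult chi_1[simplified])

lemma chi_0_iff: "chi n = 0 \<longleftrightarrow> p dvd n"
  by (simp add: chi_def Legendre_def cong_0_iff)

lemma multiplicative_chi: "multiplicative chi"
  by (simp add: multiplicative_def chi_mult chi_1[simplified])

lemma int_p_eq: "int p = 4 * int m - 1"
  using arg_cong[OF p_m, of int] by simp

lemma m_ge_2: "m \<ge> 2" using p_m p_gt_3 by linarith

lemma four_quad: "4 * (b\<^sup>2 + b + int m) = (2 * b + 1)\<^sup>2 + int p"
  using p_m by (simp add: power2_eq_square algebra_simps)

lemma quad_dvd_iff_QuadRes: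
  assumes q: "prime q" "odd q"
  shows "(\<exists>b. int q dvd b\<^sup>2 + b + int m) \<longleftrightarrow> QuadRes (int q) (- int p)"
proof
  assume "\<exists>b. int q dvd b\<^sup>2 + b + int m"
  then obtain b where "int q dvd b\<^sup>2 + b + int m" by blast
  then have "int q dvd (2 * b + 1)\<^sup>2 + int p"
    unfolding four_quad[symmetric] by (rule dvd_mult)
  then show "QuadRes (int q) (- int p)"
    unfolding QuadRes_def cong_iff_dvd_diff by (intro exI[of _ "2 * b + 1"]) simp
next
  assume "QuadRes (int q) (- int p)"
  then obtain y where y: "[y\<^sup>2 = - int p] (mod int q)" unfolding QuadRes_def by blast
  \<comment> \<open>Only an odd square root has the form 2 b + 1; as q is odd, adding q changes the
    parity.\<close>
  define z where "z = (if odd y then y else y + int q)"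
  have "odd z" using q by (simp add: z_def)
  then obtain b where b: "z = 2 * b + 1" by (elim oddE)
  have "[z = y] (mod int q)" by (simp add: z_def Cong.cong_def)
  then have "[z\<^sup>2 = - int p] (mod int q)" using y cong_pow cong_trans by blast
  then have "int q dvd 4 * (b\<^sup>2 + b + int m)"
    unfolding four_quad b[symmetric] by (simp add: cong_iff_dvd_diff)
  moreover have "coprime (int q) 4"
    using q(2) by (simp add: coprime_int_iff[of q 4, simplified] coprime_right_2_iff_odd flip: power2_eq_square)
      (metis coprime_power_right_iff coprime_right_2_iff_odd numeral_Bit0 power2_eq_square mult_2 one_add_one)
  ultimately show "\<exists>b. int q dvd b\<^sup>2 + b + int m"
    using coprime_dvd_mult_right_iff by blast
qed

text \<open>For odd q reciprocity gives (q/p) = (-p/q), because p is 3 modulo 4, and -p is the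
  discriminant of the polynomial. For q = 2 the polynomial takes the parity of m, which agrees with
  the value (-1)^m of (2/p).\<close>

lemma chi_eq_1_iff:
  assumes q: "prime q" "q \<noteq> p"
  shows "chi q = 1 \<longleftrightarrow> (\<exists>b. int q dvd b\<^sup>2 + b + int m)"
proof (cases "q = 2")
  case True
  have "(\<exists>b::int. 2 dvd b\<^sup>2 + b + int m) \<longleftrightarrow> even m" by auto
  moreover have "chi q = (-1) ^ m"
    using Legendre_two[OF prime_p p_m p_gt_3] True by (simp add: chi_def)
  ultimately show ?thesis using True by (simp add: minus_one_power_iff)
next
  case False
  then have q2: "q > 2" and "odd q" using q(1) prime_ge_2_nat[of q] prime_odd_nat by auto
  have np: "\<not> int q dvd int p"
    using q prime_p primes_dvd_imp_eq by auto
  define e where "e = (q - 1) div 2"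
  have "odd ((p - 1) div 2)" using p_m by presburger
  then have neg: "(- 1 :: int) ^ ((p - 1) div 2 * ((q - 1) div 2)) = (- 1) ^ e"
    by (simp add: power_mult e_def)
  have rec: "Legendre (int p) (int q) * chi q = (- 1) ^ e"
    using Quadratic_Reciprocity[of p q] prime_p q q2 p_gt_3 neg by (simp add: chi_def)
  have "Legendre (- int p) (int q) = (- 1) ^ e * Legendre (int p) (int q)"
    using Legendre_mult[of q "-1" "int p"] Legendre_minus_one[of q] q q2 by (simp add: e_def)
  then have "Legendre (- int p) (int q) = chi q"
    using rec Legendre_cases[of "int p" "int q"] chi_cases[of q]
    by (cases "even e") auto
  moreover have "Legendre (- int p) (int q) = 1 \<longleftrightarrow> QuadRes (int q) (- int p)"
    using np by (auto simp: Legendre_def cong_0_iff)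
  ultimately show ?thesis using quad_dvd_iff_QuadRes[OF q(1) \<open>odd q\<close>] by simp
qed

text \<open>2 b + 1 is the derivative at b. A multiple root modulo q would make q divide the
  discriminant - p.\<close>

lemma quad_dvd_imp_not_dvd_deriv:
  assumes "prime q" "q \<noteq> p" "int q dvd b\<^sup>2 + b + int m"
  shows "\<not> int q dvd 2 * b + 1"
proof
  assume "int q dvd 2 * b + 1"
  then have "int q dvd (2 * b + 1)\<^sup>2" by (simp add: power2_eq_square)
  moreover have "int q dvd (2 * b + 1)\<^sup>2 + int p"
    unfolding four_quad[symmetric] using assms(3) by (rule dvd_mult)
  ultimately have "int q dvd int p" by (simp add: dvd_add_right_iff)
  then show False using assms prime_p primes_dvd_imp_eq by auto
qed

lemma quad_diff: "(b\<^sup>2 + b + int m) - (c\<^sup>2 + c + int m) = (b - c) * (b + c + 1)"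
  by (simp add: power2_eq_square algebra_simps)

text \<open>The roots add up to -1, so a root c comes with -1 - c; they are distinct since 2 c + 1
  is a unit modulo q.\<close>

lemma card_quad_roots_prime:
  assumes q: "prime q" "q \<noteq> p"
  shows "int (card (quad_roots m q)) = 1 + chi q"
proof (cases "chi q = 1")
  case False
  moreover have "chi q \<noteq> 0" using q prime_p primes_dvd_imp_eq by (auto simp: chi_0_iff)
  ultimately have "chi q = - 1" using chi_cases by blast
  moreover have "quad_roots m q = {}"
    using chi_eq_1_iff[OF q] False by (auto simp: quad_roots_def)
  ultimately show ?thesis by simp
next
  case True
  then obtain c where c: "int q dvd c\<^sup>2 + c + int m" using chi_eq_1_iff[OF q] by blast
  have q0: "int q > 0" using q by (simp add: prime_gt_0_nat)
  have pq: "prime (int q)" using q by simp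
  have "quad_roots m q = {c mod int q, (- c - 1) mod int q}"
  proof (intro equalityI subsetI)
    fix b assume b: "b \<in> quad_roots m q"
    then have "int q dvd (b - c) * (b + c + 1)"
      unfolding quad_diff[symmetric] using c b by (intro dvd_diff) (auto simp: quad_roots_def)
    then have "int q dvd b - c \<or> int q dvd b + c + 1"
      using pq prime_dvd_multD by blast
    moreover have "b + c + 1 = b - (- c - 1)" by simp
    ultimately have "int q dvd b - c \<or> int q dvd b - (- c - 1)" by metis
    then have "b mod int q = c mod int q \<or> b mod int q = (- c - 1) mod int q"
      by (simp add: mod_eq_dvd_iff)
    then show "b \<in> {c mod int q, (- c - 1) mod int q}" using b by (auto simp: quad_roots_def)
  next
    fix b assume "b \<in> {c mod int q, (- c - 1) mod int q}"
    moreover have "int q dvd (- c - 1)\<^sup>2 + (- c - 1) + int m"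
      using c by (simp add: power2_eq_square algebra_simps)
    ultimately show "b \<in> quad_roots m q"
      using c q0 quad_cong_dvd[of "c mod int q" c "int q" "int m"]
        quad_cong_dvd[of "(- c - 1) mod int q" "- c - 1" "int q" "int m"]
      by (auto simp: quad_roots_def)
  qed
  moreover have "c mod int q \<noteq> (- c - 1) mod int q"
    using quad_dvd_imp_not_dvd_deriv[OF q c] by (simp add: mod_eq_dvd_iff algebra_simps)
  ultimately show ?thesis using True by simp
qed

text \<open>Hensel lifting: reduction modulo q^k is a bijection because all roots are simple. The
  condition k > 0 makes q divide Q = q^k, so that the quadratic term in the lift y + z Q vanishes
  and z solves a linear congruence.\<close>

lemma card_quad_roots_prime_power_Suc:
  assumes q: "prime q" "q \<noteq> p" and k: "k > 0"
  shows "card (quad_roots m (q ^ Suc k)) = card (quad_roots m (q ^ k))"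
proof -
  define Q where "Q = int q ^ k"
  have q0: "int q > 0" "Q > 0" using q by (simp_all add: prime_gt_0_nat Q_def)
  have pq: "prime (int q)" using q by simp
  have qQ: "int q dvd Q" using k by (simp add: Q_def)
  have QS: "int (q ^ Suc k) = int q * Q" by (simp add: Q_def)
  have "bij_betw (\<lambda>x. x mod Q) (quad_roots m (q ^ Suc k)) (quad_roots m (q ^ k))"
    unfolding bij_betw_def
  proof (intro conjI inj_onI equalityI subsetI)
    fix x y assume xy: "x \<in> quad_roots m (q ^ Suc k)" "y \<in> quad_roots m (q ^ Suc k)" "x mod Q = y mod Q"
    have "Q dvd x - y" using xy(3) by (simp add: mod_eq_dvd_iff)
    then have "int q dvd x - y" using qQ dvd_trans by blast
    have "int q dvd x\<^sup>2 + x + int m"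
      using xy(1) unfolding quad_roots_def QS by (auto intro: dvd_mult_left)
    then have nd: "\<not> int q dvd 2 * x + 1" by (rule quad_dvd_imp_not_dvd_deriv[OF q])
    have "\<not> int q dvd x + y + 1"
    proof
      assume "int q dvd x + y + 1"
      then have "int q dvd (x - y) + (x + y + 1)" using \<open>int q dvd x - y\<close> by (rule dvd_add[rotated])
      then show False using nd by (simp add: algebra_simps)
    qed
    then have "coprime (int q ^ Suc k) (x + y + 1)"
      using pq by (simp add: prime_imp_coprime del: power_Suc)
    moreover have "int q ^ Suc k dvd (x - y) * (x + y + 1)"
      unfolding quad_diff[symmetric] using xy by (intro dvd_diff) (auto simp: quad_roots_def)
    ultimately have "int q ^ Suc k dvd x - y" using coprime_dvd_mult_left_iff by blast
    then have "[x = y] (mod int (q ^ Suc k))" by (simp add: cong_iff_dvd_diff)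
    then show "x = y"
      using xy by (intro cong_less_imp_eq_int[of x "int (q ^ Suc k)"]) (auto simp: quad_roots_def)
  next
    fix y assume "y \<in> (\<lambda>x. x mod Q) ` quad_roots m (q ^ Suc k)"
    then obtain x where x: "y = x mod Q" "x \<in> quad_roots m (q ^ Suc k)" by blast
    have "Q dvd x\<^sup>2 + x + int m"
      using x(2) unfolding quad_roots_def QS by (auto intro: dvd_mult_right)
    then show "y \<in> quad_roots m (q ^ k)"
      using quad_cong_dvd[of "x mod Q" x Q "int m"] q0 by (simp add: x quad_roots_def flip: Q_def)
  next
    fix y assume y: "y \<in> quad_roots m (q ^ k)"
    then have yQ: "0 \<le> y" "y < Q" "Q dvd y\<^sup>2 + y + int m" by (auto simp: quad_roots_def Q_def)
    then obtain r where r: "y\<^sup>2 + y + int m = Q * r" by (elim dvdE)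
    have "\<not> int q dvd 2 * y + 1"
      using quad_dvd_imp_not_dvd_deriv[OF q dvd_trans[OF qQ yQ(3)]] .
    then have "coprime (2 * y + 1) (int q)" using pq by (simp add: prime_imp_coprime coprime_commute)
    then obtain z where z: "[(2 * y + 1) * z = - r] (mod int q)"
      using cong_solve_coprime_int[of "2 * y + 1" "int q"]
      by (metis cong_scalar_left mult.assoc mult.commute mult.right_neutral)
    define x where "x = (y + z * Q) mod (int q * Q)"
    have "(y + z * Q)\<^sup>2 + (y + z * Q) + int m = Q * (r + (2 * y + 1) * z + z\<^sup>2 * Q)"
      using r by (simp add: power2_eq_square algebra_simps)
    moreover have "int q dvd r + (2 * y + 1) * z + z\<^sup>2 * Q"
      using z qQ by (simp add: cong_iff_dvd_diff add.commute)
    ultimately have "int q * Q dvd (y + z * Q)\<^sup>2 + (y + z * Q) + int m"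
      by (simp add: mult.commute mult_dvd_mono)
    then have "x \<in> quad_roots m (q ^ Suc k)"
      using quad_cong_dvd[of x "y + z * Q" "int q * Q" "int m"] q0
      unfolding quad_roots_def QS by (simp add: x_def)
    moreover have "y = x mod Q" using yQ by (simp add: x_def mod_mod_cancel)
    ultimately show "y \<in> (\<lambda>x. x mod Q) ` quad_roots m (q ^ Suc k)" by blast
  qed
  then show ?thesis by (rule bij_betw_same_card)
qed

text \<open>Modulo p the discriminant vanishes: four times the polynomial is congruent to a square,
  so there is one double root, (p - 1)/2.\<close>

lemma p_dvd_quad_iff: "int p dvd b\<^sup>2 + b + int m \<longleftrightarrow> int p dvd 2 * b + 1"
proof -
  have "coprime (int p) 4" using p_m by (metis coprime_Suc_right_nat coprime_commute coprime_int_iff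
        coprime_mult_left_iff dvd_def coprime_add_one_left of_nat_numeral add.commute Suc_eq_plus1)
  then have "int p dvd b\<^sup>2 + b + int m \<longleftrightarrow> int p dvd 4 * (b\<^sup>2 + b + int m)"
    by (rule coprime_dvd_mult_right_iff[symmetric])
  also have "\<dots> \<longleftrightarrow> int p dvd (2 * b + 1)\<^sup>2" unfolding four_quad by simp
  also have "\<dots> \<longleftrightarrow> int p dvd 2 * b + 1"
    using prime_p by (simp add: prime_dvd_power_iff)
  finally show ?thesis .
qed

lemma card_quad_roots_p: "card (quad_roots m p) = 1"
proof -
  have "quad_roots m p = {2 * int m - 1}"
  proof (intro equalityI subsetI)
    fix b assume "b \<in> quad_roots m p"
    then have b: "0 \<le> b" "b < int p" "int p dvd 2 * b + 1" by (auto simp: quad_roots_def p_dvd_quad_iff)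
    then obtain k where k: "2 * b + 1 = int p * k" by (elim dvdE)
    have "k > 0" using k b by (smt (verit) mult_nonneg_nonpos of_nat_0_le_iff)
    moreover have "int p * k < int p * 2" using k b by linarith
    then have "k < 2" by (rule mult_left_less_imp_less) simp
    ultimately have "k = 1" by simp
    then show "b \<in> {2 * int m - 1}" using k p_m by auto
  next
    fix b assume "b \<in> {2 * int m - 1}"
    moreover have "2 * (2 * int m - 1) + 1 = int p" using int_p_eq by simp
    ultimately have b: "b = 2 * int m - 1" "int p dvd 2 * b + 1" by auto
    then have "int p dvd b\<^sup>2 + b + int m" by (simp only: p_dvd_quad_iff)
    then show "b \<in> quad_roots m p"
      using b(1) int_p_eq m_ge_2 by (simp add: quad_roots_def)
  qed
  then show ?thesis by simp
qed

text \<open>If p^2 divided the polynomial at b, it would divide both (2 b + 1)^2 + p and (2 b +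
  1)^2, hence p.\<close>

lemma quad_roots_p_power: "quad_roots m (p ^ Suc (Suc k)) = {}"
proof -
  have False if b: "int (p ^ Suc (Suc k)) dvd b\<^sup>2 + b + int m" for b
  proof -
    have "(int p)\<^sup>2 dvd int (p ^ Suc (Suc k))" by (simp add: power2_eq_square)
    then have sq: "(int p)\<^sup>2 dvd b\<^sup>2 + b + int m" using b dvd_trans by blast
    then have "int p dvd b\<^sup>2 + b + int m" by (auto simp: power2_eq_square intro: dvd_mult_left)
    then have "(int p)\<^sup>2 dvd (2 * b + 1)\<^sup>2" by (simp add: p_dvd_quad_iff)
    moreover have "(int p)\<^sup>2 dvd (2 * b + 1)\<^sup>2 + int p"
      unfolding four_quad[symmetric] using sq by (rule dvd_mult)
    ultimately have "(int p)\<^sup>2 dvd int p" by (simp add: dvd_add_right_iff)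
    then have "(int p)\<^sup>2 \<le> int p" using p_gt_3 by (intro zdvd_imp_le) auto
    then show False using p_gt_3 by (simp add: power2_eq_square)
  qed
  then show ?thesis by (auto simp: quad_roots_def)
qed

text \<open>The number of normal forms c (a Z + (b + omega) Z) of norm n = c^2 a: the divisor d is
  c^2, and \<open>n div d\<close> is a.\<close>

definition ideal_count :: "nat \<Rightarrow> int" where
  "ideal_count n = (\<Sum>d | d dvd n. of_bool (is_nth_power 2 d) * int (card (quad_roots m (n div d))))"

lemma sum_divisors_prime_power:
  fixes f :: "nat \<Rightarrow> int"
  assumes "prime q"
  shows "(\<Sum>d | d dvd q ^ k. f d) = (\<Sum>i\<le>k. f (q ^ i))"
proof -
  have "{d. d dvd q ^ k} = (\<lambda>i. q ^ i) ` {..k}"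
    using divides_primepow_nat[OF assms] by auto
  moreover have "inj_on (\<lambda>i. q ^ i) {..k}"
    using power_inject_exp[OF prime_gt_1_nat[OF assms]] by (auto simp: inj_on_def)
  ultimately show ?thesis by (simp add: sum.reindex)
qed

text \<open>An identity of Euler factors: the root counts have generating function (1 + X) / (1 -
  chi(q) X), and multiplying by 1 / (1 - X^2) for the squares gives 1 / ((1 - X) (1 - chi(q)
  X)).\<close>

lemma ideal_count_prime_power:
  assumes q: "prime q"
  shows "ideal_count (q ^ k) = (\<Sum>d | d dvd q ^ k. chi d)"
proof -
  define r where "r = (\<lambda>j. int (card (quad_roots m (q ^ j))))"
  have "quad_roots m 1 = {0}" by (auto simp: quad_roots_def)
  then have r0: "r 0 = 1" by (simp add: r_def)
  have r1: "r 1 = 1 + chi q"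
    using card_quad_roots_prime[OF q] card_quad_roots_p chi_0_iff[of p] by (cases "q = p") (auto simp: r_def)
  \<comment> \<open>One formula for all cases: 0 for q = p, and otherwise 2 or 0 according to the
    sign of chi q.\<close>
  have r2: "r (Suc (Suc j)) = chi q ^ Suc j + chi q ^ Suc (Suc j)" for j
  proof (cases "q = p")
    case True
    then show ?thesis using quad_roots_p_power chi_0_iff[of p] by (simp add: r_def)
  next
    case False
    have "r (Suc (Suc j)) = r 1"
      by (induction j) (use card_quad_roots_prime_power_Suc[OF q False] in \<open>simp_all add: r_def del: power_Suc\<close>)
    moreover have "chi q = 1 \<or> chi q = -1"
      using chi_cases[of q] False q prime_p primes_dvd_imp_eq by (auto simp: chi_0_iff)
    ultimately show ?thesis using r1 by auto
  qed
  have A: "ideal_count (q ^ k) = (\<Sum>i\<le>k. of_bool (even i) * r (k - i))" for k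
    unfolding ideal_count_def sum_divisors_prime_power[OF q]
    by (intro sum.cong refl)
       (use q in \<open>auto simp: is_nth_power_prime_power_nat_iff r_def power_diff prime_gt_0_nat\<close>)
  have X: "(\<Sum>d | d dvd q ^ k. chi d) = (\<Sum>i\<le>k. chi q ^ i)" for k
    unfolding sum_divisors_prime_power[OF q] by (simp add: chi_power)
  have step: "(\<Sum>i\<le>Suc (Suc k). of_bool (even i) * r (Suc (Suc k) - i)) =
      r (Suc (Suc k)) + (\<Sum>i\<le>k. of_bool (even i) * r (k - i))" for k
    by (simp only: sum.atMost_Suc_shift) simp
  have "(\<Sum>i\<le>k. of_bool (even i) * r (k - i)) = (\<Sum>i\<le>k. chi q ^ i)"
  proof (induction k rule: less_induct)
    case (less k)
    consider "k = 0" | "k = 1" | j where "k = Suc (Suc j)"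
      by (metis One_nat_def not0_implies_Suc)
    then show ?case
    proof cases
      case (3 j)
      show ?thesis unfolding 3 step using less.IH[of j] r2[of j] 3 by simp
    qed (use r0 r1 in auto)
  qed
  then show ?thesis unfolding A X .
qed

lemma ideal_count_eq: "n > 0 \<Longrightarrow> ideal_count n = (\<Sum>d | d dvd n. chi d)"
proof (rule multiplicative_eqI[where f = ideal_count])
  show "multiplicative ideal_count"
    unfolding ideal_count_def
    by (rule multiplicative_dirichlet[OF multiplicative_square multiplicative_card_quad_roots])
  show "multiplicative (\<lambda>n. \<Sum>d | d dvd n. chi d)"
    using multiplicative_dirichlet[OF multiplicative_chi multiplicative_one] by simp
qed (rule ideal_count_prime_power)

end

section \<open>Rings of integers and ideal classes\<close>

definition subring_set :: "complex set \<Rightarrow> bool" where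
  "subring_set A \<longleftrightarrow> 1 \<in> A \<and> (\<forall>x\<in>A. \<forall>y\<in>A. x - y \<in> A \<and> x * y \<in> A)"

lemma subring_setD:
  assumes "subring_set A"
  shows "1 \<in> A" "0 \<in> A" "x \<in> A \<Longrightarrow> y \<in> A \<Longrightarrow> x - y \<in> A" "x \<in> A \<Longrightarrow> y \<in> A \<Longrightarrow> x + y \<in> A"
    "x \<in> A \<Longrightarrow> y \<in> A \<Longrightarrow> x * y \<in> A" "x \<in> A \<Longrightarrow> - x \<in> A"
proof -
  show 1: "1 \<in> A" and *: "x \<in> A \<Longrightarrow> y \<in> A \<Longrightarrow> x - y \<in> A" "x \<in> A \<Longrightarrow> y \<in> A \<Longrightarrow> x * y \<in> A" for x y
    using assms by (auto simp: subring_set_def)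
  show 0: "0 \<in> A" using *(1)[OF 1 1] by simp
  show neg: "x \<in> A \<Longrightarrow> - x \<in> A" for x using *(1)[OF 0, of x] by simp
  show "x \<in> A \<Longrightarrow> y \<in> A \<Longrightarrow> x + y \<in> A" using *(1)[of x "- y"] neg by simp
qed

text \<open>The set-based counterpart of the members of \<open>nonzero_ideals\<close>; negatives
  arise from multiplication by -1, which lies in A when A is a subring.\<close>

definition ideal_in :: "complex set \<Rightarrow> complex set \<Rightarrow> bool" where
  "ideal_in A I \<longleftrightarrow> I \<subseteq> A \<and> I \<noteq> {0} \<and> 0 \<in> I \<and> (\<forall>x\<in>I. \<forall>y\<in>I. x + y \<in> I) \<and> (\<forall>a\<in>A. \<forall>x\<in>I. a * x \<in> I)"

lemma ideal_inD:
  assumes "ideal_in A I"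
  shows "I \<subseteq> A" "0 \<in> I" "x \<in> I \<Longrightarrow> y \<in> I \<Longrightarrow> x + y \<in> I" "a \<in> A \<Longrightarrow> x \<in> I \<Longrightarrow> a * x \<in> I"
    "\<exists>x\<in>I. x \<noteq> 0"
  using assms by (auto simp: ideal_in_def)

definition int_ring :: "complex set \<Rightarrow> complex set" where
  "int_ring K = {z \<in> K. algebraic_int z}"

lemma ring_ring_of_integers:
  assumes A: "subring_set (int_ring K)"
  shows "ring (ring_of_integers K)"
proof (rule ringI)
  let ?R = "ring_of_integers K"
  note D = subring_setD[OF A, unfolded int_ring_def]
  have neg: "\<exists>y\<in>carrier ?R. y \<oplus>\<^bsub>?R\<^esub> x = \<zero>\<^bsub>?R\<^esub>" if "x \<in> carrier ?R" for x
    using that D(6)[of x] by (intro bexI[of _ "- x"]) (auto simp: ring_of_integers_def)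
  show "abelian_group ?R"
    by (rule abelian_groupI) (use D neg in \<open>auto simp: ring_of_integers_def\<close>)
  show "monoid ?R"
    by (rule monoidI) (use D in \<open>auto simp: ring_of_integers_def\<close>)
qed (auto simp: ring_of_integers_def algebra_simps)

lemma nonzero_ideals_ring_of_integers:
  assumes A: "subring_set (int_ring K)"
  shows "nonzero_ideals (ring_of_integers K) = {I. ideal_in (int_ring K) I}"
proof (intro equalityI subsetI CollectI)
  let ?R = "ring_of_integers K"
  interpret R: ring ?R by (rule ring_ring_of_integers[OF A])
  fix I assume "I \<in> nonzero_ideals ?R"
  then have I: "ideal I ?R" "I \<noteq> {0}" by (auto simp: nonzero_ideals_def ring_of_integers_def)
  interpret I: ideal I ?R by (rule I(1))
  show "ideal_in (int_ring K) I"
    using I.a_subset I.zero_closed I.a_closed I.I_l_closed I(2)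
    by (auto simp: ideal_in_def int_ring_def ring_of_integers_def)
next
  let ?R = "ring_of_integers K"
  interpret R: ring ?R by (rule ring_ring_of_integers[OF A])
  note D = subring_setD[OF A, unfolded int_ring_def]
  fix I assume "I \<in> {I. ideal_in (int_ring K) I}"
  then have I: "ideal_in (int_ring K) I" by simp
  have "ideal I ?R"
  proof (rule idealI)
    show "ring ?R" by (rule R.ring_axioms)
    show "subgroup I (add_monoid ?R)"
    proof (rule R.add.subgroupI)
      fix a assume a: "a \<in> I"
      have "a \<in> carrier ?R" "- a \<in> carrier ?R"
        using a ideal_inD(1)[OF I] D(6) by (auto simp: ring_of_integers_def int_ring_def)
      then have "\<ominus>\<^bsub>?R\<^esub> a = - a"
        by (intro R.minus_equality) (auto simp: ring_of_integers_def)
      moreover have "- a \<in> I"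
        using ideal_inD(4)[OF I _ a, of "-1"] D(1) D(6)[of 1] by (auto simp: int_ring_def)
      ultimately show "\<ominus>\<^bsub>?R\<^esub> a \<in> I" by simp
    qed (use I in \<open>auto simp: ideal_in_def int_ring_def ring_of_integers_def\<close>)
    fix a x assume "a \<in> I" "x \<in> carrier ?R"
    then have "x * a \<in> I"
      using ideal_inD(4)[OF I] by (simp add: ring_of_integers_def int_ring_def)
    then show "x \<otimes>\<^bsub>?R\<^esub> a \<in> I" "a \<otimes>\<^bsub>?R\<^esub> x \<in> I"
      by (simp_all add: ring_of_integers_def mult.commute)
  qed
  then show "I \<in> nonzero_ideals ?R"
    using I by (simp add: nonzero_ideals_def ideal_in_def ring_of_integers_def)
qed

definition ideal_rel :: "complex set \<Rightarrow> (complex set \<times> complex set) set" where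
  "ideal_rel A = {(I, J). ideal_in A I \<and> ideal_in A J \<and>
     (\<exists>a\<in>A - {0}. \<exists>b\<in>A - {0}. (*) a ` I = (*) b ` J)}"

lemma ideal_relI:
  assumes "ideal_in A I" "ideal_in A J" "a \<in> A" "a \<noteq> 0" "b \<in> A" "b \<noteq> 0" "(*) a ` I = (*) b ` J"
  shows "(I, J) \<in> ideal_rel A"
  using assms unfolding ideal_rel_def by blast

lemma ideal_relE:
  assumes "(I, J) \<in> ideal_rel A"
  obtains a b where "ideal_in A I" "ideal_in A J" "a \<in> A" "a \<noteq> 0" "b \<in> A" "b \<noteq> 0" "(*) a ` I = (*) b ` J"
  using assms unfolding ideal_rel_def by blast

lemma ideal_class_rel_ring_of_integers:
  assumes A: "subring_set (int_ring K)"
  shows "ideal_class_rel (ring_of_integers K) = ideal_rel (int_ring K)"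
  unfolding ideal_class_rel_def nonzero_ideals_ring_of_integers[OF A] ideal_rel_def
  by (auto simp: ring_of_integers_def int_ring_def)

lemma equiv_ideal_rel:
  assumes A: "subring_set A"
  shows "equiv {I. ideal_in A I} (ideal_rel A)"
proof (rule equivI)
  show "refl_on {I. ideal_in A I} (ideal_rel A)"
    using subring_setD(1)[OF A] by (auto simp: refl_on_def intro: ideal_relI[of A _ _ 1 1])
  show "ideal_rel A \<subseteq> {I. ideal_in A I} \<times> {I. ideal_in A I}" by (auto simp: ideal_rel_def)
  show "sym (ideal_rel A)"
  proof (rule symI)
    fix I J assume "(I, J) \<in> ideal_rel A"
    then obtain a b where "ideal_in A I" "ideal_in A J" "a \<in> A" "a \<noteq> 0" "b \<in> A" "b \<noteq> 0" "(*) a ` I = (*) b ` J"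
      by (rule ideal_relE)
    then show "(J, I) \<in> ideal_rel A" by (intro ideal_relI[of A J I b a]) simp_all
  qed
  show "trans (ideal_rel A)"
  proof (rule transI)
    fix I J L assume "(I, J) \<in> ideal_rel A" "(J, L) \<in> ideal_rel A"
    then obtain a b c d where abcd: "a \<in> A" "a \<noteq> 0" "b \<in> A" "b \<noteq> 0" "c \<in> A" "c \<noteq> 0" "d \<in> A" "d \<noteq> 0"
      and eq: "(*) a ` I = (*) b ` J" "(*) c ` J = (*) d ` L" and I: "ideal_in A I" "ideal_in A L"
      by (metis ideal_relE)
    have assoc: "(*) (x * y) ` S = (*) x ` ((*) y ` S)" for x y :: complex and S
      by (simp add: image_image mult.assoc)
    have "(*) (c * a) ` I = (*) (c * b) ` J" by (simp only: assoc eq)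
    also have "\<dots> = (*) (b * d) ` L" by (simp only: mult.commute[of c b] assoc eq)
    finally show "(I, L) \<in> ideal_rel A"
      using abcd I subring_setD(5)[OF A] by (intro ideal_relI[of A I L "c * a" "b * d"]) auto
  qed
qed

lemma class_number_eq:
  assumes "subring_set (int_ring K)"
  shows "class_number K = card ({I. ideal_in (int_ring K) I} // ideal_rel (int_ring K))"
  unfolding class_number_def nonzero_ideals_ring_of_integers[OF assms]
    ideal_class_rel_ring_of_integers[OF assms] ..

lemma int_subgroup_eq_multiples:
  fixes S :: "int set"
  assumes add: "\<And>x y. x \<in> S \<Longrightarrow> y \<in> S \<Longrightarrow> x + y \<in> S" and mult: "\<And>a x. x \<in> S \<Longrightarrow> a * x \<in> S"
    and ne: "\<exists>x\<in>S. x \<noteq> 0"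
  shows "\<exists>n>0. S = {x. int n dvd x}"
proof -
  obtain x where x: "x \<in> S" "x \<noteq> 0" using ne by blast
  have "\<exists>k::nat. k > 0 \<and> int k \<in> S"
    using x mult[OF x(1), of "- 1"] by (intro exI[of _ "nat \<bar>x\<bar>"]) (auto simp: abs_if)
  define n where "n = (LEAST k::nat. k > 0 \<and> int k \<in> S)"
  have n: "n > 0" "int n \<in> S"
    using LeastI_ex[OF \<open>\<exists>k. _\<close>] by (auto simp: n_def)
  have least: "n \<le> k" if "k > 0" "int k \<in> S" for k
    unfolding n_def using that by (intro Least_le) auto
  have "S = {x. int n dvd x}"
  proof (intro equalityI subsetI CollectI)
    fix y assume y: "y \<in> S"
    have "y mod int n = y + (- (y div int n)) * int n" by (simp add: minus_div_mult_eq_mod[symmetric])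
    then have "y mod int n \<in> S" using add[OF y mult[OF n(2)]] by metis
    moreover have "y mod int n \<ge> 0" "y mod int n < int n" using n by auto
    ultimately have "y mod int n = 0"
      using least[of "nat (y mod int n)"] by (cases "y mod int n = 0") auto
    then show "int n dvd y" by (simp add: dvd_eq_mod_eq_0)
  next
    fix y assume "y \<in> {x. int n dvd x}"
    then obtain k where "y = int n * k" by (auto elim: dvdE)
    then show "y \<in> S" using mult[OF n(2), of k] by (simp add: mult.commute)
  qed
  with n show ?thesis by blast
qed

text \<open>This evaluates the denominator of the relative class number. Every ideal is k Z, and l
  (k Z) = k (l Z) puts any two into one class.\<close>

lemma class_number_eq_1_if_Ints:
  assumes K: "int_ring K = \<int>"
  shows "class_number K = 1"
proof -
  have Z: "subring_set \<int>" by (auto simp: subring_set_def)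
  have gen: "\<exists>n>0. I = (*) (of_nat n) ` \<int>" if I: "ideal_in \<int> I" for I
  proof -
    define S where "S = {k::int. of_int k \<in> I}"
    have "\<exists>n>0. S = {x. int n dvd x}"
    proof (rule int_subgroup_eq_multiples)
      show "x + y \<in> S" if "x \<in> S" "y \<in> S" for x y
        using that ideal_inD(3)[OF I] by (simp add: S_def)
      show "a * x \<in> S" if "x \<in> S" for a x
        using that ideal_inD(4)[OF I, of "of_int a"] by (simp add: S_def)
      show "\<exists>x\<in>S. x \<noteq> 0"
        using ideal_inD(1,5)[OF I] by (force simp: S_def elim!: Ints_cases)
    qed
    then obtain n where n: "n > 0" "S = {x. int n dvd x}" by blast
    have "I = of_int ` S" using ideal_inD(1)[OF I] by (auto simp: S_def elim!: Ints_cases)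
    also have "\<dots> = (*) (of_nat n) ` \<int>"
      unfolding n(2) by (auto elim!: dvdE Ints_cases simp: image_iff) (metis dvd_triv_left of_int_mult of_int_of_nat_eq)
    finally show ?thesis using n by blast
  qed
  have "(I, J) \<in> ideal_rel \<int>" if IJ: "ideal_in \<int> I" "ideal_in \<int> J" for I J
  proof -
    obtain k l where kl: "k > 0" "I = (*) (of_nat k) ` \<int>" "l > 0" "J = (*) (of_nat l) ` \<int>"
      using gen[OF IJ(1)] gen[OF IJ(2)] by blast
    have "(*) (of_nat l) ` I = (*) (of_nat k) ` J"
      unfolding kl image_image by (simp add: mult.left_commute)
    then show ?thesis
      using IJ kl(1,3) by (intro ideal_relI[of \<int> I J "of_nat l" "of_nat k"]) auto
  qed
  then have rel: "ideal_rel \<int> = {I. ideal_in \<int> I} \<times> {I. ideal_in \<int> I}"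
    by (auto simp: ideal_rel_def)
  have "(1::complex) \<in> \<int>" by simp
  then have "\<int> \<noteq> {0::complex}" by (metis singletonD one_neq_zero)
  then have "ideal_in \<int> \<int>" by (simp add: ideal_in_def)
  then have "{I. ideal_in \<int> I} // ideal_rel \<int> = {{I. ideal_in \<int> I}}"
    unfolding rel quotient_def by auto
  then show ?thesis using class_number_eq[of K] Z by (simp add: K)
qed

text \<open>Boundedness of the denominators of all powers replaces the closure of the algebraic
  integers under addition.\<close>

lemma rat_powers_bounded_denominator_imp_int:
  fixes r :: real
  assumes r: "r \<in> \<rat>" and D: "D > (0::nat)" and pow: "\<And>k. of_nat D * r ^ k \<in> \<int>"
  shows "r \<in> \<int>"
proof -
  obtain a b :: int where ab: "b > 0" "coprime a b" "r = of_int a / of_int b"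
    using r by (metis Rats_cases' )
  have dvd: "b ^ k dvd int D" for k
  proof -
    obtain z where "of_nat D * r ^ k = of_int z" using pow Ints_cases by blast
    then have "real_of_int (int D * a ^ k) = of_int (z * b ^ k)"
      using ab by (simp add: field_simps)
    then have "int D * a ^ k = z * b ^ k" by (simp only: of_int_eq_iff)
    then have "b ^ k dvd int D * a ^ k" by simp
    moreover have "coprime (b ^ k) (a ^ k)" using ab(2) by (simp add: coprime_commute)
    ultimately show ?thesis by (simp add: coprime_dvd_mult_left_iff)
  qed
  have "b = 1"
  proof (rule ccontr)
    assume "b \<noteq> 1"
    then have "b \<ge> 2" using ab by simp
    \<comment> \<open>All powers of b divide D; already the D-th one is too large when b >=
      2.\<close>
    have "int D < 2 ^ D" using of_nat_less_two_power[of D, where 'a = int] by simp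
    also have "\<dots> \<le> b ^ D" using \<open>b \<ge> 2\<close> by (intro power_mono) auto
    also have "\<dots> \<le> int D" using dvd[of D] D by (intro zdvd_imp_le) auto
    finally show False by simp
  qed
  then show ?thesis using ab by simp
qed

lemma algebraic_int_quadratic:
  fixes z :: complex
  assumes "z\<^sup>2 - of_int t * z + of_int n = 0"
  shows "algebraic_int z"
proof (rule algebraic_int.intros)
  show "lead_coeff [:of_int n, - of_int t, 1::complex:] = 1" by simp
  show "poly [:of_int n, - of_int t, 1:] z = 0"
    using assms by (simp add: power2_eq_square algebra_simps)
  show "\<forall>i. poly.coeff [:of_int n, - of_int t, 1::complex:] i \<in> \<int>"
    by (auto simp: coeff_pCons split: nat.split)
qed

section \<open>The maximal order of the field\<close>

context prime_3_mod_4
begin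

definition omega :: complex where "omega = Complex (1/2) (sqrt (real p) / 2)"

definition OK :: "complex set" where "OK = {of_int u + of_int v * omega | u v. True}"

abbreviation "KK \<equiv> quadratic_field (- int p)"

lemma Re_omega [simp]: "Re omega = 1 / 2" and Im_omega [simp]: "Im omega = sqrt (real p) / 2"
  by (simp_all add: omega_def)

lemma sqrt_p_pos [simp]: "sqrt (real p) > 0" using p_gt_3 by simp

lemma real_p_eq: "real p = 4 * real m - 1"
  using arg_cong[OF p_m, of real] by simp

lemma omega_sq: "omega * omega = omega - of_nat m"
  by (rule complex_eqI) (use m_ge_2 in \<open>auto simp: real_p_eq abs_if field_simps\<close>)

lemma cnj_omega: "cnj omega = 1 - omega"
  by (rule complex_eqI) simp_all

lemma OK_mult: "(of_int u + of_int v * omega) * (of_int x + of_int y * omega) =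
    of_int (u * x - int m * v * y) + of_int (u * y + v * x + v * y) * omega"
proof -
  have "(of_int u + of_int v * omega) * (of_int x + of_int y * omega) =
    of_int u * of_int x + (of_int u * of_int y + of_int v * of_int x) * omega + of_int v * of_int y * (omega * omega)"
    by (simp add: algebra_simps)
  then show ?thesis unfolding omega_sq by (simp add: algebra_simps)
qed

lemma OKI: "of_int u + of_int v * omega \<in> OK" by (auto simp: OK_def)

lemma OK_of_int [simp]: "of_int u \<in> OK" using OKI[of u 0] by simp

lemma OK_of_nat [simp]: "of_nat u \<in> OK" using OK_of_int[of "int u"] by simp

lemma OK_omega [simp]: "omega \<in> OK" using OKI[of 0 1] by simp

lemma subring_OK: "subring_set OK"
  unfolding subring_set_def
proof (intro conjI ballI)
  show "1 \<in> OK" using OK_of_int[of 1] by simp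
  fix x y assume "x \<in> OK" "y \<in> OK"
  then obtain a b c d where x: "x = of_int a + of_int b * omega" and y: "y = of_int c + of_int d * omega"
    by (auto simp: OK_def)
  have "x - y = of_int (a - c) + of_int (b - d) * omega" by (simp add: x y algebra_simps)
  then show "x - y \<in> OK" using OKI by metis
  show "x * y \<in> OK" unfolding x y OK_mult by (rule OKI)
qed

lemmas OK_closed = subring_setD[OF subring_OK]

lemma OK_cnj: "x \<in> OK \<Longrightarrow> cnj x \<in> OK"
proof -
  assume "x \<in> OK"
  then obtain a b where x: "x = of_int a + of_int b * omega" by (auto simp: OK_def)
  have "cnj x = of_int (a + b) + of_int (- b) * omega" by (simp add: x cnj_omega algebra_simps)
  then show ?thesis using OKI by metis
qed

lemma csqrt_neg_p: "csqrt (of_int (- int p)) = \<i> * of_real (sqrt (real p))"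
  by (subst csqrt_of_real_nonpos) auto

lemma KK_iff: "z \<in> KK \<longleftrightarrow> Re z \<in> \<rat> \<and> Im z / sqrt (real p) \<in> \<rat>"
proof
  assume "z \<in> KK"
  then obtain x y where z: "z = x + y * csqrt (of_int (- int p))" "x \<in> \<rat>" "y \<in> \<rat>"
    by (auto simp: quadratic_field_def)
  obtain a b where ab: "x = of_rat a" "y = of_rat b" using z Rats_cases by metis
  have r: "complex_of_real (of_rat q) = of_rat q" for q
    by (cases q) (simp add: of_rat_rat)
  have "x = of_real (of_rat a)" "y = of_real (of_rat b)" by (simp_all add: ab r)
  then show "Re z \<in> \<rat> \<and> Im z / sqrt (real p) \<in> \<rat>"
    unfolding z csqrt_neg_p using p_gt_3 by simp
next
  assume "Re z \<in> \<rat> \<and> Im z / sqrt (real p) \<in> \<rat>"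
  then obtain a b where ab: "Re z = of_rat a" "Im z / sqrt (real p) = of_rat b" using Rats_cases by metis
  have r: "complex_of_real (of_rat q) = of_rat q" for q
    by (cases q) (simp add: of_rat_rat)
  have "Im z = of_rat b * sqrt (real p)" using ab(2) p_gt_3 by (simp add: field_simps)
  then have "z = of_rat a + of_rat b * csqrt (of_int (- int p))"
    unfolding csqrt_neg_p r[symmetric] using ab(1) by (intro complex_eqI) auto
  then show "z \<in> KK"
    unfolding quadratic_field_def using Rats_of_rat[of a] Rats_of_rat[of b] by blast
qed

text \<open>The order Z[sqrt (-p)], contained in \<open>OK\<close>. It records bounded denominators:
  it is closed under products, and its elements have integral norm.\<close>

definition sqrt_lattice :: "complex set" where "sqrt_lattice = {of_int u + of_int v * (\<i> * of_real (sqrt (real p))) | u v. True}"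

lemma sqrt_lattice_closed:
  shows "1 \<in> sqrt_lattice" "0 \<in> sqrt_lattice" "x \<in> sqrt_lattice \<Longrightarrow> y \<in> sqrt_lattice \<Longrightarrow> x + y \<in> sqrt_lattice" "x \<in> sqrt_lattice \<Longrightarrow> y \<in> sqrt_lattice \<Longrightarrow> x * y \<in> sqrt_lattice"
    "of_int k \<in> sqrt_lattice"
proof -
  have I: "of_int u + of_int v * (\<i> * of_real (sqrt (real p))) \<in> sqrt_lattice" for u v by (auto simp: sqrt_lattice_def)
  show "of_int k \<in> sqrt_lattice" for k using I[of k 0] by simp
  from this[of 0] this[of 1] show "0 \<in> sqrt_lattice" "1 \<in> sqrt_lattice" by simp_all
  assume "x \<in> sqrt_lattice" "y \<in> sqrt_lattice"
  then obtain a b c d where x: "x = of_int a + of_int b * (\<i> * of_real (sqrt (real p)))"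
    and y: "y = of_int c + of_int d * (\<i> * of_real (sqrt (real p)))" by (auto simp: sqrt_lattice_def)
  have "x + y = of_int (a + c) + of_int (b + d) * (\<i> * of_real (sqrt (real p)))"
    by (simp add: x y algebra_simps)
  then show "x + y \<in> sqrt_lattice" using I by metis
  have "x * y = of_int (a * c - int p * b * d) + of_int (a * d + b * c) * (\<i> * of_real (sqrt (real p)))"
    by (rule complex_eqI) (simp_all add: x y algebra_simps)
  then show "x * y \<in> sqrt_lattice" using I by metis
qed

lemma sqrt_lattice_norm: "x \<in> sqrt_lattice \<Longrightarrow> (cmod x)\<^sup>2 \<in> \<int>"
  by (auto simp: sqrt_lattice_def cmod_power2 power_mult_distrib)

text \<open>A monic equation of degree n reduces every power of z to 1, z, ..., z^(n - 1) with
  integral coefficients, so the n-th power of a denominator of z is a denominator of all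
  powers.\<close>

lemma powers_in_sqrt_lattice:
  assumes z: "z \<in> KK" "algebraic_int z"
  shows "\<exists>D>0. \<forall>k. of_nat D * z ^ k \<in> sqrt_lattice"
proof -
  obtain P where P: "lead_coeff P = 1" "\<And>i. poly.coeff P i \<in> \<int>" "poly P z = 0"
    using z(2) by (auto elim: algebraic_int.cases)
  define n where "n = Polynomial.degree P"
  have zn: "z ^ n = (\<Sum>i<n. - poly.coeff P i * z ^ i)"
  proof -
    have "0 = (\<Sum>i\<le>n. poly.coeff P i * z ^ i)" using P(3) by (simp add: poly_altdef n_def)
    also have "{..n} = insert n {..<n}" by auto
    finally show ?thesis using P(1) by (simp add: sum_negf n_def eq_neg_iff_add_eq_0)
  qed
  obtain a b where ab: "a > 0" "b > 0" "of_nat a * Re z \<in> \<int>" "of_nat b * (Im z / sqrt (real p)) \<in> \<int>"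
  proof -
    have "\<exists>a::nat. a > 0 \<and> of_nat a * r \<in> \<int>" if "r \<in> \<rat>" for r :: real
    proof -
      obtain x y :: int where "y > 0" "r = of_int x / of_int y" using \<open>r \<in> \<rat>\<close> by (metis Rats_cases')
      then show ?thesis by (intro exI[of _ "nat y"]) auto
    qed
    from this[of "Re z"] this[of "Im z / sqrt (real p)"] show ?thesis
      using z(1) that unfolding KK_iff by metis
  qed
  define D0 where "D0 = a * b"
  have D0: "D0 > 0" using ab by (simp add: D0_def)
  have "of_nat D0 * z \<in> sqrt_lattice"
  proof -
    obtain u v where u: "of_nat a * Re z = of_int u" and v: "of_nat b * (Im z / sqrt (real p)) = of_int v"
      using ab Ints_cases by metis
    have "of_nat b * Im z = of_int v * sqrt (real p)" using v p_gt_3 by (simp add: field_simps)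
    then have "of_nat D0 * z = of_int (int b * u) + of_int (int a * v) * (\<i> * of_real (sqrt (real p)))"
      using u by (intro complex_eqI) (simp_all add: D0_def mult.assoc mult.left_commute[of _ "real b"])
    then show ?thesis unfolding sqrt_lattice_def by blast
  qed
  then have "(of_nat D0 * z) ^ k \<in> sqrt_lattice" for k
    by (induction k) (simp_all add: sqrt_lattice_closed)
  then have pw: "of_nat D0 ^ k * z ^ k \<in> sqrt_lattice" for k by (simp add: power_mult_distrib)
  have nat: "of_nat k \<in> sqrt_lattice" for k using sqrt_lattice_closed(5)[of "int k"] by simp
  have "of_nat (D0 ^ n) * z ^ k \<in> sqrt_lattice" for k
  proof (induction k rule: less_induct)
    case (less k)
    show ?case
    proof (cases "k < n")
      case True
      then have "of_nat (D0 ^ n) * z ^ k = of_nat (D0 ^ (n - k)) * (of_nat D0 ^ k * z ^ k)"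
        by (simp add: mult.assoc[symmetric] power_add[symmetric])
      then show ?thesis using sqrt_lattice_closed(4)[OF nat pw] by metis
    next
      case False
      have "of_nat (D0 ^ n) * z ^ k = of_nat (D0 ^ n) * (z ^ n * z ^ (k - n))"
        using False by (simp add: power_add[symmetric])
      also have "\<dots> = (\<Sum>i<n. - poly.coeff P i * (of_nat (D0 ^ n) * z ^ (k - n + i)))"
        unfolding zn by (simp add: sum_distrib_left sum_distrib_right power_add mult_ac)
      also have "\<dots> \<in> sqrt_lattice"
      proof -
        have "(\<Sum>i\<in>A. - poly.coeff P i * (of_nat (D0 ^ n) * z ^ (k - n + i))) \<in> sqrt_lattice"
          if "finite A" "A \<subseteq> {..<n}" for A
          using that
        proof (induction A)
          case (insert i A)
          obtain c where "poly.coeff P i = of_int c" using P(2) Ints_cases by blast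
          then have c: "- poly.coeff P i \<in> sqrt_lattice" using sqrt_lattice_closed(5)[of "- c"] by simp
          have "of_nat (D0 ^ n) * z ^ (k - n + i) \<in> sqrt_lattice"
            using insert.prems False by (intro less.IH) auto
          then have "- poly.coeff P i * (of_nat (D0 ^ n) * z ^ (k - n + i)) \<in> sqrt_lattice"
            by (rule sqrt_lattice_closed(4)[OF c])
          then show ?case
            unfolding sum.insert[OF insert.hyps] using insert by (intro sqrt_lattice_closed(3)) auto
        qed (simp add: sqrt_lattice_closed)
        then show ?thesis by simp
      qed
      finally show ?thesis .
    qed
  qed
  then show ?thesis using D0 by (intro exI[of _ "D0 ^ n"]) auto
qed

text \<open>D^2 |z|^(2 k) is the norm of D z^k, an integer. Thus all powers of the rational number
  |z|^2 share the denominator D^2, which makes it an integer.\<close>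

lemma norm_int_if_powers:
  assumes z: "z \<in> KK" and D: "D > 0" "\<And>k. of_nat D * z ^ k \<in> sqrt_lattice"
  shows "(cmod z)\<^sup>2 \<in> \<int>"
proof (rule rat_powers_bounded_denominator_imp_int)
  have "(cmod z)\<^sup>2 = Re z * Re z + of_nat p * (Im z / sqrt (real p)) * (Im z / sqrt (real p))"
    unfolding cmod_power2 using p_gt_3 by (simp add: power2_eq_square)
  then show "(cmod z)\<^sup>2 \<in> \<rat>"
    using z unfolding KK_iff by (simp only:) (intro Rats_add Rats_mult, auto)
  show "D\<^sup>2 > 0" using D by simp
  show "of_nat (D\<^sup>2) * ((cmod z)\<^sup>2) ^ k \<in> \<int>" for k
    using sqrt_lattice_norm[OF D(2)[of k]] by (simp add: norm_mult norm_power power_mult_distrib power_mult[symmetric] mult.commute)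
qed

lemma rat_mult_p_sq_int:
  fixes r :: real
  assumes "r \<in> \<rat>" "real p * r\<^sup>2 \<in> \<int>"
  shows "r \<in> \<int>"
proof -
  obtain a b :: int where ab: "b > 0" "coprime a b" "r = of_int a / of_int b"
    using assms by (metis Rats_cases')
  obtain z where "real p * r\<^sup>2 = of_int z" using assms Ints_cases by blast
  then have "real_of_int (int p * a\<^sup>2) = of_int (z * b\<^sup>2)" using ab by (simp add: field_simps)
  then have "int p * a\<^sup>2 = z * b\<^sup>2" by (simp only: of_int_eq_iff)
  then have "b\<^sup>2 dvd int p * a\<^sup>2" by simp
  moreover have "coprime (b\<^sup>2) (a\<^sup>2)" using ab(2) by (simp add: coprime_commute)
  ultimately have "b\<^sup>2 dvd int p" by (simp add: coprime_dvd_mult_left_iff)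
  have "b dvd b\<^sup>2" by (simp add: power2_eq_square)
  then have "b dvd int p" using \<open>b\<^sup>2 dvd int p\<close> dvd_trans by blast
  moreover have "prime (int p)" using prime_p by simp
  ultimately have "b = 1 \<or> b = int p" using ab(1) unfolding prime_int_iff by simp
  moreover have "b \<noteq> int p"
  proof
    assume "b = int p"
    then have "(int p)\<^sup>2 \<le> int p" using \<open>b\<^sup>2 dvd int p\<close> p_gt_3 by (intro zdvd_imp_le) auto
    then show False using p_gt_3 by (simp add: power2_eq_square)
  qed
  ultimately show ?thesis using ab by simp
qed

text \<open>The nontrivial inclusion obtains an integral norm from the bounded denominators of the
  powers, and the trace as a difference of two norms. The coordinates then follow from norm and
  trace by a parity argument.\<close>

lemma int_ring_KK: "int_ring KK = OK"
proof (intro equalityI subsetI)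
  fix z assume "z \<in> OK"
  then obtain u v where z: "z = of_int u + of_int v * omega" by (auto simp: OK_def)
  have "z\<^sup>2 - of_int (2 * u + v) * z + of_int (u\<^sup>2 + u * v + int m * v\<^sup>2) = of_int (v\<^sup>2) * (omega * omega - omega + of_nat m)"
    by (simp add: z power2_eq_square algebra_simps)
  also have "\<dots> = 0" unfolding omega_sq by simp
  finally have "algebraic_int z" by (rule algebraic_int_quadratic)
  moreover have "z \<in> KK" unfolding KK_iff z using p_gt_3 by simp
  ultimately show "z \<in> int_ring KK" by (simp add: int_ring_def)
next
  fix z assume "z \<in> int_ring KK"
  then have z: "z \<in> KK" "algebraic_int z" by (auto simp: int_ring_def)
  obtain D where D: "D > 0" "\<And>k. of_nat D * z ^ k \<in> sqrt_lattice" using powers_in_sqrt_lattice[OF z] by blast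
  have N: "(cmod z)\<^sup>2 \<in> \<int>" by (rule norm_int_if_powers[OF z(1) D])
  \<comment> \<open>N(z + 1) - N(z) - 1 is the trace 2 Re z. By the binomial theorem the powers of z
    + 1 have the same denominator D as those of z.\<close>
  have z1: "z + 1 \<in> KK" using z(1) unfolding KK_iff by auto
  have "of_nat D * (z + 1) ^ k \<in> sqrt_lattice" for k
  proof -
    have "of_nat D * (z + 1) ^ k = (\<Sum>j\<le>k. of_nat (k choose j) * (of_nat D * z ^ j))"
      unfolding binomial_ring by (simp add: sum_distrib_left mult_ac)
    moreover have "(\<Sum>j\<in>A. of_nat (k choose j) * (of_nat D * z ^ j)) \<in> sqrt_lattice" if "finite A" for A
      using that
    proof (induction A)
      case (insert j A)
      have "of_nat (k choose j) \<in> sqrt_lattice" using sqrt_lattice_closed(5)[of "int (k choose j)"] by simp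
      then show ?case using insert D(2) by (simp add: sqrt_lattice_closed)
    qed (simp add: sqrt_lattice_closed)
    ultimately show ?thesis by simp
  qed
  then have N1: "(cmod (z + 1))\<^sup>2 \<in> \<int>" by (rule norm_int_if_powers[OF z1 D(1)])
  have "2 * Re z = (cmod (z + 1))\<^sup>2 - (cmod z)\<^sup>2 - 1"
    unfolding cmod_power2 by (simp add: power2_eq_square algebra_simps)
  then have "2 * Re z \<in> \<int>" using N N1 by simp
  then obtain t where t: "2 * Re z = of_int t" using Ints_cases by blast
  define r where "r = 2 * (Im z / sqrt (real p))"
  obtain n where n: "(cmod z)\<^sup>2 = of_int n" using N Ints_cases by blast
  have pr: "real p * r\<^sup>2 = of_int (4 * n - t\<^sup>2)"
  proof -
    have "real p * r\<^sup>2 = 4 * (Im z)\<^sup>2"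
      using p_gt_3 by (simp add: r_def power_mult_distrib power_divide)
    moreover have "(real_of_int t)\<^sup>2 = 4 * (Re z)\<^sup>2"
      unfolding t[symmetric] by (simp add: power_mult_distrib)
    moreover have "real_of_int n = (Re z)\<^sup>2 + (Im z)\<^sup>2" using n by (simp add: cmod_power2)
    ultimately show ?thesis by simp
  qed
  have "r \<in> \<int>"
  proof (rule rat_mult_p_sq_int)
    show "r \<in> \<rat>" unfolding r_def using z(1) KK_iff by (intro Rats_mult) auto
    show "real p * r\<^sup>2 \<in> \<int>" unfolding pr by (rule Ints_of_int)
  qed
  then obtain v where v: "r = of_int v" using Ints_cases by blast
  have "real_of_int (int p * v\<^sup>2) = of_int (4 * n - t\<^sup>2)" using pr by (simp add: v)
  then have eq: "int p * v\<^sup>2 = 4 * n - t\<^sup>2" by (simp only: of_int_eq_iff)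
  have "odd p" using p_m by presburger
  \<comment> \<open>This parity makes (t - v)/2 integral; it is the first coordinate with respect to
    1, omega.\<close>
  have "even (int p * v\<^sup>2) \<longleftrightarrow> even (t\<^sup>2)" unfolding eq by simp
  then have "even (t - v)" using \<open>odd p\<close> by simp
  then obtain u where u: "t = v + 2 * u" by (metis add.commute diff_eq_eq dvdE)
  have "Im z = of_int v * sqrt (real p) / 2" using v p_gt_3 by (simp add: r_def field_simps)
  then have "z = of_int u + of_int v * omega"
    using t by (intro complex_eqI) (auto simp: u)
  then show "z \<in> OK" by (simp add: OKI)
qed

lemma class_number_KK: "class_number KK = card ({I. ideal_in OK I} // ideal_rel OK)"
  using class_number_eq[of KK] subring_OK by (simp add: int_ring_KK)

lemma class_number_KK_real: "class_number (KK \<inter> \<real>) = 1"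
proof (rule class_number_eq_1_if_Ints)
  have "int_ring (KK \<inter> \<real>) = OK \<inter> \<real>" unfolding int_ring_KK[symmetric] by (auto simp: int_ring_def)
  also have "\<dots> = \<int>"
  proof (intro equalityI subsetI)
    fix z assume "z \<in> OK \<inter> \<real>"
    then obtain u v where z: "z = of_int u + of_int v * omega" "Im z = 0"
      by (auto simp: OK_def complex_is_Real_iff)
    then have "v = 0" using p_gt_3 by auto
    then show "z \<in> \<int>" using z by simp
  qed (auto elim!: Ints_cases)
  finally show "int_ring (KK \<inter> \<real>) = \<int>" .
qed

end

section \<open>Ideals of the quadratic field\<close>

text \<open>The covolume of a plane lattice, described without a choice of basis.\<close>

definition has_covolume :: "complex set \<Rightarrow> real \<Rightarrow> bool" where
  "has_covolume L r \<longleftrightarrow> r > 0 \<and> (\<exists>u\<in>L. \<exists>v\<in>L. \<bar>Im (cnj u * v)\<bar> = r) \<and>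
     (\<forall>u\<in>L. \<forall>v\<in>L. Im (cnj u * v) = 0 \<or> r \<le> \<bar>Im (cnj u * v)\<bar>)"

lemma has_covolume_unique:
  assumes "has_covolume L r" "has_covolume L s"
  shows "r = s"
proof -
  have "r \<le> s" if rs: "has_covolume L r" "has_covolume L s" for r s
  proof -
    obtain u v where "u \<in> L" "v \<in> L" "\<bar>Im (cnj u * v)\<bar> = s" "s > 0"
      using rs(2) unfolding has_covolume_def by blast
    moreover have "Im (cnj u * v) = 0 \<or> r \<le> \<bar>Im (cnj u * v)\<bar>"
      using rs(1) \<open>u \<in> L\<close> \<open>v \<in> L\<close> unfolding has_covolume_def by blast
    ultimately show ?thesis by auto
  qed
  then show ?thesis using assms by (meson antisym)
qed

lemma has_covolume_scale:
  assumes "has_covolume L r" "c \<noteq> 0"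
  shows "has_covolume ((*) c ` L) ((cmod c)\<^sup>2 * r)"
proof -
  have eq: "Im (cnj (c * u) * (c * v)) = (cmod c)\<^sup>2 * Im (cnj u * v)" for u v
  proof -
    have "cnj (c * u) * (c * v) = (c * cnj c) * (cnj u * v)" by (simp add: mult_ac)
    also have "c * cnj c = of_real ((cmod c)\<^sup>2)" by (rule complex_norm_square[symmetric])
    finally have "Im (cnj (c * u) * (c * v)) = Im (of_real ((cmod c)\<^sup>2) * (cnj u * v))" by (rule arg_cong)
    then show ?thesis by (simp only: scaleR_conv_of_real[symmetric] scaleR_complex.simps)
  qed
  have c: "(cmod c)\<^sup>2 > 0" using assms(2) by simp
  obtain u v where uv: "u \<in> L" "v \<in> L" "\<bar>Im (cnj u * v)\<bar> = r"
    using assms(1) unfolding has_covolume_def by blast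
  have "\<exists>x\<in>(*) c ` L. \<exists>y\<in>(*) c ` L. \<bar>Im (cnj x * y)\<bar> = (cmod c)\<^sup>2 * r"
    using uv eq[of u v] by (intro bexI[of _ "c * u"] bexI[of _ "c * v"]) (auto simp: abs_mult)
  moreover have "Im (cnj x * y) = 0 \<or> (cmod c)\<^sup>2 * r \<le> \<bar>Im (cnj x * y)\<bar>"
    if xy: "x \<in> (*) c ` L" "y \<in> (*) c ` L" for x y
  proof -
    obtain u v where uv: "u \<in> L" "v \<in> L" "x = c * u" "y = c * v" using xy by blast
    have "Im (cnj u * v) = 0 \<or> r \<le> \<bar>Im (cnj u * v)\<bar>"
      using assms(1) uv unfolding has_covolume_def by blast
    then show ?thesis unfolding uv eq abs_mult using c by auto
  qed
  moreover have "(cmod c)\<^sup>2 * r > 0" using c assms(1) by (simp add: has_covolume_def)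
  ultimately show ?thesis unfolding has_covolume_def by blast
qed

text \<open>The multiplier c need not lie in A. Any nonzero x0 in J clears its denominator: x0 (c J)
  = (c x0) J with both x0 and c x0 in A.\<close>

lemma scaled_ideal:
  assumes A: "subring_set A" and J: "ideal_in A J" and c: "c \<noteq> 0" and sub: "\<And>x. x \<in> J \<Longrightarrow> c * x \<in> A"
  shows "ideal_in A ((*) c ` J)" "((*) c ` J, J) \<in> ideal_rel A"
proof -
  obtain x0 where x0: "x0 \<in> J" "x0 \<noteq> 0" using ideal_inD(5)[OF J] by blast
  show I: "ideal_in A ((*) c ` J)"
    unfolding ideal_in_def
  proof (intro conjI ballI)
    show "(*) c ` J \<subseteq> A" using sub by blast
    show "(*) c ` J \<noteq> {0}" using x0 c by (metis imageI mult_eq_0_iff singletonD)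
    show "0 \<in> (*) c ` J" using ideal_inD(2)[OF J] by (force simp: image_iff)
  next
    fix x y assume "x \<in> (*) c ` J" "y \<in> (*) c ` J"
    then obtain u v where "u \<in> J" "v \<in> J" "x = c * u" "y = c * v" by blast
    then have "u + v \<in> J" "x + y = c * (u + v)"
      using ideal_inD(3)[OF J] by (simp_all add: distrib_left)
    then show "x + y \<in> (*) c ` J" by blast
  next
    fix a x assume "a \<in> A" "x \<in> (*) c ` J"
    then obtain u where "u \<in> J" "x = c * u" by blast
    then have "a * u \<in> J" "a * x = c * (a * u)"
      using ideal_inD(4)[OF J \<open>a \<in> A\<close>] by (simp_all add: mult.left_commute)
    then show "a * x \<in> (*) c ` J" by blast
  qed
  show "((*) c ` J, J) \<in> ideal_rel A"
  proof (rule ideal_relI[OF I J])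
    show "x0 \<in> A" using ideal_inD(1)[OF J] x0 by blast
    show "c * x0 \<in> A" using sub x0 by blast
    show "(*) x0 ` (*) c ` J = (*) (c * x0) ` J" by (simp add: image_image mult_ac)
  qed (use x0 c in auto)
qed

section \<open>Normal forms, norms and finiteness of the class group\<close>

context prime_3_mod_4
begin

lemma OK_coords_eq:
  assumes "of_int u + of_int v * omega = of_int u' + of_int v' * omega"
  shows "u = u' \<and> v = v'"
proof -
  have "Im (of_int u + of_int v * omega) = Im (of_int u' + of_int v' * omega)" using assms by simp
  then have v: "v = v'" using p_gt_3 by simp
  with assms show ?thesis by simp
qed

lemma OK_coords_iff:
  "of_int u + of_int v * omega = of_int u' + of_int v' * omega \<longleftrightarrow> u = u' \<and> v = v'"
  using OK_coords_eq by blast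

definition qelt :: "nat \<Rightarrow> nat \<Rightarrow> int \<Rightarrow> int \<Rightarrow> int \<Rightarrow> complex" where
  "qelt c a b x y = of_nat c * (of_nat a * of_int x + (of_int b + omega) * of_int y)"

definition qideal :: "nat \<times> nat \<times> int \<Rightarrow> complex set" where
  "qideal = (\<lambda>(c, a, b). {qelt c a b x y | x y. True})"

text \<open>In the ideal of a triple, c generates the omega-coordinates and c a the rational
  integers; b is taken reduced modulo a to make the triple unique.\<close>

definition triples :: "(nat \<times> nat \<times> int) set" where
  "triples = {(c, a, b). c > 0 \<and> a > 0 \<and> b \<in> quad_roots m a}"

lemma qelt_coords: "qelt c a b x y = of_int (int c * (int a * x + b * y)) + of_int (int c * y) * omega"
  by (simp add: qelt_def algebra_simps)

lemma qelt_in: "qelt c a b x y \<in> qideal (c, a, b)"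
  by (auto simp: qideal_def)

lemma qideal_mem_iff:
  "of_int u + of_int v * omega \<in> qideal (c, a, b) \<longleftrightarrow>
     (\<exists>x y. u = int c * (int a * x + b * y) \<and> v = int c * y)"
  unfolding qideal_def qelt_coords by (simp only: OK_coords_iff prod.case mem_Collect_eq simp_thms)

lemma mem_qideal_iff: "z \<in> qideal (c, a, b) \<longleftrightarrow> (\<exists>x y. z = qelt c a b x y)"
  by (auto simp: qideal_def)

lemma ideal_in_qideal:
  assumes "t \<in> triples"
  shows "ideal_in OK (qideal t)"
proof -
  obtain c a b where t: "t = (c, a, b)" and c: "c > 0" and a: "a > 0" and "b \<in> quad_roots m a"
    using assms by (auto simp: triples_def)
  then obtain k where k: "b\<^sup>2 + b + int m = int a * k" by (auto simp: quad_roots_def)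
  have "of_int (b\<^sup>2 + b + int m) = (of_int (int a * k) :: complex)" unfolding k ..
  then have m: "(of_nat m :: complex) = of_nat a * of_int k - (of_int b)\<^sup>2 - of_int b"
    by (simp add: algebra_simps)
  \<comment> \<open>The matrix of multiplication by omega in the basis c a, c (b + omega). It is
    integral because k = (b^2 + b + m)/a is an integer.\<close>
  have om: "omega * qelt c a b x y = qelt c a b (- b * x - k * y) (int a * x + (b + 1) * y)" for x y
  proof -
    have "omega * qelt c a b x y = of_nat c * (of_nat a * of_int x * omega + of_int b * of_int y * omega + of_int y * (omega * omega))"
      by (simp add: qelt_def algebra_simps)
    then show ?thesis unfolding omega_sq m by (simp add: qelt_def algebra_simps power2_eq_square)
  qed
  have sc: "of_int u * qelt c a b x y = qelt c a b (u * x) (u * y)" for u x y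
    by (simp add: qelt_def algebra_simps)
  have add: "qelt c a b x y + qelt c a b x' y' = qelt c a b (x + x') (y + y')" for x y x' y'
    by (simp add: qelt_def algebra_simps)
  show ?thesis
    unfolding ideal_in_def t
  proof (intro conjI ballI)
    show "qideal (c, a, b) \<subseteq> OK"
    proof
      fix z assume "z \<in> qideal (c, a, b)"
      then obtain x y where "z = qelt c a b x y" by (auto simp: mem_qideal_iff)
      then show "z \<in> OK" unfolding qelt_coords by (simp only: OKI)
    qed
    have "qelt c a b 1 0 \<noteq> 0" using c a by (simp add: qelt_def)
    then show "qideal (c, a, b) \<noteq> {0}" using qelt_in by blast
    show "0 \<in> qideal (c, a, b)" using qelt_in[of c a b 0 0] by (simp add: qelt_def)
    fix x y assume "x \<in> qideal (c, a, b)" "y \<in> qideal (c, a, b)"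
    then show "x + y \<in> qideal (c, a, b)" unfolding mem_qideal_iff using add by metis
  next
    fix z e assume "z \<in> OK" "e \<in> qideal (c, a, b)"
    then obtain u v x y where "z = of_int u + of_int v * omega" "e = qelt c a b x y"
      by (auto simp: OK_def mem_qideal_iff)
    then have "z * e = of_int u * qelt c a b x y + of_int v * (omega * qelt c a b x y)"
      by (simp add: algebra_simps)
    then show "z * e \<in> qideal (c, a, b)" unfolding om sc add mem_qideal_iff by blast
  qed
qed

text \<open>A Hermite normal form: c generates the omega-coordinates \<open>S\<close> and n = c a
  the rational integers \<open>R\<close> of I. Closure under omega shows that c divides n and the
  first coordinate u1 of an element with omega-coordinate c.\<close>

lemma ideal_eq_qideal:
  assumes I: "ideal_in OK I"
  shows "\<exists>t\<in>triples. I = qideal t"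
proof -
  note D = ideal_inD[OF I]
  have neg: "x \<in> I \<Longrightarrow> y \<in> I \<Longrightarrow> x - y \<in> I" for x y
    using D(3)[of x "- y"] D(4)[of "-1" y] OK_of_int[of "-1"] by simp
  define S where "S = {v. \<exists>u. of_int u + of_int v * omega \<in> I}"
  define R where "R = {u. of_int u \<in> I}"
  obtain z u0 v0 where z: "z \<in> I" "z \<noteq> 0" "z = of_int u0 + of_int v0 * omega"
    using D(1,5) by (force simp: OK_def)
  \<comment> \<open>The norm of a nonzero element supplies a nonzero rational integer in I.\<close>
  have "cnj z * z \<in> I" using z D(1) by (intro D(4) OK_cnj) auto
  moreover have nz: "cnj z * z = of_int (u0\<^sup>2 + u0 * v0 + int m * v0\<^sup>2)"
    by (rule complex_eqI) (use m_ge_2 in \<open>simp_all add: z real_p_eq power2_eq_square field_simps\<close>)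
  moreover have "cnj z * z \<noteq> 0" using z(2) by simp
  ultimately have "\<exists>x\<in>R. x \<noteq> 0" unfolding R_def by (metis mem_Collect_eq of_int_0)
  then have "\<exists>n>0. R = {x. int n dvd x}"
  proof (rule int_subgroup_eq_multiples[rotated 2])
    show "x + y \<in> R" if "x \<in> R" "y \<in> R" for x y using that D(3) by (simp add: R_def)
    show "a * x \<in> R" if "x \<in> R" for a x using that D(4)[of "of_int a" "of_int x"] by (simp add: R_def)
  qed
  then obtain n where n: "n > 0" "R = {x. int n dvd x}" by blast
  have RS: "R \<subseteq> S"
  proof
    fix u assume "u \<in> R"
    then have "omega * of_int u \<in> I" using D(4) by (simp add: R_def)
    then show "u \<in> S" unfolding S_def by (auto intro!: exI[of _ 0] simp: mult.commute)
  qed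
  have "\<exists>n>0. S = {x. int n dvd x}"
  proof (rule int_subgroup_eq_multiples)
    fix x y assume "x \<in> S" "y \<in> S"
    then obtain u v where "of_int u + of_int x * omega \<in> I" "of_int v + of_int y * omega \<in> I" by (auto simp: S_def)
    from D(3)[OF this] have "of_int (u + v) + of_int (x + y) * omega \<in> I" by (simp add: algebra_simps)
    then show "x + y \<in> S" unfolding S_def by blast
  next
    fix a x assume "x \<in> S"
    then obtain u where "of_int u + of_int x * omega \<in> I" by (auto simp: S_def)
    from D(4)[OF _ this, of "of_int a"] have "of_int (a * u) + of_int (a * x) * omega \<in> I" by (simp add: algebra_simps)
    then show "a * x \<in> S" unfolding S_def by blast
  qed (use \<open>\<exists>x\<in>R. x \<noteq> 0\<close> RS in blast)
  then obtain c where c: "c > 0" "S = {x. int c dvd x}" by blast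
  have "int n \<in> R" using n by simp
  then have "int c dvd int n" using RS c by blast
  then obtain a where a: "n = c * a" by (auto simp: int_dvd_int_iff elim: dvdE)
  then have a0: "a > 0" using n by simp
  have "int c \<in> S" using c by simp
  then obtain u1 where u1: "of_int u1 + of_int (int c) * omega \<in> I" by (auto simp: S_def)
  have "omega * (of_int u1 + of_int (int c) * omega) = of_int u1 * omega + of_int (int c) * (omega * omega)"
    by (simp add: algebra_simps)
  also have "\<dots> = of_int (- int c * int m) + of_int (u1 + int c) * omega"
    unfolding omega_sq by (simp add: algebra_simps)
  finally have "omega * (of_int u1 + of_int (int c) * omega) = of_int (- int c * int m) + of_int (u1 + int c) * omega" .
  then have "of_int (- int c * int m) + of_int (u1 + int c) * omega \<in> I"
    using D(4)[OF OK_omega u1] by (simp only:)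
  then have "u1 + int c \<in> S" unfolding S_def by blast
  then have "int c dvd u1 + int c" using c by simp
  then have "int c dvd u1" by simp
  then obtain b1 where b1: "u1 = int c * b1" by (elim dvdE)
  define b where "b = b1 mod int a"
  have bI: "of_nat c * (of_int b + omega) \<in> I"
  proof -
    \<comment> \<open>Reducing b1 modulo a changes the basis element by a multiple of n = c a, which
      lies in I.\<close>
    have "int n * (b1 div int a) \<in> R" using n by simp
    then have "of_int (int n * (b1 div int a)) \<in> I" by (simp add: R_def)
    then have "of_int u1 + of_int (int c) * omega - of_int (int n * (b1 div int a)) \<in> I" using neg u1 by blast
    moreover have "of_int b = (of_int (b1 - int a * (b1 div int a)) :: complex)"
      unfolding b_def minus_mult_div_eq_mod ..
    then have ob: "of_int b = (of_int b1 - of_nat a * of_int (b1 div int a) :: complex)" by simp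
    have "of_nat c * (of_int b + omega) = of_int u1 + of_int (int c) * omega - of_int (int n * (b1 div int a))"
      unfolding ob b1 a by (simp add: algebra_simps)
    ultimately show ?thesis by (simp only:)
  qed
  \<comment> \<open>Multiplying c (b + omega) by the conjugate of b + omega gives a rational integer
    of I, namely c times a norm; so n = c a divides it.\<close>
  have "(of_int b + cnj omega) \<in> OK" using OK_closed(4)[OF OK_of_int OK_cnj[OF OK_omega]] .
  from D(4)[OF this bI] have "(of_int b + cnj omega) * (of_nat c * (of_int b + omega)) \<in> I" .
  moreover have "(of_int b + cnj omega) * (of_nat c * (of_int b + omega)) = of_int (int c * (b\<^sup>2 + b + int m))"
    by (rule complex_eqI) (use m_ge_2 in \<open>simp_all add: real_p_eq power2_eq_square field_simps\<close>)
  ultimately have "of_int (int c * (b\<^sup>2 + b + int m)) \<in> I" by (simp only:)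
  then have "int c * (b\<^sup>2 + b + int m) \<in> R" unfolding R_def by blast
  then have "int n dvd int c * (b\<^sup>2 + b + int m)" unfolding n(2) by blast
  then have "int a dvd b\<^sup>2 + b + int m" using c by (simp add: a)
  then have bq: "b \<in> quad_roots m a" using a0 by (simp add: quad_roots_def b_def)
  have nI: "of_nat n \<in> I" using \<open>int n \<in> R\<close> by (simp add: R_def)
  have "I = qideal (c, a, b)"
  proof (intro equalityI subsetI)
    fix w assume w: "w \<in> I"
    then obtain u v where uv: "w = of_int u + of_int v * omega" using D(1) by (auto simp: OK_def)
    then have "v \<in> S" using w unfolding S_def by blast
    then obtain y where y: "v = int c * y" using c by (auto elim: dvdE)
    have "w - of_int y * (of_nat c * (of_int b + omega)) \<in> I"
      using neg[OF w D(4)[OF OK_of_int bI]] .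
    moreover have "w - of_int y * (of_nat c * (of_int b + omega)) = of_int (u - int c * b * y)"
      unfolding uv y by (simp add: algebra_simps)
    ultimately have "of_int (u - int c * b * y) \<in> I" by (simp only:)
    then have "u - int c * b * y \<in> R" unfolding R_def by blast
    then have "int n dvd u - int c * b * y" unfolding n(2) by blast
    then obtain x where "u - int c * b * y = int n * x" by (elim dvdE)
    then have u: "u = int c * (int a * x + b * y)" by (simp add: a algebra_simps)
    have "w = qelt c a b x y" unfolding qelt_coords uv y u ..
    then show "w \<in> qideal (c, a, b)" using qelt_in by simp
  next
    fix w assume "w \<in> qideal (c, a, b)"
    then obtain x y where "w = qelt c a b x y" by (auto simp: mem_qideal_iff)
    then have "w = of_int x * of_nat n + of_int y * (of_nat c * (of_int b + omega))"
      by (simp add: qelt_def a algebra_simps)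
    then show "w \<in> I" using D(3)[OF D(4)[OF OK_of_int nI] D(4)[OF OK_of_int bI]] by simp
  qed
  then show ?thesis using c a0 bq by (intro bexI[of _ "(c, a, b)"]) (auto simp: triples_def)
qed

lemma multiples_eq_imp_eq:
  assumes "{x. int n dvd x} = {x. int k dvd x}"
  shows "n = k"
proof -
  have "int k \<in> {x. int n dvd x}" unfolding assms by simp
  moreover have "int n \<in> {x. int k dvd x}" unfolding assms[symmetric] by simp
  ultimately show ?thesis by (simp add: dvd_antisym)
qed

lemma inj_qideal: "inj_on qideal triples"
proof (rule inj_onI)
  fix t t' assume t: "t \<in> triples" "t' \<in> triples" and eq: "qideal t = qideal t'"
  obtain c a b where 1: "t = (c, a, b)" "c > 0" "a > 0" "b \<in> quad_roots m a" using t(1) by (auto simp: triples_def)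
  obtain c' a' b' where 2: "t' = (c', a', b')" "c' > 0" "a' > 0" "b' \<in> quad_roots m a'" using t(2) by (auto simp: triples_def)
  have S: "{v. \<exists>u. of_int u + of_int v * omega \<in> qideal (c, a, b)} = {x. int c dvd x}" for c a b
    unfolding qideal_mem_iff by (auto elim: dvdE)
  have R: "{u. of_int u + of_int 0 * omega \<in> qideal (c, a, b)} = {x. int (c * a) dvd x}" if "c > 0" for c a b
    unfolding qideal_mem_iff using that by (auto elim!: dvdE simp: mult.assoc)
  have cc: "c = c'"
    using S[of c a b] S[of c' a' b'] eq unfolding 1 2 by (intro multiples_eq_imp_eq) simp
  have "c * a = c' * a'"
    using R[of c a b] R[of c' a' b'] eq 1(2) 2(2) unfolding 1(1) 2(1) by (intro multiples_eq_imp_eq) simp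
  then have aa: "a = a'" using cc 1(2) by simp
  have "of_int (int c * b) + of_int (int c) * omega \<in> qideal (c, a, b)"
    unfolding qideal_mem_iff by (intro exI[of _ 0] exI[of _ 1]) simp
  then have "of_int (int c * b) + of_int (int c) * omega \<in> qideal (c, a, b')" using eq unfolding 1 2 cc aa by simp
  then obtain x y where xy: "int c * b = int c * (int a * x + b' * y)" "int c = int c * y"
    unfolding qideal_mem_iff by blast
  then have "y = 1" using 1 by simp
  then have "b = int a * x + b'" using xy(1) 1(2) by simp
  then have "b mod int a = b' mod int a" by simp
  then have "b = b'" using 1(4) 2(4) by (simp add: aa quad_roots_def)
  then show "t = t'" using 1 2 cc aa by simp
qed

lemma bij_qideal: "bij_betw qideal triples {I. ideal_in OK I}"
  unfolding bij_betw_def using inj_qideal ideal_in_qideal ideal_eq_qideal by blast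

text \<open>Im (cnj u v) is the determinant of the integral coordinates times the value for the
  basis; a nonzero integer has absolute value at least 1.\<close>

lemma has_covolume_qideal:
  assumes "(c, a, b) \<in> triples"
  shows "has_covolume (qideal (c, a, b)) (real c ^ 2 * real a * (sqrt (real p) / 2))"
proof -
  have ca: "c > 0" "a > 0" using assms by (auto simp: triples_def)
  define s where "s = sqrt (real p) / 2"
  have s: "s > 0" unfolding s_def using p_gt_3 by simp
  have im: "Im (cnj (qelt c a b x y) * qelt c a b x' y') = (real c ^ 2 * real a * s) * of_int (x * y' - x' * y)" for x y x' y'
    by (simp add: qelt_def s_def power2_eq_square field_simps)
  show ?thesis
    unfolding has_covolume_def s_def[symmetric]
  proof (intro conjI ballI)
    show pos: "real c ^ 2 * real a * s > 0" using ca s by simp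
    show "\<exists>u\<in>qideal (c, a, b). \<exists>v\<in>qideal (c, a, b). \<bar>Im (cnj u * v)\<bar> = real c ^ 2 * real a * s"
      using im[of 1 0 0 1] pos by (intro bexI[OF _ qelt_in[of c a b 1 0]] bexI[OF _ qelt_in[of c a b 0 1]]) simp
    fix u v assume "u \<in> qideal (c, a, b)" "v \<in> qideal (c, a, b)"
    then obtain x y x' y' where uv: "u = qelt c a b x y" "v = qelt c a b x' y'" by (auto simp: mem_qideal_iff)
    show "Im (cnj u * v) = 0 \<or> real c ^ 2 * real a * s \<le> \<bar>Im (cnj u * v)\<bar>"
    proof (cases "x * y' - x' * y = 0")
      case True
      then show ?thesis unfolding uv im by simp
    next
      case False
      then have "1 \<le> \<bar>x * y' - x' * y\<bar>" by linarith
      then have "1 \<le> \<bar>real_of_int (x * y' - x' * y)\<bar>" by (simp only: of_int_abs[symmetric] of_int_1_le_iff)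
      then have "real c ^ 2 * real a * s * 1 \<le> real c ^ 2 * real a * s * \<bar>real_of_int (x * y' - x' * y)\<bar>"
        using pos by (intro mult_left_mono) auto
      moreover have "\<bar>(real c ^ 2 * real a * s) * real_of_int (x * y' - x' * y)\<bar>
          = real c ^ 2 * real a * s * \<bar>real_of_int (x * y' - x' * y)\<bar>"
        using abs_mult[of "real c ^ 2 * real a * s"] abs_of_pos[OF pos] by metis
      ultimately show ?thesis unfolding uv im by (intro disjI2) linarith
    qed
  qed
qed

text \<open>The maximal order has covolume \<open>sqrt p / 2\<close>, so this is the index of the ideal.\<close>

definition ideal_norm :: "complex set \<Rightarrow> real" where
  "ideal_norm I = (THE r. has_covolume I r) * 2 / sqrt (real p)"

lemma ideal_norm_qideal: "(c, a, b) \<in> triples \<Longrightarrow> ideal_norm (qideal (c, a, b)) = real (c ^ 2 * a)"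
proof -
  assume t: "(c, a, b) \<in> triples"
  have "(THE r. has_covolume (qideal (c, a, b)) r) = real c ^ 2 * real a * (sqrt (real p) / 2)"
    using has_covolume_qideal[OF t] has_covolume_unique by blast
  then show ?thesis using p_gt_3 by (simp add: ideal_norm_def)
qed

lemma ideal_has_covolume:
  assumes "ideal_in OK I"
  shows "\<exists>r. has_covolume I r"
  using ideal_eq_qideal[OF assms] has_covolume_qideal by fastforce

lemma ideal_norm_scale:
  assumes I: "ideal_in OK I" and c: "c \<noteq> 0"
  shows "ideal_norm ((*) c ` I) = (cmod c)\<^sup>2 * ideal_norm I"
proof -
  obtain r where r: "has_covolume I r" using ideal_has_covolume[OF I] by blast
  have "(THE r. has_covolume I r) = r" using r has_covolume_unique by blast
  moreover have "(THE r. has_covolume ((*) c ` I) r) = (cmod c)\<^sup>2 * r"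
    using has_covolume_scale[OF r c] has_covolume_unique by blast
  ultimately show ?thesis by (simp add: ideal_norm_def)
qed

text \<open>This is why \<gamma> is determined by \<gamma> J up to sign. Preserving the covolume
  gives |u| = 1, and preserving the lattice gives an integral trace. So u lies in \<open>OK\<close>,
  and norm 1 reads (2 \<alpha> + \<beta>)^2 + p \<beta>^2 = 4, which forces \<beta> = 0 as p >
  4.\<close>

lemma ideal_stabilizer:
  assumes J: "ideal_in OK J" and u: "(*) u ` J = J"
  shows "u = 1 \<or> u = -1"
proof -
  obtain c a b where t: "(c, a, b) \<in> triples" "J = qideal (c, a, b)" using ideal_eq_qideal[OF J] by auto
  have ca: "c > 0" "a > 0" using t by (auto simp: triples_def)
  have u0: "u \<noteq> 0"
  proof
    assume "u = 0"
    then have "(*) u ` J \<subseteq> {0}" by auto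
    then show False using u ideal_inD(5)[OF J] by auto
  qed
  obtain r where r: "has_covolume J r" using ideal_has_covolume[OF J] by blast
  have "(cmod u)\<^sup>2 * r = r"
    using has_covolume_scale[OF r u0] r u has_covolume_unique by metis
  then have n1: "(cmod u)\<^sup>2 = 1" using r by (simp add: has_covolume_def)
  have mem: "u * x \<in> J" if "x \<in> J" for x using u that by blast
  have cancel: "\<exists>x y. u * (of_nat a * of_int x0 + (of_int b + omega) * of_int y0) = of_nat a * of_int x + (of_int b + omega) * of_int y" for x0 y0
  proof -
    have "u * qelt c a b x0 y0 \<in> J" using mem qelt_in t by blast
    then obtain x y where "u * qelt c a b x0 y0 = qelt c a b x y" unfolding t mem_qideal_iff by blast
    then have "of_nat c * (u * (of_nat a * of_int x0 + (of_int b + omega) * of_int y0))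
        = of_nat c * (of_nat a * of_int x + (of_int b + omega) * of_int y)"
      by (simp add: qelt_def mult.left_commute)
    then show ?thesis using ca(1) by (subst (asm) mult_cancel_left) auto
  qed
  obtain x y where xy: "u * of_nat a = of_nat a * of_int x + (of_int b + omega) * of_int y"
    using cancel[of 1 0] by auto
  obtain z w where zw: "u * (of_int b + omega) = of_nat a * of_int z + (of_int b + omega) * of_int w"
    using cancel[of 0 1] by auto
  define s where "s = sqrt (real p)"
  have s: "s > 0" unfolding s_def using p_gt_3 by simp
  \<comment> \<open>The integers x and w are the diagonal entries of the matrix of u in the basis a,
    b + omega. Comparing real and imaginary parts identifies their sum with the trace 2 Re
    u.\<close>
  have ReI: "Re u * a = a * x + (b + 1 / 2) * y" using arg_cong[OF xy, of Re] by simp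
  have ImI: "Im u * a = s / 2 * y" using arg_cong[OF xy, of Im] by (simp add: s_def)
  have ImII: "Re u * (s / 2) + Im u * (b + 1 / 2) = s / 2 * w"
    using arg_cong[OF zw, of Im] by (simp add: s_def)
  have "s / 2 * (Re u * a + y * (b + 1 / 2)) = a * (Re u * (s / 2)) + (s / 2 * y) * (b + 1 / 2)"
    by (simp add: algebra_simps)
  also have "\<dots> = a * (Re u * (s / 2) + Im u * (b + 1 / 2))"
    unfolding ImI[symmetric] by (simp add: algebra_simps)
  also have "\<dots> = s / 2 * (real a * of_int w)" unfolding ImII by simp
  finally have "s / 2 * (Re u * a + y * (b + 1 / 2)) = s / 2 * (real a * of_int w)" .
  then have "Re u * a + y * (b + 1 / 2) = real a * of_int w" using s by (subst (asm) mult_cancel_left) auto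
  then have "real a * (2 * Re u) = real a * of_int (x + w)" using ReI by (simp add: algebra_simps)
  then have tr: "2 * Re u = of_int (x + w)" using ca by (subst (asm) mult_cancel_left) auto
  have "u + cnj u = of_int (x + w)" unfolding complex_add_cnj tr by simp
  moreover have "u * cnj u = 1" using n1 by (simp add: complex_norm_square[symmetric])
  moreover have "u\<^sup>2 - (u + cnj u) * u + u * cnj u = 0" by (simp add: power2_eq_square algebra_simps)
  ultimately have "u\<^sup>2 - of_int (x + w) * u + of_int 1 = 0" by simp
  then have "algebraic_int u" by (rule algebraic_int_quadratic)
  moreover have "u \<in> KK"
  proof -
    have "Re u = (a * x + (b + 1 / 2) * y) / a" using ReI ca by (simp add: field_simps)
    moreover have "Im u / s = y / (2 * a)" using ImI ca s by (simp add: field_simps)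
    ultimately show ?thesis unfolding KK_iff s_def[symmetric] by auto
  qed
  ultimately have "u \<in> OK" using int_ring_KK by (auto simp: int_ring_def)
  then obtain \<alpha> \<beta> where ab: "u = of_int \<alpha> + of_int \<beta> * omega" by (auto simp: OK_def)
  have "real_of_int ((2 * \<alpha> + \<beta>)\<^sup>2 + int p * \<beta>\<^sup>2) = 4 * (cmod u)\<^sup>2"
    unfolding cmod_power2 by (simp add: ab power2_eq_square field_simps)
  then have eq: "(2 * \<alpha> + \<beta>)\<^sup>2 + int p * \<beta>\<^sup>2 = 4" unfolding n1 by linarith
  have "\<beta> = 0"
  proof (rule ccontr)
    assume "\<beta> \<noteq> 0"
    then have "\<beta>\<^sup>2 \<ge> 1" by (simp add: power2_eq_square) (smt (verit) mult_le_0_iff mult_eq_0_iff zero_le_square)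
    then have "int p * 1 \<le> int p * \<beta>\<^sup>2" by (intro mult_left_mono) auto
    moreover have "(2 * \<alpha> + \<beta>)\<^sup>2 \<ge> 0" by simp
    moreover have "int p \<ge> 5" using int_p_eq m_ge_2 by linarith
    ultimately show False using eq by linarith
  qed
  then have "\<alpha>\<^sup>2 = 1" using eq by (simp add: power_mult_distrib)
  then have "\<alpha> = 1 \<or> \<alpha> = -1" by (simp add: power2_eq_1_iff)
  then show ?thesis using ab \<open>\<beta> = 0\<close> by auto
qed

text \<open>Reduction theory: in a normal form of least norm in its class, b can be shifted to b1
  with |2 b1 + 1| <= a. Multiplying by (b1 + cnj omega)/a gives an equivalent ideal of norm (b1^2 +
  b1 + m)/a, and minimality yields 4 a^2 <= a^2 + p. Thus only finitely many pairs (a, b)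
  occur.\<close>

lemma finite_classes: "finite ({I. ideal_in OK I} // ideal_rel OK)"
proof -
  let ?cls = "\<lambda>I. ideal_rel OK `` {I}"
  note eqv = equiv_ideal_rel[OF subring_OK]
  have "{I. ideal_in OK I} // ideal_rel OK \<subseteq> (\<lambda>(a, b). ?cls (qideal (1, a, b))) ` (SIGMA a:{..p}. quad_roots m a)"
  proof
    fix X assume "X \<in> {I. ideal_in OK I} // ideal_rel OK"
    then obtain I where I: "ideal_in OK I" "X = ?cls I" by (auto elim: quotientE)
    define P where "P = (\<lambda>t. t \<in> triples \<and> (qideal t, I) \<in> ideal_rel OK)"
    have "(I, I) \<in> ideal_rel OK" using I eqv by (auto simp: equiv_def refl_on_def)
    then have "\<exists>t. P t" using ideal_eq_qideal[OF I(1)] unfolding P_def by blast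
    then obtain t where t: "P t" and least: "\<And>t'. P t' \<Longrightarrow> (\<lambda>(c, a, b). c ^ 2 * a) t \<le> (\<lambda>(c, a, b). c ^ 2 * a) t'"
      using ex_has_least_nat[of P _ "\<lambda>(c, a, b). c ^ 2 * a"] by blast
    obtain c a b where cab: "t = (c, a, b)" by (cases t)
    have ca: "c > 0" "a > 0" "b \<in> quad_roots m a" using t by (auto simp: P_def triples_def cab)
    have t1: "(1, a, b) \<in> triples" using ca by (simp add: triples_def)
    have M: "ideal_in OK (qideal (1, a, b))" by (rule ideal_in_qideal[OF t1])
    have "qelt c a b x y = of_nat c * qelt 1 a b x y" for x y by (simp add: qelt_def)
    then have im: "qideal (c, a, b) = (*) (of_nat c) ` qideal (1, a, b)"
      unfolding qideal_def by auto
    have "ideal_in OK (qideal (c, a, b))" using ideal_in_qideal t by (simp add: P_def cab)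
    then have "(qideal (c, a, b), qideal (1, a, b)) \<in> ideal_rel OK"
      using M OK_closed(1) by (rule ideal_relI[where b = "of_nat c"]) (use ca im in auto)
    then have rel1: "(qideal (1, a, b), I) \<in> ideal_rel OK"
      using t eqv unfolding P_def cab by (meson equivE symE transE)
    \<comment> \<open>Rounding to the nearest multiple: adding a to 2 b + 1 before the division by 2
      a places the remainder symmetrically around 0.\<close>
    define k where "k = - ((2 * b + 1 + int a) div (2 * int a))"
    define b1 where "b1 = b + int a * k"
    have b1: "\<bar>2 * b1 + 1\<bar> \<le> int a"
    proof -
      have "2 * b1 + 1 + int a = (2 * b + 1 + int a) mod (2 * int a)"
        unfolding b1_def k_def minus_mult_div_eq_mod[symmetric] by (simp add: algebra_simps)
      moreover have "0 \<le> (2 * b + 1 + int a) mod (2 * int a)" "(2 * b + 1 + int a) mod (2 * int a) < 2 * int a"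
        using ca(2) by simp_all
      ultimately show ?thesis by linarith
    qed
    have "[b1 = b] (mod int a)" by (simp add: b1_def Cong.cong_def)
    then have "int a dvd b1\<^sup>2 + b1 + int m"
      using quad_cong_dvd[of b1 b "int a" "int m"] ca(3) by (simp add: quad_roots_def)
    then obtain q where q: "b1\<^sup>2 + b1 + int m = int a * q" by (elim dvdE)
    \<comment> \<open>This \<gamma> maps a to b1 + cnj omega and b1 + omega to the integer q: it
      exchanges the outer coefficients a and q of the associated quadratic form.\<close>
    define \<gamma> where "\<gamma> = (of_int b1 + cnj omega) / of_nat a"
    have nrm: "(of_int b1 + cnj omega) * (of_int b1 + omega) = of_int (b1\<^sup>2 + b1 + int m)"
      by (rule complex_eqI) (use m_ge_2 in \<open>simp_all add: real_p_eq power2_eq_square field_simps\<close>)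
    have \<gamma>0: "\<gamma> \<noteq> 0"
    proof -
      have "Im (of_int b1 + cnj omega) \<noteq> 0" using p_gt_3 by simp
      then have "of_int b1 + cnj omega \<noteq> 0" by (metis zero_complex.sel(2))
      then show ?thesis using ca(2) by (simp add: \<gamma>_def)
    qed
    have \<gamma>M: "\<gamma> * x \<in> OK" if xM: "x \<in> qideal (1, a, b)" for x
    proof -
      obtain x1 y1 where x: "x = qelt 1 a b x1 y1" using xM unfolding mem_qideal_iff by blast
      have "of_nat a * (\<gamma> * x) = (of_int b1 + cnj omega) * x" using ca(2) by (simp add: \<gamma>_def)
      also have "\<dots> = (of_int b1 + cnj omega) * (of_nat a * of_int x1 - of_nat a * of_int k * of_int y1)
          + of_int y1 * ((of_int b1 + cnj omega) * (of_int b1 + omega))"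
        unfolding x qelt_def b1_def by (simp add: algebra_simps)
      also have "\<dots> = of_nat a * ((of_int b1 + cnj omega) * of_int (x1 - k * y1) + of_int (y1 * q))"
        unfolding nrm q by (simp add: algebra_simps)
      finally have "\<gamma> * x = (of_int b1 + cnj omega) * of_int (x1 - k * y1) + of_int (y1 * q)"
        using ca(2) by (subst (asm) mult_cancel_left) auto
      also have "\<dots> \<in> OK"
        by (intro OK_closed OK_of_int OK_cnj OK_omega)
      finally show ?thesis .
    qed
    obtain t2 where t2: "t2 \<in> triples" "(*) \<gamma> ` qideal (1, a, b) = qideal t2"
      using ideal_eq_qideal scaled_ideal(1)[OF subring_OK M \<gamma>0 \<gamma>M] by blast
    obtain c2 a2 b2 where t2': "t2 = (c2, a2, b2)" by (cases t2)
    have "(qideal t2, I) \<in> ideal_rel OK"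
      using scaled_ideal(2)[OF subring_OK M \<gamma>0 \<gamma>M] rel1 eqv unfolding t2(2) by (meson equivE transE)
    then have le2: "c ^ 2 * a \<le> c2 ^ 2 * a2" using least[of t2] t2 by (simp add: P_def cab t2')
    have "c ^ 2 * a \<le> 1 ^ 2 * a" using least[of "(1, a, b)"] t1 rel1 by (simp add: P_def cab)
    define E where "E = (2 * real_of_int b1 + 1)\<^sup>2 + real p"
    have "real (c2 ^ 2 * a2) = (cmod \<gamma>)\<^sup>2 * real a"
      using ideal_norm_scale[OF M \<gamma>0] ideal_norm_qideal[OF t1] ideal_norm_qideal[of c2 a2 b2] t2
      unfolding t2' by simp
    also have "(cmod \<gamma>)\<^sup>2 = ((b1 + 1 / 2)\<^sup>2 + p / 4) / (real a)\<^sup>2"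
      unfolding \<gamma>_def norm_divide power_divide cmod_power2 by (simp add: power2_eq_square)
    also have "(b1 + 1 / 2)\<^sup>2 + p / 4 = E / 4"
      unfolding E_def by (simp add: power2_eq_square field_simps)
    finally have f1: "real (c2 ^ 2 * a2) * (4 * real a) = E"
      using ca(2) by (simp add: power2_eq_square field_simps)
    have f2: "E = real_of_int (\<bar>2 * b1 + 1\<bar> ^ 2) + real p" by (simp add: E_def)
    have f3: "real_of_int (\<bar>2 * b1 + 1\<bar> ^ 2) \<le> real_of_int (int a ^ 2)"
      unfolding of_int_le_iff using b1 by (intro power_mono) auto
    have f4: "real (c ^ 2 * a) * (4 * real a) \<le> real (c2 ^ 2 * a2) * (4 * real a)"
      using le2 by (intro mult_right_mono) (simp_all del: of_nat_mult of_nat_power)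
    have f5: "real a * (4 * real a) \<le> real (c ^ 2 * a) * (4 * real a)"
      using ca by (intro mult_right_mono) auto
    have "real a * (4 * real a) \<le> E" using order_trans[OF f5 f4] unfolding f1 .
    also have "E \<le> real_of_int (int a ^ 2) + real p" unfolding f2 using f3 by simp
    finally have "3 * (real a)\<^sup>2 \<le> real p" by (simp add: power2_eq_square)
    moreover have "real a * 1 \<le> real a * real a" using ca by (intro mult_left_mono) auto
    ultimately have "real a \<le> real p" unfolding power2_eq_square by linarith
    then have "(a, b) \<in> (SIGMA a:{..p}. quad_roots m a)" using ca by simp
    moreover have "X = ?cls (qideal (1, a, b))"
      using rel1 eqv I(2) by (metis equiv_class_eq)
    ultimately show "X \<in> (\<lambda>(a, b). ?cls (qideal (1, a, b))) ` (SIGMA a:{..p}. quad_roots m a)" by force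
  qed
  then show ?thesis by (rule finite_subset) auto
qed

end

section \<open>The class number formula\<close>

context prime_3_mod_4
begin

text \<open>The multipliers form a fractional ideal. Multiplied by a positive integer n of J it
  becomes an ideal of \<open>OK\<close>, whose normal form provides the basis; \<kappa> = c / n
  undoes the scaling.\<close>

lemma inverse_ideal_parametrization:
  assumes J: "ideal_in OK J"
  shows "\<exists>\<kappa> a b. \<kappa> > 0 \<and> a > 0 \<and>
     bij_betw (\<lambda>(y, x). of_real \<kappa> * (of_nat a * of_int x + (of_int b + omega) * of_int y))
       UNIV {\<gamma>. \<forall>x\<in>J. \<gamma> * x \<in> OK}"
proof -
  note D = ideal_inD[OF J]
  define L where "L = {\<gamma>. \<forall>x\<in>J. \<gamma> * x \<in> OK}"
  obtain c0 a0 b0 where t0: "(c0, a0, b0) \<in> triples" "J = qideal (c0, a0, b0)" using ideal_eq_qideal[OF J] by auto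
  define n where "n = c0 * a0"
  have n: "n > 0" using t0 by (auto simp: n_def triples_def)
  have nJ: "of_nat n \<in> J" using qelt_in[of c0 a0 b0 1 0] by (simp add: t0 n_def qelt_def)
  have "ideal_in OK ((*) (of_nat n) ` L)"
    unfolding ideal_in_def
  proof (intro conjI ballI)
    show "(*) (of_nat n) ` L \<subseteq> OK" using nJ by (auto simp: L_def mult.commute)
    have "1 \<in> L" using D(1) by (auto simp: L_def)
    then have "of_nat n * 1 \<in> (*) (of_nat n) ` L" by (rule imageI)
    then show "(*) (of_nat n) ` L \<noteq> {0}"
      using n by (metis mult.right_neutral of_nat_eq_0_iff singletonD less_irrefl)
    have "0 \<in> L" using OK_closed(2) by (simp add: L_def)
    then have "of_nat n * 0 \<in> (*) (of_nat n) ` L" by (rule imageI)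
    then show "0 \<in> (*) (of_nat n) ` L" by simp
  next
    fix x y assume "x \<in> (*) (of_nat n) ` L" "y \<in> (*) (of_nat n) ` L"
    then obtain u v where uv: "u \<in> L" "v \<in> L" "x = of_nat n * u" "y = of_nat n * v" by blast
    then have "u + v \<in> L" using OK_closed(4) by (simp add: L_def distrib_right)
    moreover have "x + y = of_nat n * (u + v)" by (simp add: uv distrib_left)
    ultimately show "x + y \<in> (*) (of_nat n) ` L" by blast
  next
    fix e x assume "e \<in> OK" "x \<in> (*) (of_nat n) ` L"
    then obtain u where u: "u \<in> L" "x = of_nat n * u" by blast
    then have "e * u \<in> L" using OK_closed(5)[OF \<open>e \<in> OK\<close>] by (simp add: L_def mult.assoc)
    moreover have "e * x = of_nat n * (e * u)" by (simp add: u mult.left_commute)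
    ultimately show "e * x \<in> (*) (of_nat n) ` L" by blast
  qed
  then obtain c a b where t: "(c, a, b) \<in> triples" and L: "(*) (of_nat n) ` L = qideal (c, a, b)"
    using ideal_eq_qideal by fastforce
  have ca: "c > 0" "a > 0" using t by (auto simp: triples_def)
  define \<kappa> where "\<kappa> = real c / real n"
  define g where "g = (\<lambda>(y, x). of_real \<kappa> * (of_nat a * of_int x + (of_int b + omega) * of_int y))"
  have ng: "of_nat n * g (y, x) = qelt c a b x y" for x y
    using n by (simp add: g_def \<kappa>_def qelt_def)
  have "inj g"
  proof (rule injI)
    fix z z' assume "g z = g z'"
    obtain y x y' x' where z: "z = (y, x)" "z' = (y', x')" by (metis surj_pair)
    have "qelt c a b x y = qelt c a b x' y'"
      using \<open>g z = g z'\<close> unfolding z ng[symmetric] by simp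
    then have "int c * (int a * x + b * y) = int c * (int a * x' + b * y')" "int c * y = int c * y'"
      unfolding qelt_coords OK_coords_iff by blast+
    then show "z = z'" using ca by (simp add: z)
  qed
  moreover have "range g = L"
  proof (intro equalityI subsetI)
    fix w assume "w \<in> range g"
    then obtain y x where w: "w = g (y, x)" by auto
    have "of_nat n * w \<in> (*) (of_nat n) ` L" unfolding w ng L by (rule qelt_in)
    then show "w \<in> L" using n by auto
  next
    fix w assume "w \<in> L"
    then have "of_nat n * w \<in> qideal (c, a, b)" unfolding L[symmetric] by (rule imageI)
    then obtain x y where "of_nat n * w = of_nat n * g (y, x)" unfolding mem_qideal_iff ng by blast
    then have "w = g (y, x)" using n by simp
    then show "w \<in> range g" by blast
  qed
  ultimately have "bij_betw g UNIV L" by (simp add: bij_betw_def)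
  moreover have "\<kappa> > 0" using ca n by (simp add: \<kappa>_def)
  ultimately show ?thesis using ca(2) unfolding g_def L_def by blast
qed

lemma class_sum_lattice:
  assumes J: "ideal_in OK J"
    and S: "((\<lambda>\<gamma>. exp (- (t * ((cmod \<gamma>)\<^sup>2 * ideal_norm J)))) has_sum S) {\<gamma>. \<forall>x\<in>J. \<gamma> * x \<in> OK}"
  shows "((\<lambda>I. exp (- (t * ideal_norm I))) has_sum (S - 1) / 2) {I. (I, J) \<in> ideal_rel OK}"
proof -
  note D = ideal_inD[OF J]
  define L where "L = {\<gamma>. \<forall>x\<in>J. \<gamma> * x \<in> OK}"
  define f where "f = (\<lambda>\<gamma>. exp (- (t * ((cmod \<gamma>)\<^sup>2 * ideal_norm J))))"
  \<comment> \<open>One representative of each pair of nonzero \<gamma>, -\<gamma>. Since the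
    summand is even and equals 1 at 0, S = 1 + 2 T.\<close>
  define H where "H = {\<gamma>\<in>L. Im \<gamma> > 0 \<or> Im \<gamma> = 0 \<and> Re \<gamma> > 0}"
  have neg: "- \<gamma> \<in> L" if "\<gamma> \<in> L" for \<gamma> using that OK_closed(6) by (auto simp: L_def)
  have zL: "0 \<in> L" using OK_closed(2) by (simp add: L_def)
  have L: "L = insert 0 (H \<union> uminus ` H)"
  proof (intro equalityI subsetI)
    fix \<gamma> assume \<gamma>: "\<gamma> \<in> L"
    have "\<gamma> = 0 \<or> \<gamma> \<in> H \<or> - \<gamma> \<in> H"
      using \<gamma> neg[OF \<gamma>] by (auto simp: H_def complex_eq_iff)
    moreover have "\<gamma> = - (- \<gamma>)" by simp
    ultimately show "\<gamma> \<in> insert 0 (H \<union> uminus ` H)" by (metis UnI1 UnI2 imageI insert_iff)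
  next
    fix \<gamma> assume "\<gamma> \<in> insert 0 (H \<union> uminus ` H)"
    then show "\<gamma> \<in> L" using zL neg by (auto simp: H_def)
  qed
  have "f summable_on H"
    using S summable_on_subset[of f L H] has_sum_imp_summable unfolding f_def L_def H_def by blast
  then obtain T where T: "(f has_sum T) H" by (auto simp: summable_on_def)
  have "(f has_sum T) (uminus ` H)"
    using T by (subst has_sum_reindex) (auto simp: o_def f_def)
  moreover have "H \<inter> uminus ` H = {}" by (auto simp: H_def)
  ultimately have "(f has_sum (T + T)) (H \<union> uminus ` H)" using T by (intro has_sum_Un_disjoint)
  moreover have "0 \<notin> H \<union> uminus ` H" by (auto simp: H_def)
  ultimately have "(f has_sum (f 0 + (T + T))) L" unfolding L by (intro has_sum_insert)
  then have "S = 1 + (T + T)" using S has_sum_unique unfolding f_def L_def by fastforce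
  then have T2: "T = (S - 1) / 2" by simp
  have H0: "\<gamma> \<noteq> 0" if "\<gamma> \<in> H" for \<gamma> using that by (auto simp: H_def)
  have bij: "bij_betw (\<lambda>\<gamma>. (*) \<gamma> ` J) H {I. (I, J) \<in> ideal_rel OK}"
    unfolding bij_betw_def
  proof (intro conjI inj_onI equalityI subsetI)
    fix \<gamma> \<delta> assume gd: "\<gamma> \<in> H" "\<delta> \<in> H" and eq: "(*) \<gamma> ` J = (*) \<delta> ` J"
    \<comment> \<open>Multipliers with the same image of J differ by a stabilizer of J, hence by a
      sign, and \<open>H\<close> contains only one of the two.\<close>
    have "(*) (\<gamma> / \<delta>) ` J = (*) (1 / \<delta>) ` ((*) \<gamma> ` J)" by (simp add: image_image)
    also have "\<dots> = J" unfolding eq using H0[OF gd(2)] by (simp add: image_image)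
    finally have "\<gamma> / \<delta> = 1 \<or> \<gamma> / \<delta> = -1" by (rule ideal_stabilizer[OF J])
    then have "\<gamma> = \<delta> \<or> \<gamma> = - \<delta>" using H0[OF gd(2)] by (auto simp: field_simps)
    then show "\<gamma> = \<delta>" using gd by (auto simp: H_def)
  next
    fix I assume "I \<in> (\<lambda>\<gamma>. (*) \<gamma> ` J) ` H"
    then obtain \<gamma> where \<gamma>: "\<gamma> \<in> H" "I = (*) \<gamma> ` J" by blast
    then show "I \<in> {I. (I, J) \<in> ideal_rel OK}"
      using scaled_ideal(2)[OF subring_OK J H0[OF \<gamma>(1)]] by (auto simp: H_def L_def)
  next
    fix I assume "I \<in> {I. (I, J) \<in> ideal_rel OK}"
    then obtain x y where xy: "x \<in> OK" "x \<noteq> 0" "y \<in> OK" "y \<noteq> 0" "(*) x ` I = (*) y ` J" "ideal_in OK I"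
      by (auto elim: ideal_relE)
    have "I = (*) (1 / x) ` ((*) x ` I)" using xy(2) by (simp add: image_image)
    also have "\<dots> = (*) (y / x) ` J" unfolding xy(5) by (simp add: image_image)
    finally have I: "I = (*) (y / x) ` J" .
    have IOK: "I \<subseteq> OK" using ideal_inD(1)[OF xy(6)] .
    have \<gamma>L: "y / x \<in> L" unfolding L_def using IOK unfolding I by blast
    have \<gamma>0: "y / x \<noteq> 0" using xy by simp
    \<comment> \<open>Both \<gamma> and -\<gamma> produce I, so the multiplier can be taken in
      \<open>H\<close>.\<close>
    have "J = uminus ` J"
      using D(4)[of "-1"] OK_of_int[of "-1"] by (force simp: image_iff)
    have "(*) (- (y / x)) ` J = (*) (y / x) ` uminus ` J" by (simp add: image_image)
    also have "\<dots> = I" unfolding I \<open>J = uminus ` J\<close>[symmetric] ..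
    finally have "(*) (- (y / x)) ` J = I" .
    moreover have "y / x \<in> H \<or> - (y / x) \<in> H"
      using \<gamma>L \<gamma>0 L by (auto simp del: divide_eq_0_iff)
    ultimately show "I \<in> (\<lambda>\<gamma>. (*) \<gamma> ` J) ` H" using I by blast
  qed
  have "((\<lambda>\<gamma>. exp (- (t * ideal_norm ((*) \<gamma> ` J)))) has_sum T) H"
    using T by (rule has_sum_cong[THEN iffD1, rotated]) (simp add: f_def ideal_norm_scale[OF J H0])
  then show ?thesis
    unfolding T2 using has_sum_reindex_bij_betw[OF bij, of "\<lambda>I. exp (- (t * ideal_norm I))"] by simp
qed

lemma class_sum_asymptotic:
  assumes J: "ideal_in OK J"
  shows "\<exists>c T. (\<forall>\<^sub>F t in at_right 0. ((\<lambda>I. exp (- (t * ideal_norm I))) has_sum T t) {I. (I, J) \<in> ideal_rel OK})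
     \<and> ((\<lambda>t. T t - c / t) \<longlongrightarrow> - 1 / 2) (at_right 0)"
proof -
  obtain \<kappa> a b where ka: "\<kappa> > 0" "a > 0" and
    bij: "bij_betw (\<lambda>(y, x). of_real \<kappa> * (of_nat a * of_int x + (of_int b + omega) * of_int y))
       UNIV {\<gamma>. \<forall>x\<in>J. \<gamma> * x \<in> OK}"
    using inverse_ideal_parametrization[OF J] by blast
  define g where "g = (\<lambda>(y, x). of_real \<kappa> * (of_nat a * of_int x + (of_int b + omega) * of_int y))"
  define N where "N = ideal_norm J"
  obtain c0 a0 b0 where t0: "(c0, a0, b0) \<in> triples" "J = qideal (c0, a0, b0)" using ideal_eq_qideal[OF J] by auto
  have N: "N > 0" unfolding N_def t0(2) ideal_norm_qideal[OF t0(1)] using t0(1) by (auto simp: triples_def)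
  \<comment> \<open>Completing the square: |a x + (b + omega) y|^2 = (a x + (b + 1/2) y)^2 + (p/4)
    y^2, scaled by \<kappa>^2 N(J), with a factored out of the first square.\<close>
  define A where "A = \<kappa>\<^sup>2 * (real a)\<^sup>2 * N"
  define B where "B = \<kappa>\<^sup>2 * real p / 4 * N"
  define \<sigma> where "\<sigma> = (of_int b + 1 / 2) / real a"
  have AB: "A > 0" "B > 0" using ka N p_gt_3 by (simp_all add: A_def B_def)
  have q: "A * (of_int x + \<sigma> * of_int y)\<^sup>2 + B * (of_int y)\<^sup>2 = (cmod (g (y, x)))\<^sup>2 * N" for x y :: int
  proof -
    have "real a * (of_int x + \<sigma> * of_int y) = real a * of_int x + (of_int b + 1 / 2) * of_int y"
      using ka by (simp add: \<sigma>_def field_simps)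
    moreover have "A * (of_int x + \<sigma> * of_int y)\<^sup>2 = \<kappa>\<^sup>2 * (real a * (of_int x + \<sigma> * of_int y))\<^sup>2 * N"
      unfolding A_def power_mult_distrib by simp
    ultimately have A': "A * (of_int x + \<sigma> * of_int y)\<^sup>2 = \<kappa>\<^sup>2 * (real a * of_int x + (of_int b + 1 / 2) * of_int y)\<^sup>2 * N"
      by (simp only:)
    have "Re (g (y, x)) = \<kappa> * (real a * of_int x + (of_int b + 1 / 2) * of_int y)"
      "Im (g (y, x)) = \<kappa> * (sqrt (real p) / 2 * of_int y)"
      by (simp_all add: g_def)
    then have "(cmod (g (y, x)))\<^sup>2 = \<kappa>\<^sup>2 * (real a * of_int x + (of_int b + 1 / 2) * of_int y)\<^sup>2 + \<kappa>\<^sup>2 * (real p / 4 * (of_int y)\<^sup>2)"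
      unfolding cmod_power2 by (simp only:) (simp add: power_mult_distrib power_divide)
    then show ?thesis unfolding A' B_def by (simp add: algebra_simps)
  qed
  obtain c T where T: "\<forall>\<^sub>F t in at_right 0. ((\<lambda>(y::int, x::int).
        exp (- (t * (A * (of_int x + \<sigma> * of_int y)\<^sup>2 + B * (of_int y)\<^sup>2)))) has_sum T t) UNIV"
    and lim: "((\<lambda>t. T t - c / t) \<longlongrightarrow> 0) (at_right 0)"
    using gaussian_lattice_sum[OF AB, of \<sigma>] by blast
  have "\<forall>\<^sub>F t in at_right 0. ((\<lambda>I. exp (- (t * ideal_norm I))) has_sum (T t - 1) / 2) {I. (I, J) \<in> ideal_rel OK}"
    using T
  proof eventually_elim
    case (elim t)
    have "(\<lambda>z. exp (- (t * ((cmod (g z))\<^sup>2 * N)))) = (\<lambda>(y::int, x::int).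
        exp (- (t * (A * (of_int x + \<sigma> * of_int y)\<^sup>2 + B * (of_int y)\<^sup>2))))"
      by (auto simp: q)
    then have "((\<lambda>z. exp (- (t * ((cmod (g z))\<^sup>2 * N)))) has_sum T t) UNIV" using elim by simp
    then have "((\<lambda>\<gamma>. exp (- (t * ((cmod \<gamma>)\<^sup>2 * N)))) has_sum T t) {\<gamma>. \<forall>x\<in>J. \<gamma> * x \<in> OK}"
      using has_sum_reindex_bij_betw[OF bij[folded g_def], of "\<lambda>\<gamma>. exp (- (t * ((cmod \<gamma>)\<^sup>2 * N)))"] by simp
    then show ?case unfolding N_def by (rule class_sum_lattice[OF J])
  qed
  moreover have "((\<lambda>t. (T t - 1) / 2 - (c / 2) / t) \<longlongrightarrow> - 1 / 2) (at_right 0)"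
  proof -
    have "((\<lambda>t. (T t - c / t) / 2 - 1 / 2) \<longlongrightarrow> 0 / 2 - 1 / 2) (at_right 0)"
      by (intro tendsto_intros lim) simp
    moreover have "(\<lambda>t. (T t - c / t) / 2 - 1 / 2) = (\<lambda>t. (T t - 1) / 2 - (c / 2) / t)"
      by (auto simp: field_simps)
    ultimately show ?thesis by simp
  qed
  ultimately show ?thesis by (intro exI conjI)
qed

section \<open>Oddness of the character and summation over ideals by norm\<close>

lemma chi_add_p: "chi (n + p) = chi n"
  by (rule chi_cong) (simp add: Cong.cong_def)

lemma chi_minus:
  assumes "0 < d" "d < p"
  shows "chi (p - d) = - chi d"
proof -
  have "Legendre (-1) (int p) = -1"
  proof -
    have "odd ((p - 1) div 2)" using p_m by presburger
    then show ?thesis using Legendre_minus_one[OF prime_p] p_gt_3 by simp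
  qed
  moreover have "chi (p - d) = Legendre (- int d) (int p)"
  proof -
    have e: "int (p - d) = - int d + int p" using assms by simp
    have "[int (p - d) = - int d] (mod int p)" unfolding e by (simp add: Cong.cong_def)
    then have "[int (p - d) = 0] (mod int p) \<longleftrightarrow> [- int d = 0] (mod int p)"
      "QuadRes (int p) (int (p - d)) \<longleftrightarrow> QuadRes (int p) (- int d)"
      unfolding QuadRes_def by (meson cong_sym cong_trans)+
    then show ?thesis by (simp add: chi_def Legendre_def)
  qed
  moreover have "Legendre (- int d) (int p) = Legendre (-1) (int p) * Legendre (int d) (int p)"
    using Legendre_mult[OF prime_p, of "-1" "int d"] p_gt_3 by simp
  ultimately show ?thesis by (simp add: chi_def)
qed

lemma chi_0: "chi 0 = 0" by (simp add: chi_0_iff)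

lemma sum_chi: "(\<Sum>d<p. chi d) = 0"
proof -
  have "(\<Sum>d\<in>{1..<p}. chi d) = (\<Sum>d\<in>{1..<p}. - chi d)"
    by (rule sum.reindex_bij_witness[where i = "\<lambda>d. p - d" and j = "\<lambda>d. p - d"])
       (use chi_minus in auto)
  then have "(\<Sum>d\<in>{1..<p}. chi d) = 0" by (simp add: sum_negf)
  moreover have "{..<p} = insert 0 {1..<p}" using p_gt_3 by auto
  ultimately show ?thesis by (simp add: chi_0)
qed

definition norm_fibre :: "nat \<Rightarrow> (nat \<times> nat \<times> int) set" where
  "norm_fibre n = {(c, a, b) \<in> triples. c ^ 2 * a = n}"

text \<open>With n fixed, c^2 and b determine the triple, since a = n / c^2. Hence the fibre
  decomposes over the square divisors of n.\<close>

lemma card_norm_fibre: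
  assumes n: "n > 0"
  shows "finite (norm_fibre n)" "int (card (norm_fibre n)) = ideal_count n"
proof -
  let ?S = "SIGMA d:{d. d dvd n \<and> is_nth_power 2 d}. quad_roots m (n div d)"
  have bij: "bij_betw (\<lambda>(c, a, b). (c ^ 2, b)) (norm_fibre n) ?S"
    unfolding bij_betw_def
  proof (intro conjI inj_onI equalityI subsetI)
    fix t t' assume "t \<in> norm_fibre n" "t' \<in> norm_fibre n" "(\<lambda>(c, a, b). (c ^ 2, b)) t = (\<lambda>(c, a, b). (c ^ 2, b)) t'"
    then show "t = t'"
      by (auto simp: norm_fibre_def triples_def power2_eq_iff_nonneg)
  next
    fix z assume "z \<in> (\<lambda>(c, a, b). (c ^ 2, b)) ` norm_fibre n"
    then show "z \<in> ?S" by (auto simp: norm_fibre_def triples_def)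
  next
    fix z assume "z \<in> ?S"
    then obtain c b where z: "z = (c ^ 2, b)" "c ^ 2 dvd n" "b \<in> quad_roots m (n div c ^ 2)"
      by (auto elim: is_nth_powerE)
    have "c > 0" using z(2) n by (auto intro: Nat.gr0I)
    moreover have "c ^ 2 * (n div c ^ 2) = n" using z(2) by simp
    moreover from this have "n div c ^ 2 > 0" using n by (metis mult_0_right neq0_conv)
    ultimately have "(c, n div c ^ 2, b) \<in> norm_fibre n"
      using z(3) by (simp add: norm_fibre_def triples_def)
    then show "z \<in> (\<lambda>(c, a, b). (c ^ 2, b)) ` norm_fibre n" unfolding z(1) by force
  qed
  have fin: "finite {d. d dvd n \<and> is_nth_power 2 d}" using n by simp
  then have "finite ?S" by (intro finite_SigmaI) auto
  then show "finite (norm_fibre n)" using bij bij_betw_finite by blast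
  have "int (card (norm_fibre n)) = int (card ?S)" using bij_betw_same_card[OF bij] by simp
  also have "\<dots> = (\<Sum>d | d dvd n \<and> is_nth_power 2 d. int (card (quad_roots m (n div d))))"
    by (subst card_SigmaI) (use fin in auto)
  also have "\<dots> = ideal_count n"
    unfolding ideal_count_def by (rule sum.mono_neutral_cong_left) (use n in auto)
  finally show "int (card (norm_fibre n)) = ideal_count n" .
qed

lemma ideals_sum:
  assumes t: "((\<lambda>n. real_of_int (\<Sum>d | d dvd n. chi d) * exp (- (real n * t))) has_sum S) {1..}"
  shows "((\<lambda>I. exp (- (t * ideal_norm I))) has_sum S) {I. ideal_in OK I}"
proof -
  define f where "f = (\<lambda>(n::nat, z::nat \<times> nat \<times> int). exp (- (real n * t)))"
  have inner: "((\<lambda>z. f (n, z)) has_sum (real_of_int (\<Sum>d | d dvd n. chi d) * exp (- (real n * t)))) (norm_fibre n)"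
    if "n \<in> {1..}" for n
  proof (rule has_sum_finiteI)
    have n: "n > 0" using that by simp
    show "finite (norm_fibre n)" by (rule card_norm_fibre(1)[OF n])
    have "real_of_int (\<Sum>d | d dvd n. chi d) = real (card (norm_fibre n))"
      unfolding ideal_count_eq[OF n, symmetric] card_norm_fibre(2)[OF n, symmetric] by simp
    then show "real_of_int (\<Sum>d | d dvd n. chi d) * exp (- (real n * t)) = sum (\<lambda>z. f (n, z)) (norm_fibre n)"
      by (simp add: f_def)
  qed
  have "f summable_on Sigma {1..} norm_fibre"
    by (rule summable_on_SigmaI[OF inner]) (use t has_sum_imp_summable in \<open>auto simp: f_def\<close>)
  then have sig: "(f has_sum S) (Sigma {1..} norm_fibre)"
    using inner t by (rule has_sum_SigmaI[rotated 2])
  have "((\<lambda>z. exp (- (t * ideal_norm (qideal z)))) has_sum S) triples \<longleftrightarrow> (f has_sum S) (Sigma {1..} norm_fibre)"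
    by (rule has_sum_reindex_bij_witness[where j = "\<lambda>(c, a, b). (c ^ 2 * a, (c, a, b))" and i = snd])
       (auto simp: norm_fibre_def f_def ideal_norm_qideal mult.commute triples_def Suc_le_eq)
  then have "((\<lambda>z. exp (- (t * ideal_norm (qideal z)))) has_sum S) triples" using sig by simp
  then show ?thesis
    using has_sum_reindex_bij_betw[OF bij_qideal, of "\<lambda>I. exp (- (t * ideal_norm I))"] by simp
qed

text \<open>The difference of the two expressions is (a - b)/t and has a finite limit; multiplying
  by t shows a = b. So constant terms may be compared without knowing the polar
  coefficients.\<close>

lemma asymptotic_constant_unique:
  fixes f :: "real \<Rightarrow> real"
  assumes "((\<lambda>t. f t - a / t) \<longlongrightarrow> u) (at_right 0)" "((\<lambda>t. f t - b / t) \<longlongrightarrow> v) (at_right 0)"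
  shows "u = v"
proof -
  have nt: "at_right (0::real) \<noteq> bot" by simp
  have d: "((\<lambda>t. (f t - b / t) - (f t - a / t)) \<longlongrightarrow> v - u) (at_right 0)"
    using assms by (intro tendsto_diff)
  have "((\<lambda>t. t * ((f t - b / t) - (f t - a / t))) \<longlongrightarrow> 0 * (v - u)) (at_right 0)"
    by (intro tendsto_mult d tendsto_ident_at)
  then have "((\<lambda>t. t * ((f t - b / t) - (f t - a / t))) \<longlongrightarrow> 0) (at_right 0)" by simp
  moreover have "\<forall>\<^sub>F t in at_right 0. t * ((f t - b / t) - (f t - a / t)) = a - b"
    unfolding eventually_at_filter by (intro always_eventually) (auto simp: field_simps)
  ultimately have "((\<lambda>_. a - b) \<longlongrightarrow> 0) (at_right (0::real))"
    by (rule Lim_transform_eventually)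
  then have "a = b" using tendsto_unique[OF nt tendsto_const] by fastforce
  then have "((\<lambda>t. 0) \<longlongrightarrow> v - u) (at_right (0::real))" using d by simp
  then show ?thesis using tendsto_unique[OF nt tendsto_const] by fastforce
qed

theorem class_number_formula: "real (class_number KK) = - (\<Sum>d<p. real d * real_of_int (chi d)) / real p"
proof -
  define R where "R = (\<Sum>d<p. real d * real_of_int (chi d))"
  define Q where "Q = {I. ideal_in OK I} // ideal_rel OK"
  note eqv = equiv_ideal_rel[OF subring_OK]
  have finQ: "finite Q" unfolding Q_def by (rule finite_classes)
  have "\<exists>B T. (\<forall>t>0. ((\<lambda>n. (\<Sum>d | d dvd n. real_of_int (chi d)) * exp (- (real n * t))) has_sum T t) {1..}) \<and>
           ((\<lambda>t. T t - B / t) \<longlongrightarrow> (\<Sum>d<p. real d * real_of_int (chi d)) / (2 * real p)) (at_right 0)"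
  proof (rule lambert_series_asymptotic)
    show "real_of_int (chi (n + p)) = real_of_int (chi n)" for n by (simp add: chi_add_p)
    show "\<bar>real_of_int (chi n)\<bar> \<le> 1" for n using chi_cases[of n] by auto
    show "(\<Sum>d<p. real_of_int (chi d)) = 0" using sum_chi by (simp flip: of_int_sum)
  qed (use p_gt_3 chi_0 in auto)
  then obtain B T where T: "\<And>t. t > 0 \<Longrightarrow> ((\<lambda>n. real_of_int (\<Sum>d | d dvd n. chi d) * exp (- (real n * t))) has_sum T t) {1..}"
    and TB: "((\<lambda>t. T t - B / t) \<longlongrightarrow> R / (2 * real p)) (at_right 0)"
    by (auto simp: R_def)
  define P where "P = (\<lambda>X c T. (\<forall>\<^sub>F t in at_right 0. ((\<lambda>I. exp (- (t * ideal_norm I))) has_sum T t) X)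
     \<and> ((\<lambda>t. T t - c / t) \<longlongrightarrow> - 1 / 2) (at_right 0))"
  have "\<forall>X\<in>Q. \<exists>c T. P X c T"
  proof
    fix X assume X: "X \<in> Q"
    obtain J where J: "ideal_in OK J" "X = ideal_rel OK `` {J}" using X unfolding Q_def by (auto elim: quotientE)
    have "X = {I. (I, J) \<in> ideal_rel OK}" using eqv unfolding J(2) by (auto simp: equiv_def sym_def)
    then show "\<exists>c T. P X c T" unfolding P_def using class_sum_asymptotic[OF J(1)] by simp
  qed
  from bchoice[OF this] obtain c where "\<forall>X\<in>Q. \<exists>T. P X (c X) T" by blast
  from bchoice[OF this] obtain V where "\<forall>X\<in>Q. P X (c X) (V X)" by blast
  then have V: "\<forall>\<^sub>F t in at_right 0. ((\<lambda>I. exp (- (t * ideal_norm I))) has_sum V X t) X"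
    and cV: "((\<lambda>t. V X t - c X / t) \<longlongrightarrow> - 1 / 2) (at_right 0)" if "X \<in> Q" for X
    using that unfolding P_def by blast+
  \<comment> \<open>Finiteness of the class group gives one neighbourhood of 0 for all
    classes.\<close>
  have "\<forall>\<^sub>F t in at_right 0. \<forall>X\<in>Q. ((\<lambda>I. exp (- (t * ideal_norm I))) has_sum V X t) X"
    using finQ V by (intro eventually_ball_finite) auto
  moreover have "\<forall>\<^sub>F t in at_right (0::real). t > 0" by (simp add: eventually_at_filter)
  ultimately have "\<forall>\<^sub>F t in at_right 0. (\<Sum>X\<in>Q. V X t) = T t"
  proof eventually_elim
    case (elim t)
    have "((\<lambda>I. exp (- (t * ideal_norm I))) has_sum (\<Sum>X\<in>Q. V X t)) (\<Union>X\<in>Q. X)"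
      using elim(1) finQ quotient_disj[OF eqv] unfolding Q_def by (intro sum_has_sum) auto
    moreover have "(\<Union>X\<in>Q. X) = {I. ideal_in OK I}"
      unfolding Q_def using Union_quotient[OF eqv] by simp
    ultimately show ?case using ideals_sum[OF T[OF elim(2)]] has_sum_unique by metis
  qed
  then have "((\<lambda>t. (\<Sum>X\<in>Q. V X t) - B / t) \<longlongrightarrow> R / (2 * real p)) (at_right 0)"
    using TB by (subst tendsto_cong[where g = "\<lambda>t. T t - B / t"]) (auto elim: eventually_mono)
  moreover have "((\<lambda>t. (\<Sum>X\<in>Q. V X t) - (\<Sum>X\<in>Q. c X) / t) \<longlongrightarrow> (\<Sum>X\<in>Q. - 1 / 2)) (at_right 0)"
  proof -
    have "((\<lambda>t. \<Sum>X\<in>Q. V X t - c X / t) \<longlongrightarrow> (\<Sum>X\<in>Q. - 1 / 2)) (at_right 0)"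
      by (intro tendsto_sum cV)
    then show ?thesis by (simp add: sum_subtractf sum_divide_distrib)
  qed
  ultimately have "R / (2 * real p) = (\<Sum>X\<in>Q. - 1 / 2)" by (rule asymptotic_constant_unique)
  then have "real (card Q) = - R / real p" using p_gt_3 by (simp add: field_simps)
  then show ?thesis unfolding class_number_KK Q_def[symmetric] R_def .
qed

end

section \<open>Digit expansions and quadratic residues\<close>

text \<open>The k-th tail T of the expansion equals R_k / p with R_k = r b^k mod p, by induction.
  From 0 <= T <= 1 the next numerator z lies between 0 and p and is congruent to R_(k+1); these
  agree once z = p is excluded.\<close>

lemma digit_recurrence:
  fixes a :: "nat \<Rightarrow> nat" and p b r :: nat
  assumes p: "prime p" "\<not> p dvd b" and b: "b \<ge> 2" and r: "0 < r" "r < p"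
    and a: "\<And>k. k \<ge> 1 \<Longrightarrow> a k \<le> b - 1"
    and sums: "(\<lambda>k. real (a (Suc k)) / real b ^ Suc k) sums (real r / real p)"
  shows "int p * int (a (Suc k)) = int b * int (r * b ^ k mod p) - int (r * b ^ Suc k mod p)"
proof -
  have p0: "p > 0" using p(1) by (rule prime_gt_0_nat)
  define T where "T = (\<lambda>k. \<Sum>i. real (a (Suc (k + i))) / real b ^ Suc i)"
  have geo: "(\<lambda>i. (real b - 1) * (1 / real b) ^ Suc i) sums 1"
  proof -
    have "(\<lambda>i. (real b - 1) / real b * (1 / real b) ^ i) sums ((real b - 1) / real b * (1 / (1 - 1 / real b)))"
      using b by (intro sums_mult geometric_sums) auto
    also have "(real b - 1) / real b * (1 / (1 - 1 / real b)) = 1" using b by (simp add: field_simps)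
    finally show ?thesis by simp
  qed
  have le: "real (a (Suc (k + i))) / real b ^ Suc i \<le> (real b - 1) * (1 / real b) ^ Suc i" for k i
  proof -
    have "real (a (Suc (k + i))) \<le> real b - 1" using a[of "Suc (k + i)"] b by linarith
    then have "real (a (Suc (k + i))) / real b ^ Suc i \<le> (real b - 1) / real b ^ Suc i"
      by (intro divide_right_mono) auto
    then show ?thesis unfolding power_one_over by simp
  qed
  have sm: "summable (\<lambda>i. real (a (Suc (k + i))) / real b ^ Suc i)" for k
    by (rule summable_comparison_test[OF _ sums_summable[OF geo]]) (use le in \<open>auto intro!: exI[of _ 0]\<close>)
  have T0: "T k \<ge> 0" for k
    unfolding T_def by (rule suminf_nonneg[OF sm]) auto
  have T1: "T k \<le> 1" for k
  proof -
    have "T k \<le> (\<Sum>i. (real b - 1) * (1 / real b) ^ Suc i)"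
      unfolding T_def by (rule suminf_le[OF le sm sums_summable[OF geo]])
    also have "\<dots> = 1" by (rule sums_unique[OF geo, symmetric])
    finally show ?thesis .
  qed
  have step: "T (Suc k) = real b * T k - real (a (Suc k))" for k
  proof -
    have "T k = real (a (Suc (k + 0))) / real b ^ Suc 0 + (\<Sum>i. real (a (Suc (k + Suc i))) / real b ^ Suc (Suc i))"
      unfolding T_def using suminf_split_head[OF sm[of k]] by simp
    also have "(\<Sum>i. real (a (Suc (k + Suc i))) / real b ^ Suc (Suc i)) = (\<Sum>i. (1 / real b) * (real (a (Suc (Suc k + i))) / real b ^ Suc i))"
      by simp
    also have "\<dots> = 1 / real b * T (Suc k)"
      unfolding T_def by (rule suminf_mult[OF sm])
    finally show ?thesis using b by (simp add: field_simps)
  qed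
  define R where "R = (\<lambda>k. r * b ^ k mod p)"
  have main: "T k = real (R k) / real p \<Longrightarrow> int p * int (a (Suc k)) = int b * int (R k) - int (R (Suc k))" for k
  proof -
    assume Tk: "T k = real (R k) / real p"
    define z where "z = int b * int (R k) - int p * int (a (Suc k))"
    have "T (Suc k) = of_int z / real p" unfolding step Tk z_def using p0 by (simp add: field_simps)
    then have e: "of_int z = real p * T (Suc k)" using p0 by simp
    have "0 \<le> real p * T (Suc k)" "real p * T (Suc k) \<le> real p * 1"
      using T0 T1 by (auto intro: mult_left_mono simp del: mult_1_right)
    then have "(0::real) \<le> of_int z" "real_of_int z \<le> of_int (int p)" unfolding e by simp_all
    then have z: "0 \<le> z" "z \<le> int p" by (simp_all only: of_int_0_le_iff of_int_le_iff)
    have "z mod int p = int b * int (R k) mod int p"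
      unfolding z_def by (simp add: mod_diff_eq[symmetric] mod_mult_self1_is_0)
    also have "\<dots> = int (R (Suc k))"
      unfolding R_def by (simp add: zmod_int mod_mult_right_eq mult_ac)
    finally have zm: "z mod int p = int (R (Suc k))" .
    \<comment> \<open>The value z = p would be a tail consisting of digits b - 1 only; it is
      impossible because the residue r b^(k+1) is nonzero modulo p.\<close>
    have "\<not> p dvd r" using r by (auto dest: dvd_imp_le)
    then have "\<not> p dvd r * b ^ Suc k" using p by (metis prime_dvd_mult_iff prime_dvd_power)
    then have "R (Suc k) \<noteq> 0" by (simp add: R_def dvd_eq_mod_eq_0)
    then have "z \<noteq> int p" using zm by auto
    then have "z = int (R (Suc k))" using z zm by simp
    then show ?thesis by (simp add: z_def)
  qed
  have "T k = real (R k) / real p" for k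
  proof (induction k)
    case 0
    have "T 0 = real r / real p" unfolding T_def using sums_unique[OF sums] by simp
    then show ?case using r by (simp add: R_def)
  next
    case (Suc k)
    have "real_of_int (int p * int (a (Suc k))) = of_int (int b * int (R k) - int (R (Suc k)))"
      by (simp only: main[OF Suc])
    then have "real p * real (a (Suc k)) = real b * real (R k) - real (R (Suc k))" by simp
    then show ?case unfolding step Suc using p0 by (simp add: field_simps)
  qed
  then show ?thesis using main unfolding R_def by blast
qed

section \<open>Quadratic residues as cosets of the powers of b\<close>

context prime_3_mod_4
begin

definition quad_residues :: "nat set" where "quad_residues = {x\<in>{1..<p}. chi x = 1}"

lemma finite_quad_residues [simp]: "finite quad_residues" by (simp add: quad_residues_def)

lemma chi_eq_indicator: "x \<in> {1..<p} \<Longrightarrow> chi x = 2 * of_bool (x \<in> quad_residues) - 1"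
  using chi_cases[of x] chi_0_iff[of x] by (auto simp: quad_residues_def dest: dvd_imp_le)

lemma lessThan_p: "{..<p} = insert 0 {1..<p}" using p_gt_3 by auto

lemma card_quad_residues:
  assumes "(\<Sum>d<p. chi d) = 0" "chi 0 = 0"
  shows "2 * card quad_residues = p - 1"
proof -
  have "0 = (\<Sum>x\<in>{1..<p}. chi x)" using assms unfolding lessThan_p by simp
  also have "\<dots> = (\<Sum>x\<in>{1..<p}. 2 * of_bool (x \<in> quad_residues) - 1)"
    by (intro sum.cong refl chi_eq_indicator)
  also have "\<dots> = 2 * (\<Sum>x\<in>{1..<p}. of_bool (x \<in> quad_residues)) - int (p - 1)"
    by (simp add: sum_subtractf flip: sum_distrib_left)
  also have "(\<Sum>x\<in>{1..<p}. of_bool (x \<in> quad_residues)) = int (card ({1..<p} \<inter> quad_residues))"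
    by (simp add: Int_def)
  also have "{1..<p} \<inter> quad_residues = quad_residues" by (auto simp: quad_residues_def)
  finally show ?thesis by linarith
qed

text \<open>On nonzero residues chi is twice the indicator of the quadratic residues minus 1, so the
  weighted sum of chi is twice the sum of the residues minus p (p - 1)/2.\<close>

lemma sum_quad_residues:
  "4 * (\<Sum>x\<in>quad_residues. real x) = real p * (real p - 1) + 2 * (\<Sum>d<p. real d * real_of_int (chi d))"
proof -
  have "(\<Sum>d<p. real d * real_of_int (chi d)) = (\<Sum>x\<in>{1..<p}. real x * real_of_int (chi x))"
    unfolding lessThan_p by simp
  also have "\<dots> = (\<Sum>x\<in>{1..<p}. 2 * (real x * of_bool (x \<in> quad_residues)) - real x)"
    by (intro sum.cong refl) (simp only: chi_eq_indicator, simp add: algebra_simps)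
  also have "\<dots> = 2 * (\<Sum>x\<in>{1..<p}. real x * of_bool (x \<in> quad_residues)) - (\<Sum>x\<in>{1..<p}. real x)"
    by (simp only: sum_subtractf sum_distrib_left)
  also have "(\<Sum>x\<in>{1..<p}. real x * of_bool (x \<in> quad_residues)) = (\<Sum>x\<in>quad_residues. real x)"
    by (rule sum.mono_neutral_cong_right) (auto simp: quad_residues_def)
  also have "(\<Sum>x\<in>{1..<p}. real x) = (\<Sum>x<p. real x)" unfolding lessThan_p by simp
  also have "\<dots> = real p * (real p - 1) / 2"
    by (induction p) (simp_all add: field_simps)
  finally show ?thesis by simp
qed

text \<open>The powers g^(2 j) represent the cosets of the subgroup generated by b in the group of
  squares. Injectivity and the equality of cardinalities give surjectivity.\<close>

lemma bij_quad_residues: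
  assumes b: "chi b = 1" and d: "d = ord p b" and g: "residue_primroot p g"
    and card: "2 * card quad_residues = p - 1"
  shows "2 * d * ((p - 1) div (2 * d)) = p - 1" "d > 0"
    "bij_betw (\<lambda>(j, k). g ^ (2 * j) * b ^ k mod p) ({..<(p - 1) div (2 * d)} \<times> {..<d}) quad_residues"
proof -
  have nb: "\<not> p dvd b" using b chi_0_iff[of b] by auto
  then have cb: "coprime p b" using prime_p by (simp add: prime_imp_coprime)
  show d0: "d > 0" unfolding d using cb by simp
  have cg: "coprime p g" and og: "ord p g = p - 1"
    using g prime_p by (auto simp: residue_primroot_def totient_prime)
  define n where "n = (p - 1) div (2 * d)"
  \<comment> \<open>Euler's criterion makes d divide (p - 1)/2, so the division defining the number
    of cosets is exact.\<close>
  have "[chi b = int b ^ ((p - 1) div 2)] (mod int p)"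
    unfolding chi_def using euler_criterion[OF prime_p] p_gt_3 by simp
  then have "[int (b ^ ((p - 1) div 2)) = int 1] (mod int p)" using b by (simp add: cong_sym)
  then have "[b ^ ((p - 1) div 2) = 1] (mod p)" by (simp only: cong_int_iff)
  then have "d dvd (p - 1) div 2" unfolding d using ord_divides by blast
  moreover have "2 * ((p - 1) div 2) = p - 1" using p_m by presburger
  ultimately have "2 * d dvd p - 1" by (metis mult_dvd_mono dvd_refl)
  then show nd: "2 * d * ((p - 1) div (2 * d)) = p - 1" by simp
  have bd: "[b ^ d = 1] (mod p)" unfolding d by (rule ord)
  have inj: "inj_on (\<lambda>(j, k). g ^ (2 * j) * b ^ k mod p) ({..<n} \<times> {..<d})"
  proof (rule inj_onI, clarify)
    fix j k j' k' assume jk: "j < n" "k < d" "j' < n" "k' < d"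
      and "g ^ (2 * j) * b ^ k mod p = g ^ (2 * j') * b ^ k' mod p"
    then have eq: "[g ^ (2 * j) * b ^ k = g ^ (2 * j') * b ^ k'] (mod p)" by (simp add: Cong.cong_def)
    \<comment> \<open>Raising to the power d eliminates b; the exponents 2 i d stay below p - 1, the
      order of g, so that j is recovered first and then k.\<close>
    have red: "[(g ^ (2 * i) * b ^ l) ^ d = g ^ (2 * i * d)] (mod p)" for i l
    proof -
      have "(g ^ (2 * i) * b ^ l) ^ d = g ^ (2 * i * d) * (b ^ d) ^ l"
        by (simp add: power_mult_distrib power_mult[symmetric] mult_ac)
      moreover have "[g ^ (2 * i * d) * (b ^ d) ^ l = g ^ (2 * i * d) * 1 ^ l] (mod p)"
        by (intro cong_mult cong_pow bd cong_refl)
      ultimately show ?thesis by simp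
    qed
    have "[g ^ (2 * j * d) = g ^ (2 * j' * d)] (mod p)"
      using cong_pow[OF eq, of d] red cong_sym cong_trans by meson
    then have "[2 * j * d = 2 * j' * d] (mod (p - 1))"
      using order_divides_expdiff[OF cg] og by simp
    moreover have "2 * i * d < p - 1" if "i < n" for i
    proof -
      have "2 * i * d < 2 * n * d" using that d0 by simp
      also have "2 * n * d = p - 1" using nd by (simp add: n_def mult_ac)
      finally show ?thesis .
    qed
    ultimately have "2 * j * d = 2 * j' * d" using jk cong_less_modulus_unique_nat by blast
    then have jj: "j = j'" using d0 by simp
    have "coprime (g ^ (2 * j)) p" using cg by (simp add: coprime_commute)
    then have "[b ^ k = b ^ k'] (mod p)" using eq unfolding jj[symmetric] by (simp add: cong_mult_lcancel_nat)
    then have "[k = k'] (mod d)" using order_divides_expdiff[OF cb] d by simp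
    then have "k = k'" using jk cong_less_modulus_unique_nat by blast
    with jj show "j = j' \<and> k = k'" by simp
  qed
  have "(\<lambda>(j, k). g ^ (2 * j) * b ^ k mod p) ` ({..<n} \<times> {..<d}) \<subseteq> quad_residues"
  proof clarify
    fix j k
    have "\<not> p dvd g" using cg prime_p by (metis coprime_absorb_left not_prime_unit)
    then have "chi g * chi g = 1" using chi_cases[of g] by (auto simp: chi_0_iff)
    then have "chi (g ^ (2 * j) * b ^ k) = 1"
      using b by (simp add: chi_mult chi_power power_mult power2_eq_square)
    moreover have "chi (g ^ (2 * j) * b ^ k mod p) = chi (g ^ (2 * j) * b ^ k)"
      by (rule chi_cong) (simp add: Cong.cong_def)
    moreover have "g ^ (2 * j) * b ^ k mod p \<noteq> 0"
      using \<open>\<not> p dvd g\<close> nb prime_p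
      by (metis dvd_eq_mod_eq_0 prime_dvd_mult_iff prime_dvd_power)
    ultimately show "g ^ (2 * j) * b ^ k mod p \<in> quad_residues"
      using p_gt_3 by (simp add: quad_residues_def)
  qed
  moreover have "card ((\<lambda>(j, k). g ^ (2 * j) * b ^ k mod p) ` ({..<n} \<times> {..<d})) = card quad_residues"
  proof -
    have "2 * (n * d) = p - 1" using nd by (simp add: n_def mult_ac)
    then have "n * d = card quad_residues" using card by simp
    then show ?thesis by (subst card_image[OF inj]) simp
  qed
  ultimately have "(\<lambda>(j, k). g ^ (2 * j) * b ^ k mod p) ` ({..<n} \<times> {..<d}) = quad_residues"
    by (intro card_subset_eq) auto
  with inj show "bij_betw (\<lambda>(j, k). g ^ (2 * j) * b ^ k mod p) ({..<(p - 1) div (2 * d)} \<times> {..<d}) quad_residues"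
    unfolding n_def by (simp add: bij_betw_def)
qed

end

theorem theorem3:
  fixes p b d g :: nat
    and bj :: "nat \<Rightarrow> nat"
    and a :: "nat \<Rightarrow> nat \<Rightarrow> nat"
    and S :: "nat \<Rightarrow> nat"
  assumes "prime p" and "p > 3" and "[p = 3] (mod 4)"
    and "b \<ge> 2" and "\<not> p dvd b" and "QuadRes (int p) (int b)"
    and "d = ord p b"
    and "residue_primroot p g"
    and "\<And>j. j < (p - 1) div (2 * d) \<Longrightarrow> bj j = g ^ (2 * j) mod p"
    and "\<And>j k. j < (p - 1) div (2 * d) \<Longrightarrow> k \<ge> 1 \<Longrightarrow> a j k \<in> {0..b - 1}"
    and "\<And>j. j < (p - 1) div (2 * d) \<Longrightarrow>
           (\<lambda>k. real (a j (Suc k)) / real b ^ Suc k) sums (real (bj j) / real p)"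
    and "\<And>j. j < (p - 1) div (2 * d) \<Longrightarrow> S j = (\<Sum>k=1..d. a j k)"
  shows "(\<forall>j < (p - 1) div (2 * d). \<forall>k\<ge>1. a j (k + d) = a j k) \<and>
         real (\<Sum>j < (p - 1) div (2 * d). S j) =
           (real b - 1) * (real p - 1) / 4 -
           (real b - 1) * relative_class_number (quadratic_field (- int p)) / 2"
proof -
  define m where "m = (p + 1) div 4"
  have "p mod 4 = 3" using assms(3) by (simp add: Cong.cong_def)
  then have m: "p + 1 = 4 * m" unfolding m_def by presburger
  interpret prime_3_mod_4 p m
    by unfold_locales (use assms m in auto)
  define n where "n = (p - 1) div (2 * d)"
  define R where "R = (\<lambda>j k. g ^ (2 * j) * b ^ k mod p)"
  have "chi b = 1"
    using assms(5,6) chi_0_iff[of b] by (auto simp: chi_def Legendre_def split: if_splits)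
  note bij = bij_quad_residues[OF \<open>chi b = 1\<close> assms(7,8) card_quad_residues[OF sum_chi chi_0]]
  have p0: "p > 0" using p_gt_3 by simp
  have ng: "\<not> p dvd g"
  proof -
    have "coprime p g" using assms(8) by (simp add: residue_primroot_def)
    then show ?thesis using prime_p by (metis coprime_absorb_left not_prime_unit)
  qed
  have digits: "int p * int (a j (Suc k)) = int b * int (R j k) - int (R j (Suc k))" if j: "j < n" for j k
  proof -
    have "\<not> p dvd g ^ (2 * j)" using ng prime_p prime_dvd_power by blast
    then have "bj j > 0" "bj j < p" using assms(9)[of j] j p0 by (auto simp: n_def dvd_eq_mod_eq_0)
    moreover have "a j k \<le> b - 1" if "k \<ge> 1" for k
      using assms(10)[of j k] j that by (simp add: n_def)
    ultimately have "int p * int (a j (Suc k)) = int b * int (bj j * b ^ k mod p) - int (bj j * b ^ Suc k mod p)"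
      using assms(1,4,5) assms(11)[of j] j by (intro digit_recurrence) (auto simp: n_def)
    moreover have "bj j * b ^ l mod p = R j l" for l
      using assms(9)[of j] j by (simp add: n_def R_def mod_mult_left_eq)
    ultimately show ?thesis by (simp only:)
  qed
  have period: "R j (k + d) = R j k" for j k
  proof -
    have "[b ^ d = 1] (mod p)" unfolding assms(7) by (rule ord)
    then have "[g ^ (2 * j) * b ^ k * b ^ d = g ^ (2 * j) * b ^ k * 1] (mod p)"
      by (intro cong_mult cong_refl)
    then show ?thesis by (simp add: R_def Cong.cong_def power_add mult.assoc)
  qed
  have "a j (k + d) = a j k" if j: "j < n" and k: "k \<ge> 1" for j k
  proof -
    obtain i where i: "k = Suc i" using k by (cases k) auto
    \<comment> \<open>A digit is determined by two consecutive residues, and these have period d.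
      Starting at k >= 1 matches the indexing of digits by \<open>Suc\<close>.\<close>
    have "int p * int (a j (Suc (i + d))) = int p * int (a j (Suc i))"
      using period[of j i] period[of j "Suc i"] unfolding digits[OF j] by simp
    then show ?thesis using p0 by (simp add: i)
  qed
  moreover have "real (\<Sum>j<n. S j) =
           (real b - 1) * (real p - 1) / 4 -
           (real b - 1) * relative_class_number (quadratic_field (- int p)) / 2"
  proof -
    have Sj: "real p * real (S j) = (real b - 1) * (\<Sum>k<d. real (R j k))" if j: "j < n" for j
    proof -
      have "S j = (\<Sum>k<d. a j (Suc k))"
        using assms(12)[of j] j by (simp add: n_def sum.atLeast1_atMost_eq)
      then have "real p * real (S j) = (\<Sum>k<d. real_of_int (int p * int (a j (Suc k))))"
        by (simp add: sum_distrib_left)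
      also have "\<dots> = real b * (\<Sum>k<d. real (R j k)) - (\<Sum>k<d. real (R j (Suc k)))"
        unfolding digits[OF j] by (simp add: sum_subtractf sum_distrib_left)
      \<comment> \<open>A shift over a full period replaces the residue at 0 by the equal residue at
        d, leaving the factor b - 1.\<close>
      also have "(\<Sum>k<d. real (R j (Suc k))) = (\<Sum>k<d. real (R j k))"
        using period[of j 0] sum.lessThan_Suc_shift[of "\<lambda>k. real (R j k)" d] by simp
      finally show ?thesis by (simp add: algebra_simps)
    qed
    have "real p * real (\<Sum>j<n. S j) = (\<Sum>j<n. real p * real (S j))" by (simp add: sum_distrib_left)
    also have "\<dots> = (\<Sum>j<n. (real b - 1) * (\<Sum>k<d. real (R j k)))" by (intro sum.cong refl Sj) simp
    also have "\<dots> = (real b - 1) * (\<Sum>(j, k)\<in>{..<n} \<times> {..<d}. real (R j k))"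
      by (simp add: sum_distrib_left sum.cartesian_product case_prod_unfold)
    also have "(\<Sum>(j, k)\<in>{..<n} \<times> {..<d}. real (R j k)) = (\<Sum>x\<in>quad_residues. real x)"
      using sum.reindex_bij_betw[OF bij(3), of real] by (simp add: n_def R_def case_prod_unfold)
    finally have eq: "real p * real (\<Sum>j<n. S j) = (real b - 1) * (\<Sum>x\<in>quad_residues. real x)" .
    define h where "h = real (class_number KK)"
    have "relative_class_number KK = h"
      by (simp add: relative_class_number_def class_number_KK_real h_def)
    moreover have "(\<Sum>d<p. real d * real_of_int (chi d)) = - real p * h"
      using class_number_formula p0 by (simp add: h_def field_simps)
    then have "(\<Sum>x\<in>quad_residues. real x) = real p * ((real p - 1) / 4 - h / 2)"
      using sum_quad_residues by (simp add: field_simps)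
    with eq have "real p * real (\<Sum>j<n. S j) = real p * ((real b - 1) * ((real p - 1) / 4 - h / 2))"
      by (simp only: mult.left_commute)
    then have "real (\<Sum>j<n. S j) = (real b - 1) * ((real p - 1) / 4 - h / 2)"
      using p0 by (subst (asm) mult_cancel_left) auto
    ultimately show ?thesis by (simp add: algebra_simps)
  qed
  ultimately show ?thesis unfolding n_def by blast
qed

end
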